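(* Suppose that $A$ is a piecewise constant matrix-valued function. Let $(\lambda,u)$ be an eigenpair of the continuous eigenvalue problem and $(\lambda_{\rm GCR},u_{\rm GCR})$ the corresponding discrete eigenpair of the generalized Crouzeix–Raviart (GCR) method. Assume that $u\in H^1_0(\Omega)\cap H^{1+s}(\Omega)$ with $0<s\le 1$ and that $h^{2s}\lesssim\|\nabla_{\rm NC}(u-u_{\rm GCR})\|_A^2$. Then $$\lambda_{\rm GCR}\le\lambda,$$ provided that $h$ is small enough.
   Context: $\Omega\subset\mathbb{R}^n$ is a bounded polytopal domain, exactly covered by shape-regular partitions $\mathcal{T}$ into $n$-simplices, with $h_K=\mathrm{diam}(K)$ and $h=\max_{K\in\mathcal{T}}h_K$. $p\lesssim q$ means $p\le Cq$ with a constant $C>0$ independent of the mesh size (uniform over the shape-regular family of partitions considered); "provided that $h$ is small enough" means: there is $h_0>0$ such that the conclusion holds for all partitions of the family with $h<h_0$. $(\cdot,\cdot)$ and $\|\cdot\|$ are the $L^2(\Omega)$ inner product and norm; $\nabla_{\rm NC}$ is the elementwise gradient; $\|\nabla_{\rm NC}v\|_A=(A\nabla_{\rm NC}v,\nabla_{\rm NC}v)^{1/2}$. $A$ is a symmetric matrix-valued function on $\Omega$ with $(q,q)\lesssim(Aq,q)$ for all $q\in(L^2(\Omega))^n$; here it is constant on each $K\in\mathcal{T}$, and $\bar A=A$ is used to define the GCR space. $\mathcal{E}(\Omega)$, $\mathcal{E}(\partial\Omega)$ are the sets of interior and boundary $(n-1)$-dimensional faces of $\mathcal{T}$; $[\cdot]$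 is the jump across a face. GCR space: for $K\in\mathcal{T}$ with vertices $a_p=(x_{1p},\dots,x_{np})$, $1\le p\le n+1$, centroid $\mathrm{mid}(K)$, and $\bar B|_K=(\bar A|_K)^{-1}=(b_{ij})$, put $$H=\sum_{i} b_{ii}\sum_{p<q}(x_{ip}-x_{iq})^2+2\sum_{i<j}b_{ij}\sum_{p<q}(x_{ip}-x_{iq})(x_{jp}-x_{jq}),$$ $$\phi_K(x)=\frac{n+2}{2}-\frac{n(n+1)^2(n+2)}{2H}(x-\mathrm{mid}(K))^T\bar B|_K(x-\mathrm{mid}(K)).$$ $V_{\rm CR}$ is the space of $v\in L^2(\Omega)$ with $v|_K\in P_1(K)$ for all $K\in\mathcal{T}$, $\int_E[v]\,ds=0$ for all $E\in\mathcal{E}(\Omega)$, $\int_Ev\,ds=0$ for all $E\in\mathcal{E}(\partial\Omega)$; $V_{\rm B}=\{v\in L^2(\Omega):v|_K\in\mathrm{span}\{\phi_K\}\ \forall K\in\mathcal{T}\}$; $V_{\rm GCR}=V_{\rm CR}+V_{\rm B}$. Eigenvalue problems: $(\lambda,u)\in\mathbb{R}\times H^1_0(\Omega)$, $\|u\|=1$, satisfies $(A\nabla u,\nabla v)=\lambda(u,v)$ for all $v\in H^1_0(\Omega)$; $(\lambda_{\rm GCR},u_{\rm GCR})\in\mathbb{R}\times V_{\rm GCR}$, $\|u_{\rm GCR}\|=1$, satisfies $(A\nabla_{\rm NC}u_{\rm GCR},\nabla_{\rm NC}v)=\lambda_{\rm GCR}(u_{\rm GCR},v)$ for all $v\in V_{\rm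 GCR}$. Eigenvalues are ordered increasingly with multiplicity. "Corresponding" means that $\lambda$ and $\lambda_{\rm GCR}$ have the same index and the eigenfunctions are matched so that the standard a priori estimate (recalled in the paper from the theory of nonconforming eigenvalue approximation) holds for $u\in H^1_0(\Omega)\cap H^{1+s}(\Omega)$: $$\|u-u_{\rm GCR}\|+h^s\|\nabla_{\rm NC}(u-u_{\rm GCR})\|_A\lesssim h^{2s}|u|_{1+s},$$ where $|\cdot|_{1+s}$ is the $H^{1+s}(\Omega)$ seminorm. *)

theory Defs
  imports "HOL-Analysis.Analysis"
begin

section \<open>Lebesgue and Sobolev spaces\<close>

text \<open>Elements of function spaces are represented by functions on the whole of \<open>\<real>\<^sup>n\<close>. Only their
  values almost everywhere on the underlying set matter.\<close>

definition L2_space :: "(real^'n) set \<Rightarrow> (real^'n \<Rightarrow> 'b::euclidean_space) set" where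
  "L2_space S = {f. set_borel_measurable lebesgue S f \<and>
                    set_integrable lebesgue S (\<lambda>x. (norm (f x))\<^sup>2)}"

definition L2_inner :: "(real^'n) set \<Rightarrow> (real^'n \<Rightarrow> 'b::euclidean_space) \<Rightarrow> (real^'n \<Rightarrow> 'b) \<Rightarrow> real" where
  "L2_inner S f g = (LINT x:S|lebesgue. f x \<bullet> g x)"

definition L2_norm :: "(real^'n) set \<Rightarrow> (real^'n \<Rightarrow> 'b::euclidean_space) \<Rightarrow> real" where
  "L2_norm S f = sqrt (L2_inner S f f)"

definition partial :: "'n \<Rightarrow> (real^'n \<Rightarrow> real) \<Rightarrow> real^'n \<Rightarrow> real" where
  "partial i f x = frechet_derivative f (at x) (axis i 1)"

primrec cont_diff :: "nat \<Rightarrow> (real^'n \<Rightarrow> real) \<Rightarrow> bool" where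
  "cont_diff 0 f \<longleftrightarrow> continuous_on UNIV f"
| "cont_diff (Suc k) f \<longleftrightarrow> (\<forall>x. f differentiable (at x)) \<and> (\<forall>i. cont_diff k (partial i f))"

definition test_function :: "(real^'n) set \<Rightarrow> (real^'n \<Rightarrow> real) \<Rightarrow> bool" where
  "test_function S \<phi> \<longleftrightarrow> (\<forall>k. cont_diff k \<phi>) \<and>
     compact (closure {x. \<phi> x \<noteq> 0}) \<and> closure {x. \<phi> x \<noteq> 0} \<subseteq> S"

definition is_weak_grad :: "(real^'n) set \<Rightarrow> (real^'n \<Rightarrow> real) \<Rightarrow> (real^'n \<Rightarrow> real^'n) \<Rightarrow> bool" where
  "is_weak_grad S v g \<longleftrightarrow>
     (\<forall>C. compact C \<and> C \<subseteq> S \<longrightarrow> v absolutely_integrable_on C \<and> g absolutely_integrable_on C) \<and>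
     (\<forall>\<phi> i. test_function S \<phi> \<longrightarrow>
        (LINT x:S|lebesgue. v x * partial i \<phi> x) = - (LINT x:S|lebesgue. g x $ i * \<phi> x))"

text \<open>A weak gradient is unique only up to null sets; one representative is chosen. All uses below
  are under integrals.\<close>

definition weak_grad :: "(real^'n) set \<Rightarrow> (real^'n \<Rightarrow> real) \<Rightarrow> real^'n \<Rightarrow> real^'n" where
  "weak_grad S v = (SOME g. is_weak_grad S v g)"

definition H1 :: "(real^'n) set \<Rightarrow> (real^'n \<Rightarrow> real) set" where
  "H1 S = {v \<in> L2_space S. \<exists>g \<in> L2_space S. is_weak_grad S v g}"

definition H1_norm :: "(real^'n) set \<Rightarrow> (real^'n \<Rightarrow> real) \<Rightarrow> real" where
  "H1_norm S v = sqrt ((L2_norm S v)\<^sup>2 + (L2_norm S (weak_grad S v))\<^sup>2)"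

definition H1_0 :: "(real^'n) set \<Rightarrow> (real^'n \<Rightarrow> real) set" where
  "H1_0 S = {v \<in> H1 S. \<forall>\<epsilon>>0. \<exists>\<phi>. test_function S \<phi> \<and> H1_norm S (\<lambda>x. v x - \<phi> x) < \<epsilon>}"

text \<open>The space \<open>H\<^sup>1\<^sup>+\<^sup>s\<close> for \<open>0 < s \<le> 1\<close>: second weak derivatives in \<open>L\<^sup>2\<close> if \<open>s = 1\<close>, and the
  Sobolev-Slobodeckij seminorm of the gradient if \<open>s < 1\<close>.\<close>

definition slobodeckij_sq :: "(real^'n) set \<Rightarrow> real \<Rightarrow> (real^'n \<Rightarrow> real^'n) \<Rightarrow> ennreal" where
  "slobodeckij_sq S s g =
     (\<integral>\<^sup>+x\<in>S. (\<integral>\<^sup>+y\<in>S. ennreal ((norm (g x - g y))\<^sup>2 / norm (x - y) powr (real CARD('n) + 2 * s))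
        \<partial>lebesgue) \<partial>lebesgue)"

definition H1s :: "(real^'n) set \<Rightarrow> real \<Rightarrow> (real^'n \<Rightarrow> real) set" where
  "H1s S s = {v \<in> H1 S.
     if s = 1 then \<forall>i. (\<lambda>x. weak_grad S v x $ i) \<in> H1 S
     else slobodeckij_sq S s (weak_grad S v) < \<infinity>}"

definition H1s_seminorm :: "(real^'n) set \<Rightarrow> real \<Rightarrow> (real^'n \<Rightarrow> real) \<Rightarrow> real" where
  "H1s_seminorm S s v =
     (if s = 1 then sqrt (\<Sum>i\<in>UNIV. (L2_norm S (weak_grad S (\<lambda>x. weak_grad S v x $ i)))\<^sup>2)
      else sqrt (enn2real (slobodeckij_sq S s (weak_grad S v))))"


section \<open>Polytopal domains and simplicial partitions\<close>

text \<open>The condition \<open>interior (closure \<Omega>) = \<Omega>\<close> excludes slits, which a partition with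
  \<open>\<Union>\<T> = closure \<Omega>\<close> cannot resolve.\<close>

definition polytopal_domain :: "(real^'n) set \<Rightarrow> bool" where
  "polytopal_domain \<Omega> \<longleftrightarrow> open \<Omega> \<and> connected \<Omega> \<and> bounded \<Omega> \<and> \<Omega> \<noteq> {} \<and>
     interior (closure \<Omega>) = \<Omega> \<and>
     (\<exists>\<P>. finite \<P> \<and> (\<forall>P\<in>\<P>. polytope P) \<and> closure \<Omega> = \<Union>\<P>)"

text \<open>Simplices are closed. \<^const>\<open>triangulation\<close> contains the conformity condition that two
  simplices meet in a common (possibly empty) face.\<close>

definition simplicial_partition :: "(real^'n) set \<Rightarrow> (real^'n) set set \<Rightarrow> bool" where
  "simplicial_partition \<Omega> \<T> \<longleftrightarrow> triangulation \<T> \<and>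
     (\<forall>K\<in>\<T>. int CARD('n) simplex K) \<and> \<Union>\<T> = closure \<Omega>"

definition mesh_size :: "(real^'n) set set \<Rightarrow> real" where
  "mesh_size \<T> = Max (diameter ` \<T>)"

definition shape_regular :: "(real^'n) set set set \<Rightarrow> bool" where
  "shape_regular \<F> \<longleftrightarrow>
     (\<exists>\<sigma>>0. \<forall>\<T>\<in>\<F>. \<forall>K\<in>\<T>. \<exists>x. cball x (\<sigma> * diameter K) \<subseteq> K)"

definition faces :: "(real^'n) set set \<Rightarrow> (real^'n) set set" where
  "faces \<T> = {E. \<exists>K\<in>\<T>. E facet_of K}"

definition boundary_faces :: "(real^'n) set \<Rightarrow> (real^'n) set set \<Rightarrow> (real^'n) set set" where
  "boundary_faces \<Omega> \<T> = {E \<in> faces \<T>. E \<subseteq> frontier \<Omega>}"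

definition interior_faces :: "(real^'n) set \<Rightarrow> (real^'n) set set \<Rightarrow> (real^'n) set set" where
  "interior_faces \<Omega> \<T> = faces \<T> - boundary_faces \<Omega> \<T>"

text \<open>Let \<open>H = affine hull E\<close> be the hyperplane spanned by a face \<open>E\<close>. By Fubini, the image of
  Lebesgue measure on the slab of thickness 1 around \<open>H\<close> under the orthogonal projection onto \<open>H\<close>
  is the \<open>(n-1)\<close>-dimensional surface measure on \<open>H\<close> (a unit point mass if \<open>n = 1\<close>).\<close>

definition face_measure :: "(real^'n) set \<Rightarrow> (real^'n) measure" where
  "face_measure E = distr (restrict_space lborel {x. infdist x (affine hull E) \<le> 1/2}) borel
     (closest_point (affine hull E))"

definition face_integral :: "(real^'n) set \<Rightarrow> (real^'n \<Rightarrow> real) \<Rightarrow> real" where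
  "face_integral E f = (LINT x:E|face_measure E. f x)"


section \<open>The GCR space\<close>

definition vertices :: "(real^'n) set \<Rightarrow> (real^'n) set" where
  "vertices K = {a. a extreme_point_of K}"

definition mid :: "(real^'n) set \<Rightarrow> real^'n" where
  "mid K = (1 / (real CARD('n) + 1)) *\<^sub>R (\<Sum>a\<in>vertices K. a)"

text \<open>Neighbouring closed simplices share faces, so a piecewise constant function is required to be
  constant only on the interiors. Its value on \<open>K\<close> is then its value at the centroid.\<close>

definition piecewise_constant :: "(real^'n) set set \<Rightarrow> (real^'n \<Rightarrow> 'b) \<Rightarrow> bool" where
  "piecewise_constant \<T> f \<longleftrightarrow> (\<forall>K\<in>\<T>. \<exists>c. \<forall>x\<in>interior K. f x = c)"

definition B_bar :: "(real^'n \<Rightarrow> real^'n^'n) \<Rightarrow> (real^'n) set \<Rightarrow> real^'n^'n" where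
  "B_bar A K = matrix_inv (A (mid K))"

text \<open>The sum over \<open>p < q\<close> is half the sum over all ordered pairs of vertices, since the summand is
  symmetric in \<open>p, q\<close> and vanishes for \<open>p = q\<close>. Likewise, \<open>2 \<Sum>\<^bsub>i<j\<^esub>\<close> is the sum over all
  \<open>i \<noteq> j\<close>, since \<open>B_bar A K\<close> is symmetric for symmetric \<open>A\<close>.\<close>

definition edge_sum :: "(real^'n) set \<Rightarrow> 'n \<Rightarrow> 'n \<Rightarrow> real" where
  "edge_sum K i j =
     (\<Sum>a\<in>vertices K. \<Sum>a'\<in>vertices K. (a $ i - a' $ i) * (a $ j - a' $ j)) / 2"

definition H_const :: "(real^'n \<Rightarrow> real^'n^'n) \<Rightarrow> (real^'n) set \<Rightarrow> real" where
  "H_const A K = (\<Sum>i\<in>UNIV. B_bar A K $ i $ i * edge_sum K i i)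
     + (\<Sum>i\<in>UNIV. \<Sum>j\<in>UNIV - {i}. B_bar A K $ i $ j * edge_sum K i j)"

definition gcr_bubble :: "(real^'n \<Rightarrow> real^'n^'n) \<Rightarrow> (real^'n) set \<Rightarrow> real^'n \<Rightarrow> real" where
  "gcr_bubble A K x = (let n = real CARD('n) in
     (n + 2) / 2 - n * (n + 1)\<^sup>2 * (n + 2) / (2 * H_const A K)
       * ((x - mid K) \<bullet> (B_bar A K *v (x - mid K))))"

text \<open>Below, \<open>p K\<close> is the affine function with which \<open>v\<close> agrees on \<open>K\<close>; the jump of \<open>v\<close> across a
  face common to \<open>K\<close> and \<open>K'\<close> is \<open>p K - p K'\<close>.\<close>

definition V_CR :: "(real^'n) set \<Rightarrow> (real^'n) set set \<Rightarrow> (real^'n \<Rightarrow> real) set" where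
  "V_CR \<Omega> \<T> = {v \<in> L2_space \<Omega>. \<exists>p.
     (\<forall>K\<in>\<T>. (\<exists>a b. p K = (\<lambda>x. a \<bullet> x + b)) \<and> (AE x in lebesgue. x \<in> K \<longrightarrow> v x = p K x)) \<and>
     (\<forall>E\<in>interior_faces \<Omega> \<T>. \<forall>K\<in>\<T>. \<forall>K'\<in>\<T>. E facet_of K \<and> E facet_of K' \<and> K \<noteq> K'
        \<longrightarrow> face_integral E (\<lambda>x. p K x - p K' x) = 0) \<and>
     (\<forall>E\<in>boundary_faces \<Omega> \<T>. \<forall>K\<in>\<T>. E facet_of K \<longrightarrow> face_integral E (p K) = 0)}"

definition V_B :: "(real^'n \<Rightarrow> real^'n^'n) \<Rightarrow> (real^'n) set \<Rightarrow> (real^'n) set set \<Rightarrow> (real^'n \<Rightarrow> real) set" where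
  "V_B A \<Omega> \<T> = {v \<in> L2_space \<Omega>.
     \<forall>K\<in>\<T>. \<exists>c. AE x in lebesgue. x \<in> K \<longrightarrow> v x = c * gcr_bubble A K x}"

definition V_GCR :: "(real^'n \<Rightarrow> real^'n^'n) \<Rightarrow> (real^'n) set \<Rightarrow> (real^'n) set set \<Rightarrow> (real^'n \<Rightarrow> real) set" where
  "V_GCR A \<Omega> \<T> = {\<lambda>x. v x + w x | v w. v \<in> V_CR \<Omega> \<T> \<and> w \<in> V_B A \<Omega> \<T>}"


section \<open>Eigenvalue problems\<close>

text \<open>Interiors of distinct simplices are disjoint, so the following sum has at most one term: on
  \<open>interior K\<close> it is the weak gradient of the restriction of \<open>v\<close> to \<open>interior K\<close>.\<close>

definition nc_grad :: "(real^'n) set set \<Rightarrow> (real^'n \<Rightarrow> real) \<Rightarrow> real^'n \<Rightarrow> real^'n" where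
  "nc_grad \<T> v x = (\<Sum>K | K \<in> \<T> \<and> x \<in> interior K. weak_grad (interior K) v x)"

definition A_inner :: "(real^'n \<Rightarrow> real^'n^'n) \<Rightarrow> (real^'n) set \<Rightarrow>
    (real^'n \<Rightarrow> real^'n) \<Rightarrow> (real^'n \<Rightarrow> real^'n) \<Rightarrow> real" where
  "A_inner A \<Omega> q r = L2_inner \<Omega> (\<lambda>x. A x *v q x) r"

definition A_norm :: "(real^'n \<Rightarrow> real^'n^'n) \<Rightarrow> (real^'n) set \<Rightarrow> (real^'n \<Rightarrow> real^'n) \<Rightarrow> real" where
  "A_norm A \<Omega> q = sqrt (A_inner A \<Omega> q q)"

definition eigenpair :: "(real^'n \<Rightarrow> real^'n^'n) \<Rightarrow> (real^'n) set \<Rightarrow> real \<Rightarrow> (real^'n \<Rightarrow> real) \<Rightarrow> bool" where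
  "eigenpair A \<Omega> \<mu> w \<longleftrightarrow> w \<in> H1_0 \<Omega> \<and> L2_norm \<Omega> w = 1 \<and>
     (\<forall>v\<in>H1_0 \<Omega>. A_inner A \<Omega> (weak_grad \<Omega> w) (weak_grad \<Omega> v) = \<mu> * L2_inner \<Omega> w v)"

definition gcr_eigenpair :: "(real^'n \<Rightarrow> real^'n^'n) \<Rightarrow> (real^'n) set \<Rightarrow> (real^'n) set set \<Rightarrow>
    real \<Rightarrow> (real^'n \<Rightarrow> real) \<Rightarrow> bool" where
  "gcr_eigenpair A \<Omega> \<T> \<mu> w \<longleftrightarrow> w \<in> V_GCR A \<Omega> \<T> \<and> L2_norm \<Omega> w = 1 \<and>
     (\<forall>v\<in>V_GCR A \<Omega> \<T>. A_inner A \<Omega> (nc_grad \<T> w) (nc_grad \<T> v) = \<mu> * L2_inner \<Omega> w v)"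

text \<open>\<open>\<mu>\<close> is the \<open>k\<close>-th eigenvalue (counting from 1) in an increasing enumeration with multiplicity
  of the eigenvalues of the problem with eigenpairs \<open>P\<close>. The enumeration \<open>lam\<close> is finite for a
  discrete problem and infinite for the continuous one. It is accompanied by orthogonal
  eigenfunctions \<open>w\<close>; as no eigenfunction is orthogonal to all of them, each eigenvalue occurs as
  often as its multiplicity.\<close>

definition kth_eigenvalue :: "(real^'n) set \<Rightarrow> (real \<Rightarrow> (real^'n \<Rightarrow> real) \<Rightarrow> bool) \<Rightarrow> nat \<Rightarrow> real \<Rightarrow> bool" where
  "kth_eigenvalue \<Omega> P k \<mu> \<longleftrightarrow> (\<exists>I lam w.
     (I = {1..} \<or> (\<exists>N. I = {1..N})) \<and>
     (\<forall>i\<in>I. P (lam i) (w i)) \<and>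
     (\<forall>i\<in>I. \<forall>j\<in>I. i \<le> j \<longrightarrow> lam i \<le> lam j) \<and>
     (\<forall>i\<in>I. \<forall>j\<in>I. i \<noteq> j \<longrightarrow> L2_inner \<Omega> (w i) (w j) = 0) \<and>
     (\<forall>\<nu> v. P \<nu> v \<longrightarrow> (\<exists>i\<in>I. L2_inner \<Omega> v (w i) \<noteq> 0)) \<and>
     k \<in> I \<and> \<mu> = lam k)"

end

theory Submission
  imports Defs
begin

text \<open>
  Let \<open>\<Pi>u\<close> in the GCR space have the same face means and element means as \<open>u\<close>. For every \<open>w\<close> in the GCR
  space, \<open>A \<nabla>w\<close> is on each simplex a constant plus a multiple of \<open>x - mid K\<close>, a field with constant
  divergence and constant normal components on the faces, so \<open>A \<nabla>w\<close> is orthogonal to \<open>\<nabla>(u - \<Pi>u)\<close>.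
  Testing the discrete problem with \<open>\<Pi>u\<close> gives
  \<open>\<lambda> - \<lambda>\<^sub>h = e\<^sup>2 - \<lambda>\<^sub>h \<parallel>u - u\<^sub>h\<parallel>\<^sup>2 - 2 \<lambda>\<^sub>h (u - \<Pi>u, u\<^sub>h)\<close> with the energy error \<open>e\<close> of \<open>u\<^sub>h\<close>.
  As \<open>u - \<Pi>u\<close> has vanishing element means, applying the Poincare inequality twice bounds the last
  inner product by a multiple of \<open>h\<^sup>2 e\<close>. By saturation \<open>h\<^sup>s\<close> is bounded by \<open>e\<close>, so for small \<open>h\<close> the
  term \<open>e\<^sup>2\<close> dominates.

  Traces are avoided: the mean of \<open>u\<close> over the face opposite to a vertex \<open>a\<close> of \<open>K\<close> enters through the
  integral of \<open>(x - a) \<bullet> \<nabla>u + n u\<close> over \<open>K\<close>.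
\<close>

section \<open>Smooth bump functions\<close>

text \<open>The bubble buys one power of h. Preserving face means alone would give the orthogonality
  for piecewise affine functions, but the remaining inner product would then only be bounded by a
  multiple of h e, and for s = 1 saturation turns this into a multiple of e^2 without a small
  factor. Once element means are preserved as well, the mean of the discrete eigenfunction can be
  subtracted, and the second Poincare inequality supplies the missing power. No consistency error
  occurs: the weak equation for u is tested with u only.

  \<open>weak_grad\<close> is a choice, so explicit gradients may replace it only after uniqueness
  almost everywhere, which needs enough test functions; hence the bump functions. Elements of
  \<open>H1_0\<close> are accessible only as limits of test functions, so everything used about u
  (fluxes, means, Poincare) is put in a form that is continuous under L2 convergence of function and
  gradient. Exact integrals over simplices come from affine maps that permute vertices; unknown
  Jacobians are recovered by inserting the constant 1.\<close>

definition flat :: "nat \<Rightarrow> real \<Rightarrow> real" where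
  "flat k t = (if 0 < t then exp (- inverse t) * inverse t ^ k else 0)"

lemma flat_tendsto_0: "(flat k \<longlongrightarrow> 0) (at_right 0)"
proof -
  have "((\<lambda>t. inverse t ^ k / exp (inverse t)) \<longlongrightarrow> (0::real)) (at_right 0)"
    by (rule filterlim_compose[OF tendsto_power_div_exp_0 filterlim_inverse_at_top_right])
  moreover have "\<forall>\<^sub>F t in at_right 0. inverse t ^ k / exp (inverse t) = flat k t"
    by (auto simp: eventually_at_filter flat_def exp_minus field_simps)
  ultimately show ?thesis
    by (auto intro: Lim_transform_eventually)
qed

text \<open>Powers of 1/t are carried along so that the family is closed under differentiation. At 0
  the right difference quotient of \<open>flat k\<close> is \<open>flat (k+1)\<close>, which tends
  to 0 because the exponential beats every power.\<close>

lemma DERIV_flat: "(flat k has_real_derivative flat (k+2) t - k * flat (k+1) t) (at t)"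
proof -
  consider "t > 0" | "t < 0" | "t = 0" by linarith
  then show ?thesis
  proof cases
    case 1
    have "((\<lambda>t. exp (- inverse t) * inverse t ^ k) has_real_derivative flat (k+2) t - k * flat (k+1) t) (at t)"
    proof -
      have d1: "((\<lambda>t. inverse t ^ k) has_real_derivative - real k * inverse t ^ (k + 1)) (at t)"
      proof (cases k)
        case (Suc m)
        with 1 show ?thesis
          using DERIV_power[OF DERIV_inverse, of t k UNIV] by (simp add: power2_eq_square algebra_simps)
      qed simp
      have d2: "((\<lambda>t::real. exp (- inverse t)) has_real_derivative exp (- inverse t) * inverse t ^ 2) (at t)"
        using 1 by (auto intro!: derivative_eq_intros simp: power2_eq_square field_simps)
      have "exp (- inverse t) * inverse t ^ 2 * inverse t ^ k + - real k * inverse t ^ (k + 1) * exp (- inverse t)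
        = flat (k+2) t - k * flat (k+1) t"
        using 1 by (simp add: flat_def power2_eq_square algebra_simps)
      then show ?thesis
        using DERIV_mult[OF d2 d1] by simp
    qed
    then show ?thesis
      by (rule has_field_derivative_transform_within_open[where S="{0<..}"])
         (use 1 in \<open>auto simp: flat_def\<close>)
  next
    case 2
    have "((\<lambda>t. 0) has_real_derivative flat (k+2) t - k * flat (k+1) t) (at t)"
      using 2 by (auto simp: flat_def)
    then show ?thesis
      by (rule has_field_derivative_transform_within_open[where S="{..<0}"])
         (use 2 in \<open>auto simp: flat_def\<close>)
  next
    case 3
    have "((\<lambda>h. (flat k h - flat k 0) / (h - 0)) \<longlongrightarrow> 0) (at 0)"
    proof (rule filterlim_split_at)
      have "\<forall>\<^sub>F h in at_left 0. (flat k h - flat k 0) / (h - 0) = 0"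
        by (auto simp: eventually_at_filter flat_def)
      then show "((\<lambda>h. (flat k h - flat k 0) / (h - 0)) \<longlongrightarrow> 0) (at_left 0)"
        by (rule tendsto_eventually)
      have "\<forall>\<^sub>F h in at_right 0. flat (k+1) h = (flat k h - flat k 0) / (h - 0)"
        by (auto simp: eventually_at_filter flat_def field_simps)
      then show "((\<lambda>h. (flat k h - flat k 0) / (h - 0)) \<longlongrightarrow> 0) (at_right 0)"
        by (rule Lim_transform_eventually[OF flat_tendsto_0])
    qed
    then show ?thesis
      using 3 by (simp add: has_field_derivative_iff flat_def)
  qed
qed

lemma flat_0_bounds: "0 \<le> flat 0 t" "flat 0 t \<le> 1"
  by (auto simp: flat_def)

text \<open>This algebra is closed under partial derivatives, so all its members are smooth.\<close>

inductive smooth_alg :: "(real^'n \<Rightarrow> real) \<Rightarrow> bool" where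
  const: "smooth_alg (\<lambda>x. c)"
| flat: "smooth_alg (\<lambda>x. flat k (a * x $ i + c))"
| add: "smooth_alg f \<Longrightarrow> smooth_alg g \<Longrightarrow> smooth_alg (\<lambda>x. f x + g x)"
| mult: "smooth_alg f \<Longrightarrow> smooth_alg g \<Longrightarrow> smooth_alg (\<lambda>x. f x * g x)"

text \<open>The derivative is recorded as a coordinate sum whose coefficients lie in the algebra
  again; this is exactly what the recursion of \<open>cont_diff\<close> over partial derivatives
  consumes.\<close>

lemma smooth_alg_derivative:
  fixes f :: "real^'n \<Rightarrow> real"
  assumes "smooth_alg f"
  shows "\<exists>f'. (\<forall>x. (f has_derivative (\<lambda>h. \<Sum>i\<in>UNIV. f' i x * h $ i)) (at x)) \<and> (\<forall>i. smooth_alg (f' i))"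
  using assms
proof induction
  case (const c)
  show ?case
    by (rule exI[of _ "\<lambda>i x. 0"]) (auto intro: smooth_alg.intros)
next
  case (flat k a i c)
  let ?d = "\<lambda>x::real^'n. (flat (k+2) (a * x $ i + c) + (- real k) * flat (k+1) (a * x $ i + c)) * a"
  have "((\<lambda>x. flat k (a * x $ i + c)) has_derivative
      (\<lambda>h. \<Sum>j\<in>UNIV. (if j = i then ?d x else 0) * h $ j)) (at x)" for x :: "real^'n"
  proof -
    have *: "((\<lambda>x::real^'n. a * x $ i + c) has_derivative (\<lambda>h. a * h $ i)) (at x)"
      by (auto intro!: derivative_eq_intros bounded_linear_imp_has_derivative bounded_linear_vec_nth)
    have "(\<lambda>h. h * (flat (k+2) (a * x $ i + c) - k * flat (k+1) (a * x $ i + c))) \<circ> (\<lambda>h::real^'n. a * h $ i)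
      = (\<lambda>h. \<Sum>j\<in>UNIV. (if j = i then ?d x else 0) * h $ j)"
    proof (rule ext)
      fix h :: "real^'n"
      have "(\<Sum>j\<in>UNIV. (if j = i then ?d x else 0) * h $ j) = (\<Sum>j\<in>UNIV. if j = i then ?d x * h $ i else 0)"
        by (intro sum.cong) auto
      then show "((\<lambda>h. h * (flat (k+2) (a * x $ i + c) - k * flat (k+1) (a * x $ i + c))) \<circ> (\<lambda>h::real^'n. a * h $ i)) h
        = (\<Sum>j\<in>UNIV. (if j = i then ?d x else 0) * h $ j)"
        by (simp add: algebra_simps)
    qed
    then show ?thesis
      using has_derivative_compose[OF * DERIV_flat[of k "a * x $ i + c", unfolded has_field_derivative_def]]
      by (simp add: o_def mult.commute)
  qed
  moreover have "smooth_alg (\<lambda>x. if j = i then ?d x else 0)" for j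
  proof -
    have "smooth_alg ?d"
      by (intro smooth_alg.intros)
    then show ?thesis
      by (cases "j = i") (auto intro: smooth_alg.const)
  qed
  ultimately show ?case
    by (intro exI[of _ "\<lambda>j x. if j = i then ?d x else 0"]) auto
next
  case (add f g)
  then obtain f' g' where
    f': "\<And>x. (f has_derivative (\<lambda>h. \<Sum>i\<in>UNIV. f' i x * h $ i)) (at x)" "\<And>i. smooth_alg (f' i)" and
    g': "\<And>x. (g has_derivative (\<lambda>h. \<Sum>i\<in>UNIV. g' i x * h $ i)) (at x)" "\<And>i. smooth_alg (g' i)"
    by blast
  show ?case
    by (rule exI[of _ "\<lambda>i x. f' i x + g' i x"])
       (auto intro!: smooth_alg.add f' g' derivative_eq_intros simp: sum.distrib algebra_simps)
next
  case (mult f g)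
  then obtain f' g' where
    f': "\<And>x. (f has_derivative (\<lambda>h. \<Sum>i\<in>UNIV. f' i x * h $ i)) (at x)" "\<And>i. smooth_alg (f' i)" and
    g': "\<And>x. (g has_derivative (\<lambda>h. \<Sum>i\<in>UNIV. g' i x * h $ i)) (at x)" "\<And>i. smooth_alg (g' i)"
    by blast
  show ?case
    by (rule exI[of _ "\<lambda>i x. f x * g' i x + f' i x * g x"])
       (auto intro!: smooth_alg.add smooth_alg.mult f' g' mult.hyps derivative_eq_intros
         simp: sum.distrib sum_distrib_left sum_distrib_right algebra_simps)
qed

lemma partial_eqI:
  fixes f :: "real^'n \<Rightarrow> real"
  assumes "(f has_derivative (\<lambda>h. \<Sum>i\<in>UNIV. c i * h $ i)) (at x)"
  shows "partial i f x = c i"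
proof -
  have "frechet_derivative f (at x) = (\<lambda>h. \<Sum>i\<in>UNIV. c i * h $ i)"
    using frechet_derivative_at[OF assms] by simp
  then show ?thesis
    by (simp add: partial_def axis_def if_distrib cong: if_cong)
qed

lemma smooth_alg_partial:
  assumes "smooth_alg f"
  shows "f differentiable at x" "smooth_alg (partial i f)"
proof -
  obtain f' where f': "\<And>x. (f has_derivative (\<lambda>h. \<Sum>i\<in>UNIV. f' i x * h $ i)) (at x)" "\<And>i. smooth_alg (f' i)"
    using smooth_alg_derivative[OF assms] by blast
  show "f differentiable at x"
    using f'(1) by (auto simp: differentiable_def)
  have "partial i f = f' i"
    using partial_eqI[OF f'(1)] by auto
  with f'(2) show "smooth_alg (partial i f)" by simp
qed

lemma smooth_alg_cont_diff: "smooth_alg f \<Longrightarrow> cont_diff k f"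
proof (induction k arbitrary: f)
  case 0
  then show ?case
    using smooth_alg_partial(1)[OF 0] differentiable_imp_continuous_within
    by (auto simp: continuous_on_eq_continuous_within)
qed (simp add: smooth_alg_partial)

lemma smooth_alg_prod:
  assumes "finite I" "\<And>i. i \<in> I \<Longrightarrow> smooth_alg (f i)"
  shows "smooth_alg (\<lambda>x. \<Prod>i\<in>I. f i x)"
  using assms by (induction I) (auto intro: smooth_alg.intros)

text \<open>A product of one-sided cutoffs, two for each coordinate, with slope m. The arguments are
  written in the shape \<open>a * x $ i + c\<close> required by the generators of
  \<open>smooth_alg\<close>. On the open box each factor is exp(-1/(m c)) with c > 0 and tends to 1;
  elsewhere some factor is 0.\<close>

definition box_bump :: "real^'n \<Rightarrow> real^'n \<Rightarrow> nat \<Rightarrow> real^'n \<Rightarrow> real" where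
  "box_bump a b m x = (\<Prod>i\<in>UNIV. flat 0 (real m * x $ i + - real m * a $ i) *
                                  flat 0 (- real m * x $ i + real m * b $ i))"

lemma box_bump_eq_0: "x \<notin> box a b \<Longrightarrow> box_bump a b m x = 0"
  unfolding box_bump_def
proof (rule prod_zero)
  assume "x \<notin> box a b"
  then obtain i where "\<not> (a $ i < x $ i \<and> x $ i < b $ i)"
    by (auto simp: mem_box_cart)
  then have "real m * (x $ i - a $ i) \<le> 0 \<or> real m * (b $ i - x $ i) \<le> 0"
    by (auto simp: mult_le_0_iff)
  then show "\<exists>i\<in>UNIV. flat 0 (real m * x $ i + - real m * a $ i) *
    flat 0 (- real m * x $ i + real m * b $ i) = 0"
    by (intro bexI[of _ i]) (auto simp: flat_def algebra_simps)
qed simp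

lemma box_bump_bounds: "0 \<le> box_bump a b m x" "box_bump a b m x \<le> 1"
  unfolding box_bump_def
  by (auto intro!: prod_nonneg prod_le_1 mult_le_one simp: flat_0_bounds)

lemma box_bump_tendsto: "(\<lambda>m. box_bump a b m x) \<longlonglongrightarrow> indicator (box a b) x"
proof (cases "x \<in> box a b")
  case True
  have *: "(\<lambda>m. flat 0 (real m * c)) \<longlonglongrightarrow> 1" if "c > 0" for c :: real
  proof -
    have "(\<lambda>m. exp (- (inverse (real m) * inverse c))) \<longlonglongrightarrow> exp (- (0 * inverse c))"
      by (intro tendsto_intros lim_inverse_n)
    moreover have "\<forall>\<^sub>F m in sequentially. exp (- (inverse (real m) * inverse c)) = flat 0 (real m * c)"
      using eventually_gt_at_top[of 0] by eventually_elim (use that in \<open>auto simp: flat_def\<close>)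
    ultimately show ?thesis
      by (auto intro: Lim_transform_eventually)
  qed
  have "(\<lambda>m. box_bump a b m x) \<longlonglongrightarrow> (\<Prod>i\<in>(UNIV::'a set). 1 * 1)"
    unfolding box_bump_def
  proof (intro tendsto_prod tendsto_mult)
    fix i
    have "a $ i < x $ i" "x $ i < b $ i"
      using True by (auto simp: mem_box_cart)
    then show "(\<lambda>m. flat 0 (real m * x $ i + - real m * a $ i)) \<longlonglongrightarrow> 1"
      "(\<lambda>m. flat 0 (- real m * x $ i + real m * b $ i)) \<longlonglongrightarrow> 1"
      using *[of "x $ i - a $ i"] *[of "b $ i - x $ i"] by (auto simp: algebra_simps)
  qed
  then show ?thesis using True by simp
next
  case False
  then show ?thesis
    by (simp add: box_bump_eq_0)
qed

lemma test_function_box_bump: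
  assumes "cbox a b \<subseteq> S"
  shows "test_function S (box_bump a b m)"
proof -
  have "smooth_alg (box_bump a b m)"
    unfolding box_bump_def by (intro smooth_alg_prod smooth_alg.intros) auto
  moreover have "closure {x. box_bump a b m x \<noteq> 0} \<subseteq> cbox a b"
    using box_bump_eq_0 box_subset_cbox by (intro closure_minimal closed_cbox) blast
  moreover from this have "compact (closure {x. box_bump a b m x \<noteq> 0})"
    using bounded_subset[OF bounded_cbox] by (auto simp: compact_eq_bounded_closed)
  ultimately show ?thesis
    using assms smooth_alg_cont_diff by (auto simp: test_function_def)
qed

section \<open>Uniqueness of weak gradients\<close>

text \<open>Dynkin's argument: open boxes form an intersection-stable generator of the Borel sets,
  so the integral vanishes over every Borel set, which forces the density to vanish almost
  everywhere.\<close>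

lemma AE_zero_if_box_integrals_zero:
  fixes h :: "'a::euclidean_space \<Rightarrow> real"
  assumes int: "integrable lborel h" and box: "\<And>a b. (LINT x:box a b|lborel. h x) = 0"
  shows "AE x in lborel. h x = 0"
proof (rule sigma_finite_measure.density_zero[OF sigma_finite_lborel int])
  fix A :: "'a set" assume "A \<in> sets lborel"
  then have "A \<in> sigma_sets UNIV (range (\<lambda>(a, b). box a b))"
    by (simp add: borel_eq_box)
  have set_int: "set_integrable lborel B h" if "B \<in> sets lborel" for B
    unfolding set_integrable_def using that int by (intro integrable_mult_indicator)
  have sets: "B \<in> sets lborel" if "B \<in> sigma_sets UNIV (range (\<lambda>(a, b). box a b))" for B :: "'a set"
    using that by (simp add: borel_eq_box)
  \<comment> \<open>The closure under complements needs the integral over the whole space, obtained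
    by exhausting it with growing boxes.\<close>
  have univ: "(LINT x:UNIV|lborel. h x) = 0"
  proof -
    let ?B = "\<lambda>n::nat. box (- (real n *\<^sub>R One)) (real n *\<^sub>R One) :: 'a set"
    have "incseq ?B"
    proof (rule incseq_SucI)
      fix n show "?B n \<subseteq> ?B (Suc n)"
        by (rule subset_box_imp) (auto simp: inner_simps)
    qed
    have "(\<lambda>n. LINT x:?B n|lborel. h x) \<longlonglongrightarrow> (LINT x:(\<Union>n. ?B n)|lborel. h x)"
      by (rule set_integral_cont_up) (use \<open>incseq ?B\<close> set_int in auto)
    then show ?thesis
      by (simp add: box UN_box_eq_UNIV LIMSEQ_const_iff)
  qed
  show "(LINT x:A|lborel. h x) = 0"
  proof (rule sigma_sets_induct_disjoint[of "range (\<lambda>(a, b). box a b)" UNIV A])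
    show "Int_stable (range (\<lambda>(a, b). box a b :: 'a set))"
      by (auto simp: Int_stable_def box_Int_box)
    show "A \<in> sigma_sets UNIV (range (\<lambda>(a, b). box a b))"
      by fact
    show "(LINT x:B|lborel. h x) = 0" if "B \<in> range (\<lambda>(a, b). box a b)" for B
      using that box by auto
    show "(LINT x:(UNIV - B)|lborel. h x) = 0"
      if "B \<in> sigma_sets UNIV (range (\<lambda>(a, b). box a b))" "(LINT x:B|lborel. h x) = 0" for B
    proof -
      have "(LINT x:B \<union> (UNIV - B)|lborel. h x) = (LINT x:B|lborel. h x) + (LINT x:(UNIV - B)|lborel. h x)"
        using sets[OF that(1)] by (intro set_integral_Un set_int) auto
      then show ?thesis
        using that(2) univ by simp
    qed
    show "(LINT x:(\<Union>i. B i)|lborel. h x) = 0"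
      if "disjoint_family B" "range B \<subseteq> sigma_sets UNIV (range (\<lambda>(a, b). box a b))"
         "\<And>i. (LINT x:B i|lborel. h x) = 0" for B :: "nat \<Rightarrow> 'a set"
    proof -
      have "B i \<in> sets lborel" for i
        using that(2) sets by blast
      then have "(LINT x:(\<Union>i. B i)|lborel. h x) = (\<Sum>i. LINT x:B i|lborel. h x)"
        using that(1) by (intro lebesgue_integral_countable_add set_int sets.countable_UN)
          (auto simp: disjoint_family_on_def)
      then show ?thesis
        using that(3) by simp
    qed
  qed (auto simp: set_lebesgue_integral_def)
qed

lemma continuous_imp_lebesgue_measurable: "continuous_on UNIV f \<Longrightarrow> f \<in> borel_measurable lebesgue"
  by (intro measurable_completion) (simp add: borel_measurable_continuous_onI)

lemma absolutely_integrable_mult_continuous: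
  fixes h \<theta> :: "real^'n \<Rightarrow> real"
  assumes h: "h absolutely_integrable_on C" and C: "compact C" "C \<subseteq> S"
    and \<theta>: "continuous_on UNIV \<theta>" and zero: "\<And>x. x \<notin> C \<Longrightarrow> \<theta> x = 0"
  shows "(\<lambda>x. h x * \<theta> x) absolutely_integrable_on S"
    "(LINT x:S|lebesgue. h x * \<theta> x) = (LINT x:C|lebesgue. h x * \<theta> x)"
proof -
  have eq: "indicator S x *\<^sub>R (h x * \<theta> x) = indicator C x *\<^sub>R (h x * \<theta> x)" for x
    using C(2) zero[of x] by (auto simp: indicator_def)
  obtain B where B: "\<And>x. x \<in> C \<Longrightarrow> norm (\<theta> x) \<le> B" "B \<ge> 0"
    using continuous_on_compact_bound[OF C(1) continuous_on_subset[OF \<theta>]] by auto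
  have \<theta>m: "\<theta> \<in> borel_measurable lebesgue"
    by (rule continuous_imp_lebesgue_measurable[OF \<theta>])
  have "integrable lebesgue (\<lambda>x. indicator C x *\<^sub>R (h x * \<theta> x))"
  proof (rule Bochner_Integration.integrable_bound)
    show "integrable lebesgue (\<lambda>x. B * (indicator C x *\<^sub>R h x))"
      using h by (auto simp: set_integrable_def)
    have "(\<lambda>x. (indicator C x *\<^sub>R h x) * \<theta> x) \<in> borel_measurable lebesgue"
      using h \<theta>m by (intro borel_measurable_times) (auto simp: set_integrable_def)
    then show "(\<lambda>x. indicator C x *\<^sub>R (h x * \<theta> x)) \<in> borel_measurable lebesgue"
      by (simp add: mult.assoc)
    show "AE x in lebesgue. norm (indicator C x *\<^sub>R (h x * \<theta> x)) \<le> norm (B * (indicator C x *\<^sub>R h x))"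
      using B by (auto simp: indicator_def abs_mult mult.commute[of "\<bar>h _\<bar>"] intro!: AE_I2 mult_right_mono)
  qed
  then show "(\<lambda>x. h x * \<theta> x) absolutely_integrable_on S"
    by (simp only: set_integrable_def eq)
  show "(LINT x:S|lebesgue. h x * \<theta> x) = (LINT x:C|lebesgue. h x * \<theta> x)"
    by (simp only: set_lebesgue_integral_def eq)
qed

lemma test_functionD:
  assumes "test_function S \<phi>"
  shows "continuous_on UNIV \<phi>" "continuous_on UNIV (partial i \<phi>)" "\<And>x. \<phi> differentiable at x"
    "compact (closure {x. \<phi> x \<noteq> 0})" "closure {x. \<phi> x \<noteq> 0} \<subseteq> S"
    "\<And>x. x \<notin> closure {x. \<phi> x \<noteq> 0} \<Longrightarrow> \<phi> x = 0"
    "\<And>x. x \<notin> closure {x. \<phi> x \<noteq> 0} \<Longrightarrow> partial i \<phi> x = 0"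
proof -
  have "cont_diff (Suc 0) \<phi>" "cont_diff 0 \<phi>"
    using assms unfolding test_function_def by blast+
  then show "continuous_on UNIV \<phi>" "continuous_on UNIV (partial i \<phi>)" "\<And>x. \<phi> differentiable at x"
    by simp_all
  show "compact (closure {x. \<phi> x \<noteq> 0})" "closure {x. \<phi> x \<noteq> 0} \<subseteq> S"
    using assms unfolding test_function_def by blast+
  show 0: "\<phi> x = 0" if "x \<notin> closure {x. \<phi> x \<noteq> 0}" for x
    using that closure_subset[of "{x. \<phi> x \<noteq> 0}"] by auto
  show "partial i \<phi> x = 0" if "x \<notin> closure {x. \<phi> x \<noteq> 0}" for x
  proof -
    have "((\<lambda>x. 0) has_derivative (\<lambda>h. 0)) (at x)"
      by simp
    then have "(\<phi> has_derivative (\<lambda>h. 0)) (at x)"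
    proof (rule has_derivative_transform_within_open)
      show "open (- closure {x. \<phi> x \<noteq> 0})" "x \<in> - closure {x. \<phi> x \<noteq> 0}"
        using that by (simp_all add: open_Compl)
      show "0 = \<phi> y" if "y \<in> - closure {x. \<phi> x \<noteq> 0}" for y
        by (rule 0[symmetric]) (use that in simp)
    qed
    then have "partial i \<phi> x = (\<lambda>i. 0) i"
      by (intro partial_eqI) simp
    then show ?thesis by simp
  qed
qed

text \<open>The fundamental lemma of the calculus of variations for locally integrable functions.
  Box bumps tend to the indicator of an open box, so integrals over boxes with closure in S agree;
  this settles each closed box in S, and countably many of them cover S.\<close>

lemma AE_eq_if_test_integrals_eq:
  fixes h1 h2 :: "real^'n \<Rightarrow> real"
  assumes S: "open S"
    and loc: "\<And>C. compact C \<Longrightarrow> C \<subseteq> S \<Longrightarrow> h1 absolutely_integrable_on C"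
      "\<And>C. compact C \<Longrightarrow> C \<subseteq> S \<Longrightarrow> h2 absolutely_integrable_on C"
    and eq: "\<And>\<phi>. test_function S \<phi> \<Longrightarrow>
      (LINT x:S|lebesgue. h1 x * \<phi> x) = (LINT x:S|lebesgue. h2 x * \<phi> x)"
  shows "AE x in lebesgue. x \<in> S \<longrightarrow> h1 x = h2 x"
proof -
  have lim: "(\<lambda>m. LINT x:S|lebesgue. h x * box_bump a b m x) \<longlonglongrightarrow> (LINT x:box a b|lebesgue. h x)"
    if h: "\<And>C. compact C \<Longrightarrow> C \<subseteq> S \<Longrightarrow> h absolutely_integrable_on C" and ab: "cbox a b \<subseteq> S"
    for h :: "real^'n \<Rightarrow> real" and a b
  proof -
    have int: "h absolutely_integrable_on cbox a b"
      using h[OF compact_cbox ab] .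
    have *: "(LINT x:S|lebesgue. h x * box_bump a b m x)
      = (LINT x|lebesgue. (indicator (cbox a b) x *\<^sub>R h x) * box_bump a b m x)" for m
    proof -
      have "indicator S x *\<^sub>R (h x * box_bump a b m x)
        = (indicator (cbox a b) x *\<^sub>R h x) * box_bump a b m x" for x
        using ab box_bump_eq_0[of x a b m] box_subset_cbox[of a b] by (auto simp: indicator_def)
      then show ?thesis
        by (simp only: set_lebesgue_integral_def)
    qed
    have **: "(LINT x:box a b|lebesgue. h x)
      = (LINT x|lebesgue. (indicator (cbox a b) x *\<^sub>R h x) * indicator (box a b) x)"
      unfolding set_lebesgue_integral_def using box_subset_cbox[of a b]
      by (intro Bochner_Integration.integral_cong) (auto simp: indicator_def)
    show ?thesis
      unfolding * **
    proof (rule integral_dominated_convergence)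
      show "integrable lebesgue (\<lambda>x. norm (indicator (cbox a b) x *\<^sub>R h x))"
        using int by (auto simp: set_integrable_def)
      show "(\<lambda>x. (indicator (cbox a b) x *\<^sub>R h x) * indicator (box a b) x) \<in> borel_measurable lebesgue"
        using int by (intro borel_measurable_times borel_measurable_indicator) (auto simp: set_integrable_def)
      show "(\<lambda>x. (indicator (cbox a b) x *\<^sub>R h x) * box_bump a b m x) \<in> borel_measurable lebesgue" for m
      proof (intro borel_measurable_times)
        have "continuous_on UNIV (box_bump a b m)"
          using test_functionD(1)[OF test_function_box_bump[OF ab]] .
        then show "box_bump a b m \<in> borel_measurable lebesgue"
          by (rule continuous_imp_lebesgue_measurable)
      qed (use int in \<open>auto simp: set_integrable_def\<close>)
      show "AE x in lebesgue. (\<lambda>m. (indicator (cbox a b) x *\<^sub>R h x) * box_bump a b m x)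
        \<longlonglongrightarrow> (indicator (cbox a b) x *\<^sub>R h x) * indicator (box a b) x"
        by (intro AE_I2 tendsto_mult tendsto_const box_bump_tendsto)
      show "AE x in lebesgue. norm ((indicator (cbox a b) x *\<^sub>R h x) * box_bump a b m x)
        \<le> norm (indicator (cbox a b) x *\<^sub>R h x)" for m
        using box_bump_bounds[of a b m] by (auto simp: abs_mult intro!: AE_I2 mult_left_le)
    qed
  qed
  have box_eq: "(LINT x:box a b|lebesgue. h1 x) = (LINT x:box a b|lebesgue. h2 x)"
    if "cbox a b \<subseteq> S" for a b
    using lim[OF loc(1) that] lim[OF loc(2) that] eq[OF test_function_box_bump[OF that]]
    by (auto intro: LIMSEQ_unique)
  have cbox: "AE x in lebesgue. x \<in> cbox c d \<longrightarrow> h1 x = h2 x" if cd: "cbox c d \<subseteq> S" for c d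
  proof -
    let ?h = "\<lambda>x. indicator (cbox c d) x *\<^sub>R (h1 x - h2 x)"
    have int: "integrable lebesgue ?h"
      using set_integral_diff(1)[OF loc[OF compact_cbox cd]] by (simp add: set_integrable_def)
    \<comment> \<open>The functions are only Lebesgue measurable, whereas the generator argument
      concerns Borel sets, so a Borel representative takes over.\<close>
    obtain h0 where h0: "h0 \<in> borel_measurable lborel" "AE x in lborel. ?h x = h0 x"
      using completion_ex_borel_measurable_real[of ?h lborel] int by auto
    have ae: "AE x in lebesgue. ?h x = h0 x"
      using h0(2) by (rule AE_completion)
    have int0: "integrable lborel h0"
      using integrable_cong_AE_imp[OF int _ ae] h0(1) measurable_completion integrable_completion by blast
    have "AE x in lborel. h0 x = 0"
    proof (rule AE_zero_if_box_integrals_zero[OF int0])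
      fix a b :: "real^'n"
      obtain e f where ef: "box a b \<inter> box c d = box e f"
        by (auto simp: box_Int_box)
      \<comment> \<open>The boundary of the box is discarded so that the domain of integration is an
        intersection of two open boxes, which is again an open box.\<close>
      have nul: "AE x in lebesgue. x \<notin> cbox c d - box c d"
        using negligible_frontier_interval[of c d] by (intro AE_not_in) (simp add: negligible_iff_null_sets)
      have "(LINT x:box a b|lborel. h0 x) = (LINT x:box a b|lebesgue. h0 x)"
        unfolding set_lebesgue_integral_def using h0(1) by (intro integral_completion[symmetric]) auto
      also have "\<dots> = (LINT x:box e f|lebesgue. h1 x - h2 x)"
        unfolding set_lebesgue_integral_def
      proof (rule integral_cong_AE)
        show "(\<lambda>x. indicator (box a b) x *\<^sub>R h0 x) \<in> borel_measurable lebesgue"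
          using measurable_completion[OF h0(1)] by (intro borel_measurable_scaleR borel_measurable_indicator) auto
        have "(\<lambda>x. indicator (box e f) x *\<^sub>R ?h x) \<in> borel_measurable lebesgue"
          by (rule borel_measurable_integrable[OF integrable_mult_indicator[OF _ int]]) simp
        moreover have "indicator (box e f) x *\<^sub>R ?h x = indicator (box e f) x *\<^sub>R (h1 x - h2 x)" for x
          using ef box_subset_cbox[of c d] by (auto simp: indicator_def)
        ultimately show "(\<lambda>x. indicator (box e f) x *\<^sub>R (h1 x - h2 x)) \<in> borel_measurable lebesgue"
          by (simp only:)
        show "AE x in lebesgue. indicator (box a b) x *\<^sub>R h0 x = indicator (box e f) x *\<^sub>R (h1 x - h2 x)"
          using ae nul by eventually_elim (use ef box_subset_cbox[of c d] in \<open>auto simp: indicator_def\<close>)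
      qed
      also have "\<dots> = 0"
      proof (cases "box e f = {}")
        case False
        have "cbox e f \<subseteq> cbox c d"
          using closure_mono[of "box e f" "cbox c d"] ef box_subset_cbox[of c d] closure_box[OF False] by auto
        with cd have efS: "cbox e f \<subseteq> S" by blast
        have i1: "h1 absolutely_integrable_on box e f"
          by (rule set_integrable_subset[OF loc(1)[OF compact_cbox efS]]) (auto simp: box_subset_cbox)
        have i2: "h2 absolutely_integrable_on box e f"
          by (rule set_integrable_subset[OF loc(2)[OF compact_cbox efS]]) (auto simp: box_subset_cbox)
        show ?thesis
          using set_integral_diff(2)[OF i1 i2] box_eq[OF efS] by simp
      qed (simp add: set_lebesgue_integral_def)
      finally show "(LINT x:box a b|lborel. h0 x) = 0" .
    qed
    then have "AE x in lebesgue. h0 x = 0"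
      by (rule AE_completion)
    with ae show ?thesis
      by eventually_elim (auto simp: indicator_def split: if_splits)
  qed
  obtain \<D> where \<D>: "countable \<D>" "\<D> \<subseteq> Pow S" "\<And>X. X \<in> \<D> \<Longrightarrow> \<exists>a b. X = cbox a b" "\<Union>\<D> = S"
    using open_countable_Union_open_cbox[OF S] by blast
  have "AE x in lebesgue. \<forall>X\<in>\<D>. x \<in> X \<longrightarrow> h1 x = h2 x"
    using cbox \<D> by (subst AE_ball_countable) blast+
  then show ?thesis
    by eventually_elim (use \<D>(4) in blast)
qed

section \<open>Weak gradients of continuously differentiable functions\<close>

text \<open>The gradient is an explicit argument, which avoids a choice of derivative. Test
  functions and shape functions are both differentiable on the whole space, so differentiability up
  to the boundary of a simplex never has to be discussed.\<close>

definition C1_with :: "(real^'n \<Rightarrow> real) \<Rightarrow> (real^'n \<Rightarrow> real^'n) \<Rightarrow> bool" where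
  "C1_with f f' \<longleftrightarrow> (\<forall>x. (f has_derivative (\<lambda>h. f' x \<bullet> h)) (at x)) \<and> continuous_on UNIV f'"

lemma C1_withD:
  assumes "C1_with f f'"
  shows "(f has_derivative (\<lambda>h. f' x \<bullet> h)) (at x)" "continuous_on UNIV f'" "continuous_on UNIV f"
proof -
  show *: "(f has_derivative (\<lambda>h. f' x \<bullet> h)) (at x)" "continuous_on UNIV f'" for x
    using assms by (auto simp: C1_with_def)
  show "continuous_on UNIV f"
    using has_derivative_continuous[OF *(1)] by (auto simp: continuous_on_eq_continuous_within)
qed

lemma C1_with_diff:
  assumes "C1_with f f'" "C1_with g g'"
  shows "C1_with (\<lambda>x. f x - g x) (\<lambda>x. f' x - g' x)"
  using assms by (auto simp: C1_with_def inner_diff_left intro!: derivative_eq_intros continuous_intros)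

lemma C1_with_test_function:
  assumes "test_function S \<phi>"
  shows "C1_with \<phi> (\<lambda>x. \<chi> i. partial i \<phi> x)"
  unfolding C1_with_def
proof (intro conjI allI)
  fix x
  have "(\<phi> has_derivative frechet_derivative \<phi> (at x)) (at x)"
    using test_functionD(3)[OF assms] frechet_derivative_works by blast
  moreover have "frechet_derivative \<phi> (at x) h = (\<chi> i. partial i \<phi> x) \<bullet> h" for h
  proof -
    have lin: "linear (frechet_derivative \<phi> (at x))"
      using test_functionD(3)[OF assms] linear_frechet_derivative by blast
    have "frechet_derivative \<phi> (at x) h = frechet_derivative \<phi> (at x) (\<Sum>i\<in>UNIV. h $ i *\<^sub>R axis i 1)"
      using basis_expansion[of h] by (simp add: scalar_mult_eq_scaleR)
    also have "\<dots> = (\<Sum>i\<in>UNIV. h $ i * partial i \<phi> x)"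
      by (simp add: linear_sum[OF lin] linear_cmul[OF lin] partial_def)
    finally show ?thesis
      by (simp add: inner_vec_def mult.commute)
  qed
  then have "frechet_derivative \<phi> (at x) = (\<lambda>h. (\<chi> i. partial i \<phi> x) \<bullet> h)"
    by (rule ext)
  ultimately show "(\<phi> has_derivative (\<lambda>h. (\<chi> i. partial i \<phi> x) \<bullet> h)) (at x)"
    by (simp only:)
qed (intro continuous_on_vec_lambda test_functionD(2)[OF assms])

lemma C1_with_lipschitz:
  fixes f :: "real^'n \<Rightarrow> real"
  assumes f: "C1_with f f'" and K: "convex K" and B: "\<And>x. x \<in> K \<Longrightarrow> norm (f' x) \<le> B" and xy: "x \<in> K" "y \<in> K"
  shows "\<bar>f x - f y\<bar> \<le> B * norm (x - y)"
proof -
  have "norm (f x - f y) \<le> B * norm (x - y)"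
  proof (rule differentiable_bound[OF K _ _ xy])
    show "(f has_derivative (\<lambda>h. f' x \<bullet> h)) (at x within K)" for x
      using C1_withD(1)[OF f] has_derivative_at_withinI by blast
    show "onorm (\<lambda>h. f' x \<bullet> h) \<le> B" if "x \<in> K" for x
    proof (rule onorm_le)
      fix h
      have "norm (f' x \<bullet> h) \<le> norm (f' x) * norm h"
        using Cauchy_Schwarz_ineq2 by simp
      also have "\<dots> \<le> B * norm h"
        by (intro mult_right_mono B that) simp
      finally show "norm (f' x \<bullet> h) \<le> B * norm h" .
    qed
  qed
  then show ?thesis by simp
qed

text \<open>Stated along sequences because the limits below are taken under integrals by dominated
  convergence.\<close>

lemma has_derivative_difference_quotient:
  fixes f :: "'a::real_normed_vector \<Rightarrow> real"
  assumes f: "(f has_derivative f') (at x)" and t: "t \<longlonglongrightarrow> 0" "\<And>m. t m \<noteq> (0::real)"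
  shows "(\<lambda>m. (f (x + t m *\<^sub>R v) - f x) / t m) \<longlonglongrightarrow> f' v"
proof -
  have "((\<lambda>r. x + r *\<^sub>R v) has_derivative (\<lambda>r. r *\<^sub>R v)) (at 0)"
    by (auto intro!: derivative_eq_intros)
  moreover have "(f has_derivative f') (at (x + 0 *\<^sub>R v))"
    using f by simp
  ultimately have "((\<lambda>r. f (x + r *\<^sub>R v)) has_derivative (\<lambda>r. f' (r *\<^sub>R v))) (at 0)"
    by (rule has_derivative_compose)
  then have "((\<lambda>r. f (x + r *\<^sub>R v)) has_real_derivative f' v) (at 0)"
    using linear_cmul[OF has_derivative_linear[OF f]]
    by (simp add: has_field_derivative_def mult.commute[of _ "f' v"])
  then have "((\<lambda>r. (f (x + r *\<^sub>R v) - f x) / r) \<longlongrightarrow> f' v) (at 0)"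
    by (simp add: has_field_derivative_iff)
  moreover have "filterlim t (at 0) sequentially"
    using t by (simp add: filterlim_at)
  ultimately show ?thesis
    by (rule filterlim_compose)
qed

text \<open>By translation invariance the integral of every difference quotient is 0, and dominated
  convergence carries this over to the partial derivative.\<close>

lemma integral_partial_eq_0:
  fixes f :: "real^'n \<Rightarrow> real"
  assumes f: "C1_with f f'" and zero: "\<And>x. norm x > R \<Longrightarrow> f x = 0" "\<And>x. norm x > R \<Longrightarrow> f' x = 0"
  shows "(LINT x|lborel. f' x $ i) = 0"
proof -
  let ?t = "\<lambda>m::nat. inverse (real (Suc m))"
  let ?q = "\<lambda>m x. (f (x + ?t m *\<^sub>R axis i 1) - f x) / ?t m"
  obtain B where B: "B \<ge> 0" "\<And>x. x \<in> cball 0 R \<Longrightarrow> norm (f' x) \<le> B"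
    using continuous_on_compact_bound[OF compact_cball[of 0 R] continuous_on_subset[OF C1_withD(2)[OF f] subset_UNIV]]
    by blast
  have B': "norm (f' x) \<le> B" for x
    using B zero(2)[of x] by (cases "norm x > R") auto
  have fc: "continuous_on UNIV f" and f'c: "continuous_on UNIV f'"
    using C1_withD[OF f] by auto
  have fm: "f \<in> borel_measurable borel"
    using fc by (rule borel_measurable_continuous_onI)
  have intf: "integrable lborel f"
  proof -
    have "integrable lborel (\<lambda>x. indicator (cball 0 R) x *\<^sub>R f x)"
      by (rule borel_integrable_compact) (auto intro: continuous_on_subset[OF fc])
    moreover have "indicator (cball 0 R) x *\<^sub>R f x = f x" for x
      using zero(1)[of x] by (auto simp: indicator_def)
    ultimately show ?thesis by (simp only:)
  qed
  have tr: "integrable lborel (\<lambda>x. f (x + a))" "(LINT x|lborel. f (x + a)) = (LINT x|lborel. f x)" for a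
  proof -
    have "integrable (distr lborel borel ((+) a)) f"
      using intf by (simp add: lborel_distr_plus)
    then show "integrable lborel (\<lambda>x. f (x + a))"
      using fm by (subst (asm) integrable_distr_eq) (auto simp: add.commute)
    have "(LINT x|lborel. f x) = (LINT x|distr lborel borel ((+) a). f x)"
      by (simp add: lborel_distr_plus)
    also have "\<dots> = (LINT x|lborel. f (x + a))"
      using fm by (subst integral_distr) (auto simp: add.commute)
    finally show "(LINT x|lborel. f (x + a)) = (LINT x|lborel. f x)" by simp
  qed
  have q0: "(LINT x|lborel. ?q m x) = 0" for m
    using tr intf by simp
  have "(\<lambda>m. LINT x|lborel. ?q m x) \<longlonglongrightarrow> (LINT x|lborel. f' x $ i)"
  proof (rule integral_dominated_convergence)
    \<comment> \<open>Increments are at most 1, so all difference quotients vanish outside the ball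
      of radius R + 1; the Lipschitz constant B dominates them inside.\<close>
    show "integrable lborel (\<lambda>x. B * indicator (cball (0::real^'n) (R + 1)) x)"
      using emeasure_compact_finite[of "cball (0::real^'n) (R+1)"]
      by (auto simp: integrable_mult_right_iff)
    show "(\<lambda>x. f' x $ i) \<in> borel_measurable lborel"
      using borel_measurable_continuous_onI[of "\<lambda>x. f' x $ i"] f'c by (auto intro: continuous_intros)
    show "(\<lambda>x. ?q m x) \<in> borel_measurable lborel" for m
      using tr(1) intf by (intro borel_measurable_divide borel_measurable_diff borel_measurable_integrable) auto
    show "AE x in lborel. (\<lambda>m. ?q m x) \<longlonglongrightarrow> f' x $ i"
    proof (rule AE_I2)
      fix x
      have "(\<lambda>m. ?q m x) \<longlonglongrightarrow> f' x \<bullet> axis i 1"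
        by (rule has_derivative_difference_quotient[OF C1_withD(1)[OF f] LIMSEQ_inverse_real_of_nat]) simp
      then show "(\<lambda>m. ?q m x) \<longlonglongrightarrow> f' x $ i"
        by (simp add: inner_axis)
    qed
    show "AE x in lborel. norm (?q m x) \<le> B * indicator (cball 0 (R + 1)) x" for m
    proof (rule AE_I2)
      fix x :: "real^'n"
      have t: "0 < ?t m" "?t m \<le> 1"
        by (auto simp: field_simps)
      show "norm (?q m x) \<le> B * indicator (cball 0 (R + 1)) x"
      proof (cases "norm x \<le> R + 1")
        case True
        have "\<bar>f (x + ?t m *\<^sub>R axis i 1) - f x\<bar> \<le> B * norm (x + ?t m *\<^sub>R axis i 1 - x)"
          by (rule C1_with_lipschitz[OF f convex_UNIV]) (use B' in auto)
        also have "\<dots> = B * ?t m"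
          using t by simp
        finally show ?thesis
          using True t by (simp add: abs_divide pos_divide_le_eq)
      next
        case False
        have "norm x \<le> norm (x + ?t m *\<^sub>R axis i 1) + ?t m"
          using norm_triangle_ineq4[of "x + ?t m *\<^sub>R axis i 1" "?t m *\<^sub>R axis i 1"] t by simp
        then have "norm (x + ?t m *\<^sub>R axis i 1) > R" "norm x > R"
          using False t by linarith+
        then show ?thesis
          using zero(1) False by simp
      qed
    qed
  qed
  then show ?thesis
    unfolding q0 by (simp add: LIMSEQ_const_iff)
qed

lemma continuous_absolutely_integrable_compact:
  fixes f :: "'a::euclidean_space \<Rightarrow> 'b::euclidean_space"
  assumes "continuous_on UNIV f" "compact C"
  shows "f absolutely_integrable_on C"
proof -
  have "integrable lborel (\<lambda>x. indicator C x *\<^sub>R f x)"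
    using assms by (intro borel_integrable_compact) (auto intro: continuous_on_subset)
  then show ?thesis
    unfolding set_integrable_def
    by (subst integrable_completion) (auto dest: borel_measurable_integrable)
qed

text \<open>Integration by parts: the product of \<open>f\<close> with a test function has compact
  support even though \<open>f\<close> need not, and the integral of its partial derivative is
  0.\<close>

lemma is_weak_grad_C1:
  fixes f :: "real^'n \<Rightarrow> real"
  assumes f: "C1_with f f'"
  shows "is_weak_grad S f f'"
  unfolding is_weak_grad_def
proof (intro conjI allI impI)
  show "f absolutely_integrable_on C" "f' absolutely_integrable_on C" if "compact C \<and> C \<subseteq> S" for C
    using that C1_withD[OF f] by (auto intro: continuous_absolutely_integrable_compact)
  fix \<phi> i assume \<phi>: "test_function S \<phi>"
  let ?C = "closure {x. \<phi> x \<noteq> 0}"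
  note \<phi>D = test_functionD[OF \<phi>]
  let ?\<phi>' = "\<lambda>x. \<chi> i. partial i \<phi> x"
  let ?g' = "\<lambda>x. f x *\<^sub>R ?\<phi>' x + \<phi> x *\<^sub>R f' x"
  have \<phi>C1: "C1_with \<phi> ?\<phi>'"
    by (rule C1_with_test_function[OF \<phi>])
  have g: "C1_with (\<lambda>x. f x * \<phi> x) ?g'"
    using f \<phi>C1 C1_withD(3)[OF f] C1_withD(3)[OF \<phi>C1] unfolding C1_with_def
    by (auto intro!: derivative_eq_intros continuous_intros simp: inner_add_left algebra_simps)
  obtain R where R: "\<And>x. x \<in> ?C \<Longrightarrow> norm x \<le> R"
    using compact_imp_bounded[OF \<phi>D(4)] unfolding bounded_iff by blast
  have out: "x \<notin> ?C" if "norm x > R" for x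
    using R[of x] that by linarith
  have "(LINT x|lborel. ?g' x $ i) = 0"
  proof (rule integral_partial_eq_0[OF g])
    fix x :: "real^'n" assume "norm x > R"
    then have "\<phi> x = 0" "\<And>i. partial i \<phi> x = 0"
      using \<phi>D(6)[OF out] \<phi>D(7)[OF out] by auto
    then show "f x * \<phi> x = 0" "?g' x = 0"
      by (auto simp: vec_eq_iff)
  qed
  moreover have "(\<lambda>x. ?g' x $ i) \<in> borel_measurable lborel"
    using borel_measurable_continuous_onI[OF continuous_on_component[OF C1_withD(2)[OF g]], of i] by simp
  ultimately have 0: "(LINT x|lebesgue. ?g' x $ i) = 0"
    by (simp only: integral_completion)
  have int1: "(\<lambda>x. f x * partial i \<phi> x) absolutely_integrable_on S"
    by (rule absolutely_integrable_mult_continuous(1)[OF continuous_absolutely_integrable_compact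
          [OF C1_withD(3)[OF f] \<phi>D(4)] \<phi>D(4,5,2,7)])
  have int2: "(\<lambda>x. f' x $ i * \<phi> x) absolutely_integrable_on S"
    by (rule absolutely_integrable_mult_continuous(1)[OF continuous_absolutely_integrable_compact
          [OF continuous_on_component[OF C1_withD(2)[OF f]] \<phi>D(4)] \<phi>D(4,5,1,6)])
  have "(LINT x:S|lebesgue. f x * partial i \<phi> x) + (LINT x:S|lebesgue. f' x $ i * \<phi> x)
      = (LINT x:S|lebesgue. f x * partial i \<phi> x + f' x $ i * \<phi> x)"
    by (rule set_integral_add(2)[OF int1 int2, symmetric])
  also have "\<dots> = (LINT x|lebesgue. ?g' x $ i)"
    unfolding set_lebesgue_integral_def
  proof (rule Bochner_Integration.integral_cong[OF refl])
    fix x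
    show "indicator S x *\<^sub>R (f x * partial i \<phi> x + f' x $ i * \<phi> x) = ?g' x $ i"
      using \<phi>D(5) \<phi>D(6)[of x] \<phi>D(7)[of x i] by (cases "x \<in> ?C") (auto simp: mult.commute)
  qed
  finally show "(LINT x:S|lebesgue. f x * partial i \<phi> x) = - (LINT x:S|lebesgue. f' x $ i * \<phi> x)"
    using 0 by simp
qed

lemma absolutely_integrable_vec_nth:
  assumes "(g :: real^'n \<Rightarrow> real^'n) absolutely_integrable_on C"
  shows "(\<lambda>x. g x $ i) absolutely_integrable_on C"
  using absolutely_integrable_component[OF assms, of "axis i 1"] by (simp add: inner_axis)

lemma is_weak_grad_unique:
  assumes S: "open S" and g: "is_weak_grad S v g1" "is_weak_grad S v g2"
  shows "AE x in lebesgue. x \<in> S \<longrightarrow> g1 x = g2 x"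
proof -
  have "AE x in lebesgue. x \<in> S \<longrightarrow> g1 x $ i = g2 x $ i" for i
  proof (rule AE_eq_if_test_integrals_eq[OF S])
    show "(\<lambda>x. g1 x $ i) absolutely_integrable_on C" "(\<lambda>x. g2 x $ i) absolutely_integrable_on C"
      if "compact C" "C \<subseteq> S" for C
      using g that by (auto intro!: absolutely_integrable_vec_nth simp: is_weak_grad_def)
    show "(LINT x:S|lebesgue. g1 x $ i * \<phi> x) = (LINT x:S|lebesgue. g2 x $ i * \<phi> x)"
      if "test_function S \<phi>" for \<phi>
    proof -
      have "(LINT x:S|lebesgue. v x * partial i \<phi> x) = - (LINT x:S|lebesgue. g1 x $ i * \<phi> x)"
        "(LINT x:S|lebesgue. v x * partial i \<phi> x) = - (LINT x:S|lebesgue. g2 x $ i * \<phi> x)"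
        using g that unfolding is_weak_grad_def by blast+
      then show ?thesis by simp
    qed
  qed
  then have "AE x in lebesgue. \<forall>i. x \<in> S \<longrightarrow> g1 x $ i = g2 x $ i"
    by (subst AE_all_countable) blast
  then show ?thesis
    by eventually_elim (auto simp: vec_eq_iff)
qed

text \<open>This removes the choice hidden in \<open>weak_grad\<close>: any explicitly known weak
  gradient may be used under integrals.\<close>

lemma weak_grad_AE:
  assumes "open S" "is_weak_grad S v g"
  shows "AE x in lebesgue. x \<in> S \<longrightarrow> weak_grad S v x = g x"
  using is_weak_grad_unique[OF assms(1)] assms(2) someI[of "is_weak_grad S v" g]
  unfolding weak_grad_def by blast

lemma is_weak_grad_diff:
  assumes v: "is_weak_grad S v g" and w: "is_weak_grad S w k"
  shows "is_weak_grad S (\<lambda>x. v x - w x) (\<lambda>x. g x - k x)"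
  unfolding is_weak_grad_def
proof (intro conjI allI impI)
  have loc: "v absolutely_integrable_on C" "w absolutely_integrable_on C"
    "g absolutely_integrable_on C" "k absolutely_integrable_on C" if "compact C" "C \<subseteq> S" for C
    using assms that unfolding is_weak_grad_def by blast+
  show "(\<lambda>x. v x - w x) absolutely_integrable_on C" "(\<lambda>x. g x - k x) absolutely_integrable_on C"
    if "compact C \<and> C \<subseteq> S" for C
    using that loc by (auto intro: set_integral_diff)
  fix \<phi> i assume \<phi>: "test_function S \<phi>"
  let ?C = "closure {x. \<phi> x \<noteq> 0}"
  note \<phi>D = test_functionD[OF \<phi>]
  have int: "(\<lambda>x. h x * \<theta> x) absolutely_integrable_on S"
    if "h absolutely_integrable_on ?C" "\<theta> \<in> {\<phi>, partial i \<phi>}" for h \<theta>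
    using absolutely_integrable_mult_continuous(1)[OF that(1) \<phi>D(4,5)] that(2) \<phi>D(1,2,6,7) by blast
  have eq: "(LINT x:S|lebesgue. v x * partial i \<phi> x) = - (LINT x:S|lebesgue. g x $ i * \<phi> x)"
    "(LINT x:S|lebesgue. w x * partial i \<phi> x) = - (LINT x:S|lebesgue. k x $ i * \<phi> x)"
    using assms \<phi> unfolding is_weak_grad_def by blast+
  have "(LINT x:S|lebesgue. (v x - w x) * partial i \<phi> x)
    = (LINT x:S|lebesgue. v x * partial i \<phi> x) - (LINT x:S|lebesgue. w x * partial i \<phi> x)"
    unfolding left_diff_distrib using loc[OF \<phi>D(4,5)] by (intro set_integral_diff int) auto
  moreover have "(LINT x:S|lebesgue. (g x - k x) $ i * \<phi> x)
    = (LINT x:S|lebesgue. g x $ i * \<phi> x) - (LINT x:S|lebesgue. k x $ i * \<phi> x)"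
    unfolding left_diff_distrib vector_minus_component using loc[OF \<phi>D(4,5)]
    by (intro set_integral_diff int absolutely_integrable_vec_nth) auto
  ultimately show "(LINT x:S|lebesgue. (v x - w x) * partial i \<phi> x)
    = - (LINT x:S|lebesgue. (g x - k x) $ i * \<phi> x)"
    using eq by simp
qed

text \<open>A test function on the smaller set is one on the larger set. Applied to the interior of
  a simplex inside the domain, it makes the gradient of \<open>u\<close> also its elementwise
  gradient.\<close>

lemma is_weak_grad_subset:
  assumes v: "is_weak_grad S v g" and "T \<subseteq> S"
  shows "is_weak_grad T v g"
  unfolding is_weak_grad_def
proof (intro conjI allI impI)
  show "v absolutely_integrable_on C" "g absolutely_integrable_on C" if "compact C \<and> C \<subseteq> T" for C
    using assms that unfolding is_weak_grad_def by blast+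
  fix \<phi> i assume \<phi>: "test_function T \<phi>"
  note \<phi>D = test_functionD[OF \<phi>]
  have \<phi>S: "test_function S \<phi>"
    using \<phi> \<open>T \<subseteq> S\<close> unfolding test_function_def by blast
  have eq: "(LINT x:T|lebesgue. h x * \<theta> x) = (LINT x:S|lebesgue. h x * \<theta> x)"
    if "\<theta> \<in> {\<phi>, partial i \<phi>}" for h \<theta> :: "real^'a \<Rightarrow> real"
    unfolding set_lebesgue_integral_def
  proof (rule Bochner_Integration.integral_cong[OF refl])
    fix x
    show "indicator T x *\<^sub>R (h x * \<theta> x) = indicator S x *\<^sub>R (h x * \<theta> x)"
    proof (cases "x \<in> closure {x. \<phi> x \<noteq> 0}")
      case True
      then have "x \<in> T" "x \<in> S"
        using \<phi>D(5) \<open>T \<subseteq> S\<close> by blast+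
      then show ?thesis by simp
    next
      case False
      then have "\<theta> x = 0"
        using that \<phi>D(6)[OF False] \<phi>D(7)[OF False, of i] by blast
      then show ?thesis by simp
    qed
  qed
  show "(LINT x:T|lebesgue. v x * partial i \<phi> x) = - (LINT x:T|lebesgue. g x $ i * \<phi> x)"
    using v \<phi>S unfolding eq[of "partial i \<phi>" v, simplified] eq[of \<phi> "\<lambda>x. g x $ i", simplified]
      is_weak_grad_def by blast
qed

lemma is_weak_grad_cong_AE:
  assumes v: "is_weak_grad S v g" and ae: "AE x in lebesgue. x \<in> S \<longrightarrow> v x = w x"
  shows "is_weak_grad S w g"
  unfolding is_weak_grad_def
proof (intro conjI allI impI)
  show "g absolutely_integrable_on C" if "compact C \<and> C \<subseteq> S" for C
    using assms that unfolding is_weak_grad_def by blast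
  show w: "w absolutely_integrable_on C" if C: "compact C \<and> C \<subseteq> S" for C
  proof -
    have "integrable lebesgue (\<lambda>x. indicator C x *\<^sub>R v x)"
      using C v unfolding is_weak_grad_def set_integrable_def by blast
    moreover have ae_eq: "AE x in lebesgue. indicator C x *\<^sub>R v x = indicator C x *\<^sub>R w x"
      using ae by eventually_elim (use that in \<open>auto simp: indicator_def\<close>)
    ultimately show ?thesis
      unfolding set_integrable_def
      using integrable_cong_AE_imp[OF _ borel_measurable_AE[OF borel_measurable_integrable ae_eq]] by blast
  qed
  fix \<phi> i assume \<phi>: "test_function S \<phi>"
  note \<phi>D = test_functionD[OF \<phi>]
  let ?C = "closure {x. \<phi> x \<noteq> 0}"
  have "(LINT x:S|lebesgue. w x * partial i \<phi> x) = (LINT x:S|lebesgue. v x * partial i \<phi> x)"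
    unfolding set_lebesgue_integral_def
  proof (rule integral_cong_AE)
    have "(\<lambda>x. h x * partial i \<phi> x) absolutely_integrable_on S" if "h absolutely_integrable_on ?C" for h
      by (rule absolutely_integrable_mult_continuous(1)[OF that \<phi>D(4,5,2,7)])
    moreover have "v absolutely_integrable_on ?C"
      using v \<phi>D(4,5) unfolding is_weak_grad_def by blast
    ultimately show "(\<lambda>x. indicator S x *\<^sub>R (w x * partial i \<phi> x)) \<in> borel_measurable lebesgue"
      "(\<lambda>x. indicator S x *\<^sub>R (v x * partial i \<phi> x)) \<in> borel_measurable lebesgue"
      using w[of ?C] \<phi>D(4,5) unfolding set_integrable_def by (blast intro: borel_measurable_integrable)+
    show "AE x in lebesgue. indicator S x *\<^sub>R (w x * partial i \<phi> x) = indicator S x *\<^sub>R (v x * partial i \<phi> x)"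
      using ae by eventually_elim (auto simp: indicator_def)
  qed
  then show "(LINT x:S|lebesgue. w x * partial i \<phi> x) = - (LINT x:S|lebesgue. g x $ i * \<phi> x)"
    using v \<phi> unfolding is_weak_grad_def by simp
qed

section \<open>Affine changes of variables\<close>

lemma nn_integral_lborel_shift:
  fixes f :: "'a::euclidean_space \<Rightarrow> ennreal"
  assumes [measurable]: "f \<in> borel_measurable borel"
  shows "(\<integral>\<^sup>+y. f (a + y) \<partial>lborel) = (\<integral>\<^sup>+y. f y \<partial>lborel)"
    "(\<integral>\<^sup>+y. f (a - y) \<partial>lborel) = (\<integral>\<^sup>+y. f y \<partial>lborel)"
proof -
  have *: "(\<integral>\<^sup>+y. f (a + y) \<partial>lborel) = (\<integral>\<^sup>+y. f y \<partial>lborel)"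
    if [measurable]: "f \<in> borel_measurable borel" for f :: "'a \<Rightarrow> ennreal"
  proof -
    have "(\<integral>\<^sup>+y. f y \<partial>lborel) = (\<integral>\<^sup>+y. f y \<partial>distr lborel borel ((+) a))"
      by (simp add: lborel_distr_plus)
    then show ?thesis
      by (subst (asm) nn_integral_distr) auto
  qed
  show "(\<integral>\<^sup>+y. f (a + y) \<partial>lborel) = (\<integral>\<^sup>+y. f y \<partial>lborel)"
    by (rule *) measurable
  have "lborel = distr lborel borel (\<lambda>y. a + (-1) *\<^sub>R y)"
    using lborel_affine[of "-1" a] by (simp add: density_1)
  then have "(\<integral>\<^sup>+y. f y \<partial>lborel) = (\<integral>\<^sup>+y. f y \<partial>distr lborel borel (\<lambda>y. a + (-1) *\<^sub>R y))"
    by simp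
  then show "(\<integral>\<^sup>+y. f (a - y) \<partial>lborel) = (\<integral>\<^sup>+y. f y \<partial>lborel)"
    by (subst (asm) nn_integral_distr) auto
qed

lemma linear_affine_continuous_on:
  "linear (L::'a::euclidean_space \<Rightarrow> 'a) \<Longrightarrow> continuous_on S (\<lambda>x. L x + b)"
  by (intro continuous_intros) (simp add: linear_conv_bounded_linear linear_continuous_on)

text \<open>This is the uniqueness of Haar measure, by Fubini's theorem. The change of variables theorems of
  the library assume an index type of class \<^class>\<open>wellorder\<close>.\<close>

lemma distr_lborel_linear:
  fixes L :: "'a::euclidean_space \<Rightarrow> 'a"
  assumes L: "linear L" "inj L"
  obtains c where "c > 0" "distr lborel borel (\<lambda>x. L x + b) = density lborel (\<lambda>_. ennreal c)"
proof -
  obtain L' where L': "linear L'" "\<And>x. L' (L x) = x" "\<And>x. L (L' x) = x"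
    using linear_injective_isomorphism[OF L] by blast
  have [measurable]: "L \<in> borel_measurable borel"
    using borel_measurable_continuous_onI[OF linear_affine_continuous_on[OF L(1), of _ 0]] by simp
  let ?Q = "box 0 One :: 'a set"
  define c where "c = emeasure lborel (L -` ?Q)"
  have Q: "emeasure lborel ?Q = 1"
    by (simp add: emeasure_lborel_box_eq)
  have key: "emeasure lborel (L -` B) = c * emeasure lborel B" if [measurable]: "B \<in> sets borel" for B
  proof -
    have shift: "(\<integral>\<^sup>+x. indicator B (L x) * indicator ?Q (y + L x) \<partial>lborel)
      = (\<integral>\<^sup>+x. indicator B (L x - y) * indicator ?Q (L x) \<partial>lborel)" for y
    proof -
      have "L (- L' y + x) = L x - y" for x
        using linear_add[OF L(1)] linear_neg[OF L(1)] L'(3) by (simp add: linear_diff[OF L(1)])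
      then show ?thesis
        using nn_integral_lborel_shift(1)[of "\<lambda>x. indicator B (L x) * indicator ?Q (y + L x)" "- L' y"]
        by (simp only:) simp
    qed
    \<comment> \<open>The unit box is inserted as a factor integrated over y. Shifting y by L x and
      interchanging the integrals allows the translation of x by the preimage of y, which moves y
      from the box into B. After a second interchange, the reflection y -> L x - y integrates B to
      its full measure and leaves the preimage of the box as the constant.\<close>
    have "emeasure lborel (L -` B) = (\<integral>\<^sup>+x. indicator (L -` B) x \<partial>lborel)"
      using measurable_sets[of L borel borel B] by simp
    also have "\<dots> = (\<integral>\<^sup>+x. (\<integral>\<^sup>+y. indicator B (L x) * indicator ?Q y \<partial>lborel) \<partial>lborel)"
      by (intro nn_integral_cong) (simp add: nn_integral_cmult Q, simp add: indicator_def)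
    also have "\<dots> = (\<integral>\<^sup>+x. (\<integral>\<^sup>+y. indicator B (L x) * indicator ?Q (L x + y) \<partial>lborel) \<partial>lborel)"
    proof (rule nn_integral_cong)
      fix x
      show "(\<integral>\<^sup>+y. indicator B (L x) * indicator ?Q y \<partial>lborel)
        = (\<integral>\<^sup>+y. indicator B (L x) * indicator ?Q (L x + y) \<partial>lborel)"
        by (rule nn_integral_lborel_shift(1)[of "\<lambda>y. indicator B (L x) * indicator ?Q y", symmetric]) measurable
    qed
    also have "\<dots> = (\<integral>\<^sup>+y. (\<integral>\<^sup>+x. indicator B (L x) * indicator ?Q (y + L x) \<partial>lborel) \<partial>lborel)"
      by (subst lborel_pair.Fubini') (auto simp: add.commute)
    also have "\<dots> = (\<integral>\<^sup>+y. (\<integral>\<^sup>+x. indicator B (L x - y) * indicator ?Q (L x) \<partial>lborel) \<partial>lborel)"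
      unfolding shift ..
    also have "\<dots> = (\<integral>\<^sup>+x. (\<integral>\<^sup>+y. indicator B (L x - y) * indicator ?Q (L x) \<partial>lborel) \<partial>lborel)"
      by (subst lborel_pair.Fubini') auto
    also have "\<dots> = (\<integral>\<^sup>+x. emeasure lborel B * indicator (L -` ?Q) x \<partial>lborel)"
    proof (rule nn_integral_cong)
      fix x
      have "(\<integral>\<^sup>+y. indicator B (L x - y) * indicator ?Q (L x) \<partial>lborel)
        = (\<integral>\<^sup>+y. indicator B y * indicator ?Q (L x) \<partial>lborel)"
        by (rule nn_integral_lborel_shift(2)[of "\<lambda>y. indicator B y * indicator ?Q (L x)"]) measurable
      then show "(\<integral>\<^sup>+y. indicator B (L x - y) * indicator ?Q (L x) \<partial>lborel)
        = emeasure lborel B * indicator (L -` ?Q) x"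
        by (simp add: nn_integral_multc) (simp add: indicator_def)
    qed
    also have "\<dots> = emeasure lborel B * c"
      using measurable_sets[of L borel borel ?Q] by (simp add: nn_integral_cmult c_def)
    finally show ?thesis
      by (simp add: mult.commute)
  qed
  \<comment> \<open>The constant is positive because the preimage of the box is open and nonempty.
    It is finite because injectivity bounds L from below, so that this preimage is bounded.\<close>
  have op: "open (L -` ?Q)"
    using linear_affine_continuous_on[OF L(1), of UNIV 0] open_box
    by (intro open_vimage) auto
  have "L' (One /\<^sub>R 2) \<in> L -` ?Q"
    by (simp add: L'(3) box_def inner_simps)
  then have "\<not> negligible (L -` ?Q)"
    using open_not_negligible[OF op] by blast
  then have "L -` ?Q \<notin> null_sets lborel"
    using null_sets_completionI negligible_iff_null_sets by blast
  then have "c > 0"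
    using measurable_sets[of L borel borel ?Q] by (auto simp: c_def null_sets_def zero_less_iff_neq_zero)
  obtain B where B: "B > 0" "\<And>x. B * norm x \<le> norm (L x)"
    using linear_inj_bounded_below_pos[OF L] by blast
  obtain R where R: "\<And>x. x \<in> ?Q \<Longrightarrow> norm x \<le> R"
    using bounded_box[of 0 One] unfolding bounded_iff by blast
  have "L -` ?Q \<subseteq> cball 0 (R / B)"
  proof
    fix x assume "x \<in> L -` ?Q"
    then have "B * norm x \<le> R"
      using R[of "L x"] B(2)[of x] by simp
    then show "x \<in> cball 0 (R / B)"
      using B(1) by (simp add: field_simps)
  qed
  then have "c \<le> emeasure lborel (cball (0::'a) (R / B))"
    unfolding c_def by (intro emeasure_mono) auto
  then have "c < \<infinity>"
    using emeasure_compact_finite[of "cball (0::'a) (R / B)"] by (auto intro: le_less_trans)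
  obtain d where d: "c = ennreal d" "d > 0"
    using \<open>c > 0\<close> \<open>c < \<infinity>\<close> by (cases c) auto
  have "distr lborel borel (\<lambda>x. L x + b) = distr (distr lborel borel L) borel ((+) b)"
    by (subst distr_distr) (auto simp: o_def add.commute)
  also have "distr lborel borel L = density lborel (\<lambda>_. c)"
    by (rule measure_eqI) (auto simp: emeasure_distr emeasure_density key nn_integral_cmult)
  also have "distr (density lborel (\<lambda>_. c)) borel ((+) b) = density lborel (\<lambda>_. c)"
  proof (rule measure_eqI)
    fix A assume "A \<in> sets (distr (density lborel (\<lambda>_. c)) borel ((+) b))"
    then have A: "A \<in> sets borel" by simp
    then have bA: "(+) b -` A \<in> sets borel"
      using measurable_sets[of "(+) b" borel borel A] by simp
    have dens: "emeasure (density lborel (\<lambda>_. c)) X = c * emeasure lborel X" if "X \<in> sets borel" for X :: "'a set"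
      using that by (simp add: emeasure_density nn_integral_cmult)
    have "emeasure lborel A = emeasure (distr lborel borel ((+) b)) A"
      by (simp add: lborel_distr_plus)
    then have "emeasure lborel ((+) b -` A) = emeasure lborel A"
      using A by (simp add: emeasure_distr)
    then show "emeasure (distr (density lborel (\<lambda>_. c)) borel ((+) b)) A = emeasure (density lborel (\<lambda>_. c)) A"
      using A bA by (simp add: emeasure_distr dens)
  qed simp
  finally show ?thesis
    using that d by blast
qed

text \<open>Measurability suffices: \<open>f\<close> and its composition with the affine map are
  integrable together, and otherwise both integrals are 0 by convention.\<close>

lemma integral_affine_image:
  fixes L :: "'a::euclidean_space \<Rightarrow> 'a"
  assumes L: "linear L" "inj L"
  obtains c where "c > 0"
    "\<And>f::'a \<Rightarrow> real. f \<in> borel_measurable borel \<Longrightarrow> (LINT x|lborel. f (L x + b)) = c * (LINT x|lborel. f x)"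
proof -
  obtain c where c: "c > 0" "distr lborel borel (\<lambda>x. L x + b) = density lborel (\<lambda>_. ennreal c)"
    using distr_lborel_linear[OF L] by blast
  have Lm: "(\<lambda>x. L x + b) \<in> borel_measurable borel"
    by (intro borel_measurable_continuous_onI linear_affine_continuous_on L)
  show ?thesis
  proof (rule that[OF c(1)])
    fix f :: "'a \<Rightarrow> real" assume f: "f \<in> borel_measurable borel"
    have "(LINT x|lborel. f (L x + b)) = (LINT x|distr lborel borel (\<lambda>x. L x + b). f x)"
      using f Lm by (subst integral_distr) auto
    also have "\<dots> = c * (LINT x|lborel. f x)"
      using f c(1) unfolding c(2) by (subst integral_density) auto
    finally show "(LINT x|lborel. f (L x + b)) = c * (LINT x|lborel. f x)" .
  qed
qed

text \<open>Applying the map twice squares the Jacobian constant. Testing with a unit box shows that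
  the square is 1, so the constant is 1 by positivity, with no determinant involved.\<close>

lemma integral_affine_involution:
  fixes T :: "'a::euclidean_space \<Rightarrow> 'a" and f :: "'a \<Rightarrow> real"
  assumes L: "linear L" and T: "\<And>x. T x = L x + b" "\<And>x. T (T x) = x" and f: "f \<in> borel_measurable borel"
  shows "(LINT x|lborel. f (T x)) = (LINT x|lborel. f x)"
proof -
  have "inj L"
  proof (rule injI)
    fix x y assume "L x = L y"
    then have "T (T x) = T (T y)" by (simp add: T(1))
    then show "x = y" by (simp add: T(2))
  qed
  then obtain c where c: "c > 0"
    "\<And>f::'a \<Rightarrow> real. f \<in> borel_measurable borel \<Longrightarrow> (LINT x|lborel. f (T x)) = c * (LINT x|lborel. f x)"
    using integral_affine_image[OF L, of b] unfolding T(1) by blast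
  have Tm: "T \<in> borel_measurable borel"
    unfolding T(1)[abs_def] by (intro borel_measurable_continuous_onI linear_affine_continuous_on L)
  let ?g = "indicat_real (box 0 One :: 'a set)"
  have g1: "(LINT x|lborel. ?g x) = 1"
    by simp
  have "(LINT x|lborel. ?g (T (T x))) = c * (LINT x|lborel. ?g (T x))"
    using Tm by (intro c(2)) (auto intro: measurable_compose)
  also have "\<dots> = c * (c * (LINT x|lborel. ?g x))"
    by (subst c(2)) auto
  finally have "c * c = 1"
    unfolding T(2) g1 by simp
  with c(1) have "c = 1"
    by (metis abs_of_pos abs_square_eq_1 power2_eq_square)
  then show ?thesis
    using c(2)[OF f] by simp
qed

section \<open>Simplices and their moments\<close>

lemma affine_sum_eq:
  fixes g :: "'a::real_inner"
  assumes "finite V" "sum u V = 1"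
  shows "g \<bullet> (\<Sum>a\<in>V. u a *\<^sub>R a) + b = (\<Sum>a\<in>V. u a * (g \<bullet> a + b))"
  using assms by (simp add: inner_sum_right distrib_left sum.distrib flip: sum_distrib_right)

section \<open>Barycentric coordinates\<close>

definition foot :: "'a::euclidean_space set \<Rightarrow> 'a \<Rightarrow> 'a" where
  "foot V a = closest_point (affine hull (V - {a})) a"

text \<open>The height vector from the opposite face to \<open>a\<close>, divided by its squared
  length: the gradient of the affine function that is 1 at \<open>a\<close> and 0 on that
  face.\<close>

definition bary_grad :: "'a::euclidean_space set \<Rightarrow> 'a \<Rightarrow> 'a" where
  "bary_grad V a = (1 / (norm (a - foot V a))\<^sup>2) *\<^sub>R (a - foot V a)"

text \<open>Written in the form \<open>g \<bullet> x + b\<close>, so that statements about affine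
  functions and shears apply by unfolding.\<close>

definition bary :: "'a::euclidean_space set \<Rightarrow> 'a \<Rightarrow> 'a \<Rightarrow> real" where
  "bary V a x = bary_grad V a \<bullet> x + - (bary_grad V a \<bullet> foot V a)"

lemma bary_add: "bary V a (x + h) = bary V a x + bary_grad V a \<bullet> h"
  by (simp add: bary_def inner_add_right)

lemma continuous_on_bary: "continuous_on S (bary V a)"
  unfolding bary_def[abs_def] by (intro continuous_intros)

lemma bary_measurable: "bary V a \<in> borel_measurable borel"
  by (rule borel_measurable_continuous_onI[OF continuous_on_bary])

locale nondegenerate_simplex =
  fixes V :: "(real^'n) set"
  assumes indep: "\<not> affine_dependent V" and card: "card V = CARD('n) + 1"
begin

abbreviation "K \<equiv> convex hull V"

lemma finite_V: "finite V"
  using indep by (rule aff_independent_finite)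

lemma V_nonempty: "V \<noteq> {}"
  using card by auto

lemma affine_hull_V: "affine hull V = UNIV"
  using affine_independent_span_eq[OF indep] card by simp

lemma other_vertex:
  obtains b where "b \<in> V" "b \<noteq> a"
proof -
  have "card V \<ge> 2"
    using card by (simp add: Suc_leI)
  then have "\<not> V \<subseteq> {a}"
    using card_mono[of "{a}" V] by auto
  then show ?thesis
    using that by blast
qed

lemma
  assumes a: "a \<in> V"
  shows foot_in: "foot V a \<in> affine hull (V - {a})"
    and foot_neq: "a \<noteq> foot V a"
    and foot_orth: "x \<in> affine hull (V - {a}) \<Longrightarrow> (a - foot V a) \<bullet> (x - foot V a) = 0"
proof -
  let ?H = "affine hull (V - {a})"
  obtain b where "b \<in> V" "b \<noteq> a" by (rule other_vertex)
  then have "b \<in> ?H"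
    by (simp add: hull_inc)
  then have ne: "?H \<noteq> {}" by blast
  then show fin: "foot V a \<in> ?H"
    unfolding foot_def by (intro closest_point_in_set) auto
  have "a \<notin> ?H"
    using indep a unfolding affine_dependent_def by blast
  with fin show "a \<noteq> foot V a" by auto
  assume x: "x \<in> ?H"
  have le: "(a - foot V a) \<bullet> (y - foot V a) \<le> 0" if "y \<in> ?H" for y
    unfolding foot_def using that by (intro closest_point_dot) (auto simp: affine_imp_convex)
  \<comment> \<open>The closest point satisfies only a variational inequality. The point reflection
    of x in the foot also lies in the affine hull, and the two inequalities together give
    orthogonality.\<close>
  have "2 *\<^sub>R foot V a + (-1) *\<^sub>R x \<in> ?H"
    using fin x by (intro mem_affine) auto
  from le[OF this] le[OF x] show "(a - foot V a) \<bullet> (x - foot V a) = 0"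
    by (simp add: inner_diff_right inner_add_right)
qed

lemma bary_vertex:
  assumes a: "a \<in> V" and b: "b \<in> V"
  shows "bary V a b = (if b = a then 1 else 0)"
proof -
  have *: "bary V a x = ((a - foot V a) \<bullet> (x - foot V a)) / (norm (a - foot V a))\<^sup>2" for x
    by (simp add: bary_def bary_grad_def inner_diff_right diff_divide_distrib)
  show ?thesis
  proof (cases "b = a")
    case True
    then show ?thesis
      using foot_neq[OF a] by (simp add: * power2_norm_eq_inner)
  next
    case False
    then show ?thesis
      using foot_orth[OF a, of b] b by (simp add: * hull_inc)
  qed
qed

lemma bary_grad_vertex:
  assumes "a \<in> V" "p \<in> V" "q \<in> V"
  shows "bary_grad V a \<bullet> (q - p) = (if q = a then 1 else 0) - (if p = a then 1 else 0)"
  using bary_vertex[OF assms(1,2)] bary_vertex[OF assms(1,3)]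
  by (simp add: bary_def inner_diff_right)

lemma bary_affine_comb:
  assumes "sum u V = 1" "a \<in> V"
  shows "bary V a (\<Sum>b\<in>V. u b *\<^sub>R b) = u a"
proof -
  have "bary V a (\<Sum>b\<in>V. u b *\<^sub>R b) = (\<Sum>b\<in>V. u b * bary V a b)"
    unfolding bary_def by (rule affine_sum_eq[OF finite_V assms(1)])
  also have "\<dots> = (\<Sum>b\<in>V. if b = a then u b else 0)"
    by (intro sum.cong) (auto simp: bary_vertex assms)
  finally show ?thesis
    using finite_V assms(2) by simp
qed

lemma bary_sum: "(\<Sum>a\<in>V. bary V a x) = 1" and bary_expand: "(\<Sum>a\<in>V. bary V a x *\<^sub>R a) = x"
proof -
  have "x \<in> affine hull V"
    by (simp add: affine_hull_V)
  then obtain u where u: "sum u V = 1" "(\<Sum>b\<in>V. u b *\<^sub>R b) = x"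
    unfolding affine_hull_finite[OF finite_V] by blast
  have "bary V a x = u a" if "a \<in> V" for a
    using bary_affine_comb[OF u(1) that] u(2) by simp
  then show "(\<Sum>a\<in>V. bary V a x) = 1" "(\<Sum>a\<in>V. bary V a x *\<^sub>R a) = x"
    using u by (simp_all cong: sum.cong)
qed

lemma affine_bary_expand: "g \<bullet> x + b = (\<Sum>a\<in>V. bary V a x * (g \<bullet> a + b))"
  using affine_sum_eq[OF finite_V bary_sum, of g x b] by (simp add: bary_expand)

lemma K_eq: "K = {x. \<forall>a\<in>V. bary V a x \<ge> 0}"
proof (intro set_eqI iffI)
  fix x assume "x \<in> K"
  then obtain u where u: "\<forall>a\<in>V. 0 \<le> u a" "sum u V = 1" "(\<Sum>b\<in>V. u b *\<^sub>R b) = x"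
    unfolding convex_hull_finite[OF finite_V] by blast
  then show "x \<in> {x. \<forall>a\<in>V. bary V a x \<ge> 0}"
    using bary_affine_comb[OF u(2)] by auto
next
  fix x assume x: "x \<in> {x. \<forall>a\<in>V. bary V a x \<ge> 0}"
  then show "x \<in> K"
    unfolding convex_hull_finite[OF finite_V]
    by (intro CollectI exI[of _ "\<lambda>a. bary V a x"]) (simp add: bary_sum bary_expand)
qed

lemma face_eq:
  assumes a: "a \<in> V"
  shows "convex hull (V - {a}) = {x \<in> K. bary V a x = 0}"
proof (intro set_eqI iffI)
  fix x assume "x \<in> convex hull (V - {a})"
  then have xK: "x \<in> K" and "x \<in> affine hull (V - {a})"
    using hull_mono[of "V - {a}" V convex] convex_hull_subset_affine_hull by blast+
  then have "(a - foot V a) \<bullet> (x - foot V a) = 0"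
    using foot_orth[OF a] by blast
  then have "bary V a x = 0"
    by (simp add: bary_def bary_grad_def inner_diff_right)
  with xK show "x \<in> {x \<in> K. bary V a x = 0}" by simp
next
  fix x assume x: "x \<in> {x \<in> K. bary V a x = 0}"
  have "(\<Sum>b\<in>V - {a}. bary V b x) = 1" "(\<Sum>b\<in>V - {a}. bary V b x *\<^sub>R b) = x"
    using bary_sum[of x] bary_expand[of x] x a finite_V by (simp_all add: sum.remove[of V a])
  then show "x \<in> convex hull (V - {a})"
    using x finite_V unfolding convex_hull_finite[OF finite_Diff[OF finite_V]] K_eq
    by (intro CollectI exI[of _ "\<lambda>b. bary V b x"]) auto
qed

lemma compact_K: "compact K"
  using finite_V by (rule finite_imp_compact_convex_hull)

lemma interior_K_nonempty: "interior K \<noteq> {}"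
proof -
  have "rel_interior K = interior K"
    using affine_hull_V by (intro rel_interior_interior) simp
  then show ?thesis
    using rel_interior_eq_empty[OF convex_convex_hull, of V] V_nonempty by simp
qed

lemma measure_K_pos: "measure lborel K > 0"
proof -
  have "\<not> negligible K"
    using interior_K_nonempty negligible_subset[OF _ interior_subset] open_not_negligible[OF open_interior] by blast
  then have "measure lebesgue K \<noteq> 0"
    using lmeasurable_compact[OF compact_K] negligible_iff_measure by blast
  then show ?thesis
    using compact_K by (simp add: zero_less_measure_iff borel_compact)
qed

lemma mid_K: "mid K = (1 / (real CARD('n) + 1)) *\<^sub>R (\<Sum>a\<in>V. a)"
proof -
  have "vertices K = V"
    using extreme_point_of_convex_hull_affine_independent[OF indep] by (auto simp: vertices_def)
  then show ?thesis
    by (simp add: mid_def)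
qed

lemma vertices_K: "vertices K = V"
  using extreme_point_of_convex_hull_affine_independent[OF indep] by (auto simp: vertices_def)

lemma sum_V_diff_mid: "(\<Sum>a\<in>V. a - mid K) = 0"
proof -
  have "(\<Sum>a\<in>V. mid K) = real (card V) *\<^sub>R mid K"
    by (rule sum_constant_scaleR)
  moreover have "real (card V) * (1 / (real CARD('n) + 1)) = 1"
    by (simp add: card field_simps add_pos_nonneg)
  ultimately have "(\<Sum>a\<in>V. mid K) = (\<Sum>a\<in>V. a)"
    unfolding mid_K scaleR_scaleR by (simp only: scaleR_one)
  then show ?thesis
    by (simp only: sum_subtractf diff_self)
qed

lemma integrable_K:
  assumes "continuous_on UNIV (f :: _ \<Rightarrow> real)"
  shows "integrable lborel (\<lambda>x. indicator K x * f x)"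
  using borel_integrable_compact[OF compact_K continuous_on_subset[OF assms subset_UNIV]] by simp

end

text \<open>The quantity assumed to be nonzero is the determinant of the linear part, a rank-one
  perturbation of the identity. The constant is left unspecified; where it matters, inserting the
  constant function 1 expresses it by volumes.\<close>

lemma integral_shear:
  fixes w \<gamma> :: "'a::euclidean_space"
  assumes "1 + \<gamma> \<bullet> w \<noteq> 0"
  obtains c where "c > 0" "\<And>f::'a \<Rightarrow> real. f \<in> borel_measurable borel \<Longrightarrow>
    (LINT x|lborel. f (x + (\<gamma> \<bullet> x + \<beta>) *\<^sub>R w)) = c * (LINT x|lborel. f x)"
proof -
  let ?L = "\<lambda>x. x + (\<gamma> \<bullet> x) *\<^sub>R w"
  have lin: "linear ?L"
    by (rule linearI) (auto simp: inner_add_right algebra_simps)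
  have "inj ?L"
  proof (subst linear_injective_0[OF lin], intro allI impI)
    fix x assume x: "?L x = 0"
    have "\<gamma> \<bullet> ?L x = 0"
      by (simp only: x inner_zero_right)
    then have "\<gamma> \<bullet> x * (1 + \<gamma> \<bullet> w) = 0"
      by (simp add: inner_add_right algebra_simps)
    with assms x show "x = 0" by simp
  qed
  then obtain c where c: "c > 0" "\<And>f::'a \<Rightarrow> real. f \<in> borel_measurable borel \<Longrightarrow>
      (LINT x|lborel. f (?L x + \<beta> *\<^sub>R w)) = c * (LINT x|lborel. f x)"
    using integral_affine_image[OF lin] by blast
  have "?L x + \<beta> *\<^sub>R w = x + (\<gamma> \<bullet> x + \<beta>) *\<^sub>R w" for x
    by (simp add: scaleR_add_left)
  with c that show ?thesis
    by (simp only:)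
qed

lemma inner_matrix_sum:
  fixes B :: "real^'n^'n"
  shows "(\<Sum>a\<in>V. c a *\<^sub>R d a) \<bullet> (B *v (\<Sum>b\<in>V. c b *\<^sub>R d b)) = (\<Sum>a\<in>V. \<Sum>b\<in>V. (c a * c b) * (d a \<bullet> (B *v d b)))"
proof -
  have "(\<Sum>a\<in>V. c a *\<^sub>R d a) \<bullet> w = (\<Sum>a\<in>V. c a * (d a \<bullet> w))" for w
    by (simp add: inner_sum_left)
  moreover have "B *v (\<Sum>b\<in>V. c b *\<^sub>R d b) = (\<Sum>b\<in>V. c b *\<^sub>R (B *v d b))"
    by (simp add: linear_sum[OF matrix_vector_mul_linear] linear_cmul[OF matrix_vector_mul_linear])
  ultimately have "(\<Sum>a\<in>V. c a *\<^sub>R d a) \<bullet> (B *v (\<Sum>b\<in>V. c b *\<^sub>R d b))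
      = (\<Sum>a\<in>V. c a * (d a \<bullet> (\<Sum>b\<in>V. c b *\<^sub>R (B *v d b))))"
    by (simp only:)
  then show ?thesis
    by (simp add: inner_sum_right sum_distrib_left mult.assoc)
qed

text \<open>The value -2 turns the shear into an oblique reflection, which is its own inverse and
  hence preserves integrals.\<close>

lemma integral_shear_involution:
  fixes w \<gamma> :: "'a::euclidean_space" and f :: "'a \<Rightarrow> real"
  assumes "\<gamma> \<bullet> w = - 2" and f: "f \<in> borel_measurable borel"
  shows "(LINT x|lborel. f (x + (\<gamma> \<bullet> x + \<beta>) *\<^sub>R w)) = (LINT x|lborel. f x)"
proof (rule integral_affine_involution[OF _ _ _ f])
  let ?L = "\<lambda>x. x + (\<gamma> \<bullet> x) *\<^sub>R w" and ?T = "\<lambda>x. x + (\<gamma> \<bullet> x + \<beta>) *\<^sub>R w"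
  show "linear ?L"
    by (rule linearI) (auto simp: inner_add_right algebra_simps)
  show "?T x = ?L x + \<beta> *\<^sub>R w" for x
    by (simp add: scaleR_add_left)
  show "?T (?T x) = x" for x
    using assms(1) by (simp add: inner_add_right algebra_simps)
qed

section \<open>Moments of a simplex from its symmetries\<close>

context nondegenerate_simplex
begin

text \<open>The affine map that exchanges the vertices p and q and fixes the others: it permutes the
  barycentric coordinates.\<close>

definition swap :: "real^'n \<Rightarrow> real^'n \<Rightarrow> real^'n \<Rightarrow> real^'n" where
  "swap p q x = x + (bary V p x - bary V q x) *\<^sub>R (q - p)"

lemma bary_swap:
  assumes "p \<in> V" "q \<in> V" "p \<noteq> q" "r \<in> V"
  shows "bary V r (swap p q x) = bary V (if r = p then q else if r = q then p else r) x"
  using assms bary_grad_vertex[OF assms(4,1,2)]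
  by (auto simp: swap_def bary_add inner_scaleR_right)

lemma swap_in_K:
  assumes "p \<in> V" "q \<in> V" "p \<noteq> q"
  shows "swap p q x \<in> K \<longleftrightarrow> x \<in> K"
proof -
  have "0 \<le> bary V r (swap p q x)" if "\<forall>r\<in>V. 0 \<le> bary V r x" "r \<in> V" for r
    using that assms by (simp add: bary_swap)
  moreover have "0 \<le> bary V r x" if "\<forall>r\<in>V. 0 \<le> bary V r (swap p q x)" "r \<in> V" for r
  proof -
    define r' where "r' = (if r = p then q else if r = q then p else r)"
    have r': "r' \<in> V" "(if r' = p then q else if r' = q then p else r') = r"
      using assms that(2) by (auto simp: r'_def)
    have "0 \<le> bary V r' (swap p q x)"
      using that(1) r'(1) by blast
    then show ?thesis
      by (simp only: bary_swap[OF assms r'(1)] r'(2))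
  qed
  ultimately show ?thesis
    unfolding K_eq by blast
qed

lemma integral_swap:
  fixes f :: "real^'n \<Rightarrow> real"
  assumes p: "p \<in> V" "q \<in> V" "p \<noteq> q" and f: "f \<in> borel_measurable borel"
  shows "(LINT x|lborel. f (swap p q x)) = (LINT x|lborel. f x)"
proof -
  let ?g = "bary_grad V p - bary_grad V q"
  obtain \<beta> where \<beta>: "\<And>x. bary V p x - bary V q x = ?g \<bullet> x + \<beta>"
    by (auto simp: bary_def inner_diff_left algebra_simps
      intro!: that[of "bary_grad V q \<bullet> foot V q - bary_grad V p \<bullet> foot V p"])
  have "?g \<bullet> (q - p) = - 2"
    using bary_grad_vertex[OF p(1,1,2)] bary_grad_vertex[OF p(2,1,2)] p(3) by (simp add: inner_diff_left)
  from integral_shear_involution[OF this f, of \<beta>] show ?thesis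
    by (simp add: swap_def \<beta>)
qed

lemma integral_K_swap:
  fixes f :: "real^'n \<Rightarrow> real"
  assumes p: "p \<in> V" "q \<in> V" "p \<noteq> q" and f: "f \<in> borel_measurable borel"
  shows "(LINT x|lborel. indicator K x * f (swap p q x)) = (LINT x|lborel. indicator K x * f x)"
proof -
  have "(\<lambda>x. indicator K x * f x) \<in> borel_measurable borel"
    using f compact_K by (intro borel_measurable_times borel_measurable_indicator) (auto intro: borel_compact)
  from integral_swap[OF p this] show ?thesis
    by (simp add: indicator_def swap_in_K[OF p])
qed

lemma cont_bary: "continuous_on UNIV (\<lambda>x. bary V a x)"
  using continuous_on_bary .

text \<open>Swapping vertices shows that all coordinates have the same integral, and the n + 1
  coordinates add up to 1.\<close>

lemma integral_bary:
  assumes "a \<in> V"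
  shows "(LINT x|lborel. indicator K x * bary V a x) = measure lborel K / (real CARD('n) + 1)"
proof -
  let ?I = "\<lambda>a. LINT x|lborel. indicator K x * bary V a x"
  have eq: "?I b = ?I a" if "b \<in> V" for b
  proof (cases "b = a")
    case False
    then show ?thesis
      using integral_K_swap[OF assms that _ bary_measurable[of V a]] assms that by (simp add: bary_swap)
  qed simp
  have "measure lborel K = (LINT x|lborel. indicator K x)"
    using compact_K by (simp add: borel_compact)
  also have "\<dots> = (LINT x|lborel. (\<Sum>b\<in>V. indicator K x * bary V b x))"
    by (simp add: bary_sum flip: sum_distrib_left)
  also have "\<dots> = (\<Sum>b\<in>V. ?I b)"
    by (intro Bochner_Integration.integral_sum integrable_K cont_bary)
  also have "\<dots> = (real CARD('n) + 1) * ?I a"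
    using eq by (simp add: card add.commute cong: sum.cong)
  finally show ?thesis
    by (simp add: field_simps add_pos_nonneg)
qed

text \<open>The map \<open>x \<mapsto> x + bary V q x (p - q)/2\<close> fixes all vertices but \<open>q\<close>, which is sent to the midpoint
  of the edge \<open>p q\<close>. It maps the simplex onto one of its two halves.\<close>

lemma integral_bary_square:
  assumes p: "p \<in> V" "q \<in> V" "p \<noteq> q"
  shows "(LINT x|lborel. indicator K x * (bary V p x)\<^sup>2) = 2 * (LINT x|lborel. indicator K x * (bary V p x * bary V q x))"
proof -
  let ?T = "\<lambda>x. x + bary V q x *\<^sub>R ((p - q) /\<^sub>R 2)"
  let ?K1 = "{x \<in> K. bary V q x \<le> bary V p x}"
  have T: "bary V r (?T x) = bary V r x + bary V q x * ((if r = p then 1 else 0) - (if r = q then 1 else 0)) / 2"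
    if "r \<in> V" for r x
    using bary_grad_vertex[OF that p(2,1)] by (auto simp: bary_add)
  have K1: "?T x \<in> ?K1 \<longleftrightarrow> x \<in> K" for x
  proof -
    have "?T x \<in> ?K1 \<longleftrightarrow> (\<forall>r\<in>V. 0 \<le> bary V r (?T x)) \<and> bary V q (?T x) \<le> bary V p (?T x)"
      unfolding K_eq by blast
    also have "\<dots> \<longleftrightarrow> (\<forall>r\<in>V. 0 \<le> bary V r x)"
    proof (intro iffI conjI ballI; (elim conjE)?)
      fix r assume *: "\<forall>r\<in>V. 0 \<le> bary V r (?T x)" "bary V q (?T x) \<le> bary V p (?T x)" "r \<in> V"
      then have "0 \<le> bary V r (?T x)" by blast
      then show "0 \<le> bary V r x"
        using *(2) p T[OF p(1), of x] T[OF p(2), of x] T[OF *(3), of x] by (auto split: if_splits)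
    next
      fix r assume *: "\<forall>r\<in>V. 0 \<le> bary V r x" "r \<in> V"
      then have "0 \<le> bary V r x" "0 \<le> bary V q x" using p by auto
      then show "0 \<le> bary V r (?T x)"
        using T[OF *(2), of x] p by auto
    next
      assume *: "\<forall>r\<in>V. 0 \<le> bary V r x"
      then show "bary V q (?T x) \<le> bary V p (?T x)"
        using T[OF p(1), of x] T[OF p(2), of x] p by auto
    qed
    finally show ?thesis unfolding K_eq by blast
  qed
  have cl: "compact ?K1"
  proof -
    have "?K1 = K \<inter> {x. bary V q x \<le> bary V p x}" by blast
    then show ?thesis
      using compact_K by (auto intro!: compact_Int_closed closed_Collect_le cont_bary)
  qed
  have "1 + bary_grad V q \<bullet> ((p - q) /\<^sub>R 2) \<noteq> 0"
    using bary_grad_vertex[OF p(2,2,1)] p(3) by simp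
  then obtain c where c: "c > 0" "\<And>f::_ \<Rightarrow> real. f \<in> borel_measurable borel \<Longrightarrow>
    (LINT x|lborel. f (?T x)) = c * (LINT x|lborel. f x)"
    unfolding bary_def using integral_shear by blast
  have cov: "(LINT x|lborel. indicator K x * f (?T x)) = c * (LINT x|lborel. indicator ?K1 x * f x)"
    if "f \<in> borel_measurable borel" for f :: "_ \<Rightarrow> real"
  proof -
    have "(\<lambda>x. indicator ?K1 x * f x) \<in> borel_measurable borel"
      using that cl by (intro borel_measurable_times borel_measurable_indicator) (auto intro: borel_compact)
    moreover have "indicator ?K1 (?T x) = (indicator K x :: real)" for x
      using K1[of x] by (simp only: indicator_def)
    ultimately show ?thesis
      using c(2)[of "\<lambda>x. indicator ?K1 x * f x"] by (simp only:)
  qed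
  let ?d = "\<lambda>x. bary V p x - bary V q x"
  have dm: "?d \<in> borel_measurable borel"
    by (intro borel_measurable_diff bary_measurable)
  \<comment> \<open>\<open>swap\<close> exchanges the two halves of the simplex and changes the sign
    of \<open>?d\<close>, which an even function does not see; the halves overlap only in a
    hyperplane.\<close>
  have halves: "(LINT x|lborel. indicator K x * h (?d x)) = 2 * (LINT x|lborel. indicator ?K1 x * h (?d x))"
    if h: "continuous_on UNIV h" "\<And>t. h (- t) = h t" for h :: "real \<Rightarrow> real"
  proof -
    let ?K2 = "{x \<in> K. bary V p x \<le> bary V q x}"
    have hm: "(\<lambda>x. h (?d x)) \<in> borel_measurable borel"
      using dm borel_measurable_continuous_onI[OF h(1)] by (rule measurable_compose)
    have "(\<lambda>x. indicator ?K1 x * h (?d x)) \<in> borel_measurable borel"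
      using hm cl by (intro borel_measurable_times borel_measurable_indicator) (auto intro: borel_compact)
    from integral_swap[OF p this]
    have "(LINT x|lborel. indicator ?K1 (swap p q x) * h (?d (swap p q x))) = (LINT x|lborel. indicator ?K1 x * h (?d x))" .
    moreover have "indicator ?K1 (swap p q x) * h (?d (swap p q x)) = indicator ?K2 x * h (?d x)" for x
      using p h(2)[of "?d x"] by (auto simp: indicator_def swap_in_K bary_swap)
    ultimately have K2: "(LINT x|lborel. indicator ?K2 x * h (?d x)) = (LINT x|lborel. indicator ?K1 x * h (?d x))"
      by (simp only:)
    have hc: "continuous_on UNIV (\<lambda>x. h (?d x))"
      by (intro continuous_on_compose2[OF h(1)] continuous_intros cont_bary) auto
    have "?K2 = K \<inter> {x. bary V p x \<le> bary V q x}" by blast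
    then have cl2: "compact ?K2"
      using compact_K by (auto intro!: compact_Int_closed closed_Collect_le cont_bary)
    have int: "integrable lborel (\<lambda>x. indicator S x * h (?d x))" if "compact S" for S
      using borel_integrable_compact[OF that continuous_on_subset[OF hc subset_UNIV]] by simp
    let ?N = "{x. (bary_grad V p - bary_grad V q) \<bullet> x
      = bary_grad V p \<bullet> foot V p - bary_grad V q \<bullet> foot V q}"
    have "(bary_grad V p - bary_grad V q) \<bullet> (q - p) \<noteq> 0"
      using bary_grad_vertex[OF p(1,1,2)] bary_grad_vertex[OF p(2,1,2)] p(3) by (simp add: inner_diff_left)
    then have "bary_grad V p - bary_grad V q \<noteq> 0" by auto
    then have "negligible ?N"
      by (intro negligible_hyperplane) simp
    then have "AE x in lebesgue. x \<notin> ?N"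
      by (intro AE_not_in) (simp add: negligible_iff_null_sets)
    then have N: "AE x in lborel. x \<notin> ?N"
      by (simp add: AE_completion_iff)
    have "(LINT x|lborel. indicator K x * h (?d x))
      = (LINT x|lborel. indicator ?K1 x * h (?d x) + indicator ?K2 x * h (?d x))"
    proof (rule integral_cong_AE)
      show "AE x in lborel. indicator K x * h (?d x) = indicator ?K1 x * h (?d x) + indicator ?K2 x * h (?d x)"
        using N by eventually_elim (auto simp: indicator_def bary_def inner_diff_left)
    qed (use int cl cl2 compact_K in \<open>auto intro!: borel_measurable_integrable integrable_add\<close>)
    also have "\<dots> = 2 * (LINT x|lborel. indicator ?K1 x * h (?d x))"
      using int cl cl2 K2 by (subst Bochner_Integration.integral_add) auto
    finally show ?thesis .
  qed
  have dT: "?d (?T x) = bary V p x" for x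
    using T[OF p(1), of x] T[OF p(2), of x] p by auto
  have m: "measure lborel K = (LINT x|lborel. indicator K x * 1)"
    using compact_K by (simp add: borel_compact)
  then have half: "(LINT x|lborel. indicator ?K1 x * 1) = measure lborel K / 2"
    using halves[of "\<lambda>t. 1"] by simp
  \<comment> \<open>The Jacobian constant follows from volumes: the image of the simplex is one of
    two halves of equal measure.\<close>
  have "measure lborel K = c * (measure lborel K / 2)"
    using cov[OF borel_measurable_const[of 1]] unfolding half m[symmetric] by simp
  then have "c = 2"
    using measure_K_pos by simp
  \<comment> \<open>Along the map, \<open>?d\<close> becomes the coordinate of p. Hence the square
    of this coordinate and the square of \<open>?d\<close> have the same integral over the simplex,
    and expanding the latter leaves the claim.\<close>
  have "(LINT x|lborel. indicator K x * (bary V p x)\<^sup>2) = 2 * (LINT x|lborel. indicator ?K1 x * (?d x)\<^sup>2)"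
    using cov[of "\<lambda>x. (?d x)\<^sup>2"] dm unfolding dT \<open>c = 2\<close> by simp
  also have "\<dots> = (LINT x|lborel. indicator K x * (?d x)\<^sup>2)"
    by (subst halves[of "\<lambda>t. t\<^sup>2"]) (auto intro: continuous_intros)
  also have "\<dots> = (LINT x|lborel. indicator K x * (bary V p x)\<^sup>2 + indicator K x * (bary V q x)\<^sup>2
      - 2 * (indicator K x * (bary V p x * bary V q x)))"
    by (intro Bochner_Integration.integral_cong) (auto simp: power2_eq_square algebra_simps)
  also have "\<dots> = (LINT x|lborel. indicator K x * (bary V p x)\<^sup>2) + (LINT x|lborel. indicator K x * (bary V q x)\<^sup>2)
      - 2 * (LINT x|lborel. indicator K x * (bary V p x * bary V q x))"
  proof -
    have "integrable lborel (\<lambda>x. indicator K x * (bary V r x)\<^sup>2)"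
      "integrable lborel (\<lambda>x. indicator K x * (bary V p x * bary V q x))" for r
      by (intro integrable_K continuous_intros cont_bary)+
    then show ?thesis by simp
  qed
  also have "(LINT x|lborel. indicator K x * (bary V q x)\<^sup>2) = (LINT x|lborel. indicator K x * (bary V p x)\<^sup>2)"
    using integral_K_swap[OF p, of "\<lambda>x. (bary V p x)\<^sup>2"] bary_measurable[of V p] p by (simp add: bary_swap)
  finally show ?thesis by simp
qed

text \<open>Multiplying the coordinate of p by the sum of all coordinates gives back the first
  moment. Every mixed moment is half the square moment J, so J (1 + n/2) is known.\<close>

lemma integral_bary_bary:
  assumes p: "p \<in> V" and q: "q \<in> V"
  shows "(LINT x|lborel. indicator K x * (bary V p x * bary V q x))
    = (if p = q then 2 else 1) * measure lborel K / ((real CARD('n) + 1) * (real CARD('n) + 2))"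
proof -
  let ?J = "\<lambda>q. LINT x|lborel. indicator K x * (bary V p x * bary V q x)"
  let ?n = "real CARD('n)"
  have int: "integrable lborel (\<lambda>x. indicator K x * (bary V p x * bary V r x))" for r
    by (intro integrable_K continuous_intros cont_bary)
  have sq: "?J r = ?J p / 2" if "r \<in> V" "r \<noteq> p" for r
    using integral_bary_square[OF p that(1)] that(2) by (simp add: power2_eq_square)
  have "measure lborel K / (?n + 1) = (LINT x|lborel. (\<Sum>r\<in>V. indicator K x * (bary V p x * bary V r x)))"
    by (simp add: integral_bary[OF p] bary_sum flip: sum_distrib_left)
  also have "\<dots> = (\<Sum>r\<in>V. ?J r)"
    by (intro Bochner_Integration.integral_sum int)
  also have "\<dots> = ?J p + (\<Sum>r\<in>V - {p}. ?J p / 2)"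
  proof -
    have "(\<Sum>r\<in>V - {p}. ?J r) = (\<Sum>r\<in>V - {p}. ?J p / 2)"
      by (intro sum.cong sq) auto
    then show ?thesis
      by (simp only: sum.remove[OF finite_V p])
  qed
  also have "\<dots> = ?J p * (?n + 2) / 2"
    using p finite_V card by (simp add: card_Diff_singleton field_simps)
  finally have eq: "measure lborel K / (?n + 1) = ?J p * (?n + 2) / 2" .
  have nz: "?n + 1 \<noteq> 0" "?n + 2 \<noteq> 0"
    by linarith+
  have "J = 2 * M / ((m + 1) * (m + 2))" if "M / (m + 1) = J * (m + 2) / 2" "m + 1 \<noteq> 0" "m + 2 \<noteq> 0" for M m J :: real
  proof -
    have "2 * M = J * ((m + 1) * (m + 2))"
      using that(1,2) by (simp add: field_simps)
    then show ?thesis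
      using that(2,3) by (simp add: nonzero_eq_divide_eq)
  qed
  from this[OF eq nz] have Jp: "?J p = 2 * measure lborel K / ((?n + 1) * (?n + 2))" .
  then show ?thesis
    using sq[OF q] by (cases "p = q") auto
qed

lemma integral_K_affine:
  "(LINT x|lborel. indicator K x * (g \<bullet> x + b)) = measure lborel K * (g \<bullet> mid K + b)"
proof -
  have "(LINT x|lborel. indicator K x * (g \<bullet> x + b))
    = (LINT x|lborel. (\<Sum>a\<in>V. (indicator K x * bary V a x) * (g \<bullet> a + b)))"
    by (subst affine_bary_expand) (simp add: sum_distrib_left mult.assoc)
  also have "\<dots> = (\<Sum>a\<in>V. measure lborel K / (real CARD('n) + 1) * (g \<bullet> a + b))"
    by (subst Bochner_Integration.integral_sum)
      (auto intro!: integrable_mult_left integrable_K cont_bary simp: integral_bary)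
  also have "\<dots> = measure lborel K / (real CARD('n) + 1) * (\<Sum>a\<in>V. g \<bullet> a + b)"
    by (simp add: sum_distrib_left)
  also have "(\<Sum>a\<in>V. g \<bullet> a + b) = (real CARD('n) + 1) * (g \<bullet> mid K + b)"
    using card by (simp add: sum.distrib mid_K inner_sum_right field_simps add_pos_nonneg)
  finally show ?thesis
    by (simp add: add_pos_nonneg)
qed

text \<open>In barycentric coordinates the second moments are a constant matrix plus a multiple of
  the identity. The constant part pairs the sum of all \<open>a - mid K\<close> with itself and
  vanishes; only the diagonal survives.\<close>

lemma integral_K_quadratic:
  "(LINT x|lborel. indicator K x * ((x - mid K) \<bullet> (B *v (x - mid K))))
    = measure lborel K / ((real CARD('n) + 1) * (real CARD('n) + 2)) * (\<Sum>a\<in>V. (a - mid K) \<bullet> (B *v (a - mid K)))"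
proof -
  let ?d = "\<lambda>a. a - mid K" and ?n = "real CARD('n)"
  let ?c = "measure lborel K / ((?n + 1) * (?n + 2))"
  let ?q = "\<lambda>a b. ?d a \<bullet> (B *v ?d b)"
  have x: "x - mid K = (\<Sum>a\<in>V. bary V a x *\<^sub>R ?d a)" for x
    by (simp add: scaleR_diff_right sum_subtractf bary_expand bary_sum flip: scaleR_sum_left)
  have "(x - mid K) \<bullet> (B *v (x - mid K)) = (\<Sum>a\<in>V. \<Sum>b\<in>V. (bary V a x * bary V b x) * ?q a b)" for x
    unfolding x[of x] by (rule inner_matrix_sum)
  then have "(LINT x|lborel. indicator K x * ((x - mid K) \<bullet> (B *v (x - mid K))))
    = (LINT x|lborel. (\<Sum>a\<in>V. \<Sum>b\<in>V. (indicator K x * (bary V a x * bary V b x)) * ?q a b))"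
    by (simp add: sum_distrib_left mult.assoc)
  also have "\<dots> = (\<Sum>a\<in>V. \<Sum>b\<in>V. (LINT x|lborel. (indicator K x * (bary V a x * bary V b x)) * ?q a b))"
  proof -
    have "integrable lborel (\<lambda>x. (indicator K x * (bary V a x * bary V b x)) * ?q a b)" for a b
      by (intro integrable_mult_left integrable_K continuous_intros cont_bary)
    then show ?thesis
      by (simp only: Bochner_Integration.integral_sum Bochner_Integration.integrable_sum)
  qed
  also have "\<dots> = (\<Sum>a\<in>V. \<Sum>b\<in>V. ?c * ?q a b + (if b = a then ?c * ?q a b else 0))"
  proof (intro sum.cong refl)
    fix a b assume ab: "a \<in> V" "b \<in> V"
    have "(LINT x|lborel. (indicator K x * (bary V a x * bary V b x)) * ?q a b)
      = (LINT x|lborel. indicator K x * (bary V a x * bary V b x)) * ?q a b"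
      by (rule integral_mult_left_zero)
    also have "\<dots> = ?c * ?q a b + (if b = a then ?c * ?q a b else 0)"
      unfolding integral_bary_bary[OF ab] by auto
    finally show "(LINT x|lborel. (indicator K x * (bary V a x * bary V b x)) * ?q a b)
      = ?c * ?q a b + (if b = a then ?c * ?q a b else 0)" .
  qed
  also have "\<dots> = (\<Sum>a\<in>V. \<Sum>b\<in>V. ?c * ?q a b) + (\<Sum>a\<in>V. ?c * ?q a a)"
    using finite_V by (simp add: sum.distrib cong: sum.cong)
  also have "(\<Sum>a\<in>V. \<Sum>b\<in>V. ?c * ?q a b) = ?c * ((\<Sum>a\<in>V. ?d a) \<bullet> (B *v (\<Sum>b\<in>V. ?d b)))"
    using inner_matrix_sum[of "\<lambda>_. 1" ?d V B] by (simp only: scaleR_one mult_1 sum_distrib_left)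
  finally show ?thesis
    by (simp add: sum_V_diff_mid sum_distrib_left)
qed

end

section \<open>Face means as volume integrals\<close>

lemma set_integral_lebesgue_lborel:
  fixes f :: "'a::euclidean_space \<Rightarrow> real"
  assumes "f \<in> borel_measurable borel" "K \<in> sets borel"
  shows "(LINT x:K|lebesgue. f x) = (LINT x|lborel. indicator K x * f x)"
proof -
  have "(\<lambda>x. indicator K x * f x) \<in> borel_measurable lborel"
    using assms by (intro borel_measurable_times borel_measurable_indicator) auto
  then show ?thesis
    by (simp add: set_lebesgue_integral_def integral_completion)
qed

lemma integral_lborel_affine:
  fixes f :: "'a::euclidean_space \<Rightarrow> real"
  assumes f: "f \<in> borel_measurable borel" and c: "c > 0"
  shows "(LINT x|lborel. f x) = c ^ DIM('a) * (LINT x|lborel. f (s + c *\<^sub>R x))"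
proof -
  have "(LINT x|lborel. f x) = (LINT x|density (distr lborel borel (\<lambda>x. s + c *\<^sub>R x)) (\<lambda>_. ennreal (\<bar>c\<bar> ^ DIM('a))). f x)"
    using lborel_affine[of c s] c by (simp add: ennreal_power)
  also have "\<dots> = c ^ DIM('a) * (LINT x|lborel. f (s + c *\<^sub>R x))"
    using f c by (subst integral_density) (auto simp: integral_distr)
  finally show ?thesis .
qed

text \<open>For smooth \<open>v\<close> with gradient \<open>g\<close> and a vertex \<open>a\<close> of \<open>K\<close>, the divergence theorem identifies this with
  the integral of \<open>v\<close> over the face opposite to \<open>a\<close> times the distance of \<open>a\<close> to that face. It
  replaces traces of Sobolev functions.\<close>

definition flux :: "(real^'n) set \<Rightarrow> real^'n \<Rightarrow> (real^'n \<Rightarrow> real) \<Rightarrow> (real^'n \<Rightarrow> real^'n) \<Rightarrow> real" where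
  "flux K a v g = (LINT x:K|lebesgue. (x - a) \<bullet> g x + real CARD('n) * v x)"

lemma C1_withD_measurable:
  assumes "C1_with f f'"
  shows "f \<in> borel_measurable borel" "f' \<in> borel_measurable borel"
  using C1_withD[OF assms] by (auto intro: borel_measurable_continuous_onI)

context nondegenerate_simplex
begin

lemma flux_C1:
  assumes "C1_with \<psi> \<psi>'"
  shows "flux K a \<psi> \<psi>' = (LINT x|lborel. indicator K x * ((x - a) \<bullet> \<psi>' x + real CARD('n) * \<psi> x))"
  unfolding flux_def using C1_withD[OF assms] compact_K
  by (intro set_integral_lebesgue_lborel borel_measurable_continuous_onI continuous_intros borel_compact)

text \<open>Moving from x parallel to an edge from \<open>a\<close> to another vertex b reaches the
  opposite face after the distance \<open>bary V a x * norm (b - a)\<close>, so the Lipschitz bound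
  applies.\<close>

lemma C1_vanishing_on_face_bound:
  assumes a: "a \<in> V" and \<psi>: "C1_with \<psi> \<psi>'" and zero: "\<And>x. x \<in> convex hull (V - {a}) \<Longrightarrow> \<psi> x = 0"
  obtains C where "C \<ge> 0" "\<And>x. x \<in> K \<Longrightarrow> \<bar>\<psi> x\<bar> \<le> C * bary V a x"
proof -
  obtain b where b: "b \<in> V" "b \<noteq> a" by (rule other_vertex)
  obtain B where B: "B \<ge> 0" "\<And>x. x \<in> K \<Longrightarrow> norm (\<psi>' x) \<le> B"
    using continuous_on_compact_bound[OF compact_K continuous_on_subset[OF C1_withD(2)[OF \<psi>] subset_UNIV]] by blast
  have "\<bar>\<psi> x\<bar> \<le> (B * norm (b - a)) * bary V a x" if x: "x \<in> K" for x
  proof -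
    let ?y = "x + bary V a x *\<^sub>R (b - a)"
    have bary_y: "bary V r ?y = bary V r x + bary V a x * ((if b = r then 1 else 0) - (if a = r then 1 else 0))"
      if "r \<in> V" for r
      using bary_grad_vertex[OF that a b(1)] by (simp add: bary_add)
    have "?y \<in> K"
      unfolding K_eq
    proof (intro CollectI ballI)
      fix r assume r: "r \<in> V"
      then show "0 \<le> bary V r ?y"
        using x a b(2) unfolding K_eq bary_y[OF r] by auto
    qed
    moreover have "bary V a ?y = 0"
      using bary_y[OF a] b by simp
    ultimately have y: "?y \<in> K" "\<psi> ?y = 0"
      using zero face_eq[OF a] by auto
    have "\<bar>\<psi> x - \<psi> ?y\<bar> \<le> B * norm (x - ?y)"
      by (rule C1_with_lipschitz[OF \<psi> convex_convex_hull[of V] B(2) x y(1)])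
    moreover have "norm (x - ?y) = bary V a x * norm (b - a)"
      using x a by (simp add: K_eq)
    ultimately show ?thesis
      unfolding y(2) diff_zero by (simp only: mult_ac)
  qed
  then show ?thesis
    using that[of "B * norm (b - a)"] B(1) by simp
qed

text \<open>Differentiate \<open>t \<mapsto> \<integral>\<psi>\<close> over the homothetic copies \<open>a + t (K - a)\<close> at \<open>t = 1\<close>: by scaling the
  derivative is \<open>flux K a \<psi> \<psi>'\<close>, and it vanishes since \<open>\<psi>\<close> is small near the face.\<close>

lemma flux_eq_0:
  assumes a: "a \<in> V" and \<psi>: "C1_with \<psi> \<psi>'" and zero: "\<And>x. x \<in> convex hull (V - {a}) \<Longrightarrow> \<psi> x = 0"
  shows "flux K a \<psi> \<psi>' = 0"
proof -
  define r where "r m = inverse (real (Suc (Suc m)))" for m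
  define t where "t m = 1 - r m" for m
  let ?n = "CARD('n)"
  let ?D = "\<lambda>m x. x + (- r m) *\<^sub>R (x - a)"
  have r: "0 < r m" "r m < 1" for m
    by (auto simp: r_def field_simps)
  have t: "0 < t m" "t m < 1" for m
    using r[of m] by (auto simp: t_def)
  have r0: "r \<longlonglongrightarrow> 0"
    unfolding r_def using LIMSEQ_Suc[OF LIMSEQ_inverse_real_of_nat] by simp
  have t1: "t \<longlonglongrightarrow> 1"
    unfolding t_def using tendsto_diff[OF tendsto_const r0, of 1] by simp
  have mr0: "(\<lambda>m. - r m) \<longlonglongrightarrow> 0"
    using tendsto_minus[OF r0] by simp
  have mr: "- r m \<noteq> 0" for m
    using r[of m] by simp
  obtain C where C: "C \<ge> 0" "\<And>x. x \<in> K \<Longrightarrow> \<bar>\<psi> x\<bar> \<le> C * bary V a x"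
    using C1_vanishing_on_face_bound[OF a \<psi> zero] by blast
  obtain B where B: "B \<ge> 0" "\<And>x. x \<in> K \<Longrightarrow> norm (\<psi>' x) \<le> B"
    using continuous_on_compact_bound[OF compact_K continuous_on_subset[OF C1_withD(2)[OF \<psi>] subset_UNIV]] by blast
  have aK: "a \<in> K"
    using a by (simp add: hull_inc)
  have \<psi>c: "continuous_on UNIV \<psi>"
    using C1_withD[OF \<psi>] by blast
  define J where "J m = (LINT x|lborel. indicator K x * \<psi> (?D m x))" for m
  define J1 where "J1 = (LINT x|lborel. indicator K x * \<psi> x)"
  define P where "P = (LINT x|lborel. indicator K x * (\<psi>' x \<bullet> (x - a)))"
  \<comment> \<open>The homothetic copy of the simplex with centre \<open>a\<close> and ratio
    \<open>t m\<close>: the part cut off near the opposite face is a slab of relative thickness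
    \<open>r m\<close>.\<close>
  let ?K = "\<lambda>m. {x \<in> K. 1 - t m \<le> bary V a x}"
  have cK: "compact (?K m)" for m
  proof -
    have "?K m = K \<inter> {x. 1 - t m \<le> bary V a x}" by blast
    then show ?thesis
      using compact_K by (auto intro!: compact_Int_closed closed_Collect_le cont_bary)
  qed
  have D: "?D m x = (1 - t m) *\<^sub>R a + t m *\<^sub>R x" for m x
    by (simp add: t_def algebra_simps)
  have D_in: "?D m x \<in> ?K m \<longleftrightarrow> x \<in> K" for m x
  proof -
    have eq: "bary V b (?D m x) = t m * bary V b x + (if b = a then 1 - t m else 0)" if "b \<in> V" for b
    proof -
      have "bary V b (?D m x) = bary V b x - r m * (bary V b x - bary V b a)"
        by (simp add: bary_add) (simp add: bary_def inner_diff_right algebra_simps)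
      then show ?thesis
        using bary_vertex[OF that a] by (auto simp: t_def algebra_simps)
    qed
    show ?thesis
    proof
      assume x: "x \<in> K"
      then have "0 \<le> bary V b (?D m x)" if "b \<in> V" for b
        using that t[of m] unfolding eq[OF that] K_eq by (auto intro!: add_nonneg_nonneg)
      moreover have "1 - t m \<le> bary V a (?D m x)"
        using x a t[of m] unfolding eq[OF a] K_eq by auto
      ultimately show "?D m x \<in> ?K m"
        unfolding K_eq by blast
    next
      assume x: "?D m x \<in> ?K m"
      have "0 \<le> bary V b x" if b: "b \<in> V" for b
      proof -
        have "0 \<le> bary V b (?D m x)" "1 - t m \<le> bary V a (?D m x)"
          using x b unfolding K_eq by blast+
        then have "0 \<le> t m * bary V b x"
          unfolding eq[OF b] eq[OF a] by (cases "b = a") simp_all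
        then show ?thesis
          using t(1)[of m] by (simp add: zero_le_mult_iff)
      qed
      then show "x \<in> K"
        unfolding K_eq by blast
    qed
  qed
  have scale: "(LINT x|lborel. indicator (?K m) x * f x) = t m ^ ?n * (LINT x|lborel. indicator K x * f (?D m x))"
    if "f \<in> borel_measurable borel" for f :: "_ \<Rightarrow> real" and m
  proof -
    have meas: "(\<lambda>x. indicator (?K m) x * f x) \<in> borel_measurable borel"
      using that cK by (intro borel_measurable_times borel_measurable_indicator) (auto intro: borel_compact)
    have "indicator (?K m) (?D m x) = (indicator K x :: real)" for x
      using D_in[of x m] by (simp only: indicator_def)
    then show ?thesis
      using integral_lborel_affine[OF meas t(1)[of m], of "(1 - t m) *\<^sub>R a"] by (simp only: D DIM_cart DIM_real mult_1_right)
  qed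
  have J_lim: "(\<lambda>m. (J m - J1) / (- r m)) \<longlonglongrightarrow> P"
  proof -
    have int: "integrable lborel (\<lambda>x. indicator K x * \<psi> (?D m x))" for m
      by (intro integrable_K continuous_on_compose2[OF \<psi>c] continuous_intros) auto
    have int1: "integrable lborel (\<lambda>x. indicator K x * \<psi> x)"
      by (intro integrable_K \<psi>c)
    have "(\<lambda>m. LINT x|lborel. indicator K x * ((\<psi> (?D m x) - \<psi> x) / (- r m))) \<longlonglongrightarrow> P"
      unfolding P_def
    proof (rule integral_dominated_convergence)
      show "integrable lborel (\<lambda>x. indicator K x * (B * diameter K))"
        by (intro integrable_K continuous_intros)
      show "(\<lambda>x. indicator K x * (\<psi>' x \<bullet> (x - a))) \<in> borel_measurable lborel"
        by (intro borel_measurable_integrable integrable_K continuous_intros C1_withD[OF \<psi>])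
      show "(\<lambda>x. indicator K x * ((\<psi> (?D m x) - \<psi> x) / (- r m))) \<in> borel_measurable lborel" for m
        using mr by (intro borel_measurable_integrable integrable_K continuous_intros continuous_on_compose2[OF \<psi>c] \<psi>c) auto
      show "AE x in lborel. (\<lambda>m. indicator K x * ((\<psi> (?D m x) - \<psi> x) / (- r m))) \<longlonglongrightarrow> indicator K x * (\<psi>' x \<bullet> (x - a))"
        by (intro AE_I2 tendsto_mult tendsto_const has_derivative_difference_quotient[OF C1_withD(1)[OF \<psi>] mr0 mr])
      show "AE x in lborel. norm (indicator K x * ((\<psi> (?D m x) - \<psi> x) / (- r m))) \<le> indicator K x * (B * diameter K)" for m
      proof (rule AE_I2)
        fix x :: "real^'n"
        show "norm (indicator K x * ((\<psi> (?D m x) - \<psi> x) / (- r m))) \<le> indicator K x * (B * diameter K)"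
        proof (cases "x \<in> K")
          case True
          have DK: "?D m x \<in> K"
            using D_in[of x m] True by blast
          have "\<bar>\<psi> (?D m x) - \<psi> x\<bar> \<le> B * norm (?D m x - x)"
            by (rule C1_with_lipschitz[OF \<psi> convex_convex_hull[of V] B(2) DK True])
          also have "norm (?D m x - x) = r m * norm (x - a)"
            using r[of m] by simp
          also have "B * (r m * norm (x - a)) \<le> B * (r m * diameter K)"
            using r[of m] B(1) diameter_bounded_bound[OF compact_imp_bounded[OF compact_K] True aK]
            by (intro mult_left_mono) (auto simp: dist_norm)
          finally have "\<bar>\<psi> (?D m x) - \<psi> x\<bar> / r m \<le> B * diameter K"
            using r[of m] by (simp add: pos_divide_le_eq mult_ac)
          then show ?thesis
            using True r[of m] by (simp add: abs_divide)
        qed simp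
      qed
    qed
    moreover have "(LINT x|lborel. indicator K x * ((\<psi> (?D m x) - \<psi> x) / (- r m))) = (J m - J1) / (- r m)" for m
    proof -
      have "(J m - J1) / (- r m) = (LINT x|lborel. (indicator K x * \<psi> (?D m x) - indicator K x * \<psi> x) / (- r m))"
        unfolding J_def J1_def using int[of m] int1 by simp
      also have "\<dots> = (LINT x|lborel. indicator K x * ((\<psi> (?D m x) - \<psi> x) / (- r m)))"
        by (intro Bochner_Integration.integral_cong) (simp_all add: right_diff_distrib diff_divide_distrib)
      finally show ?thesis by (rule sym)
    qed
    ultimately show ?thesis by (simp only:)
  qed
  have pow_lim: "(\<lambda>m. (t m ^ ?n - 1) / (- r m)) \<longlonglongrightarrow> real ?n"
  proof -
    have "((\<lambda>y. y ^ ?n) has_derivative (\<lambda>h. real ?n * h)) (at (1::real))"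
      by (auto intro!: derivative_eq_intros)
    from has_derivative_difference_quotient[OF this mr0 mr, of 1]
    show ?thesis by (simp add: t_def)
  qed
  \<comment> \<open>The numerator is, up to sign, the integral over the slab next to the face, where
    the function is at most \<open>C * r m\<close>. Dividing by \<open>r m\<close> leaves C times
    the volume of the slab, which tends to 0.\<close>
  have F_lim: "(\<lambda>m. (t m ^ ?n * J m - J1) / (- r m)) \<longlonglongrightarrow> 0"
  proof (rule Lim_null_comparison)
    show "(\<lambda>m. C * (measure lborel K * (1 - t m ^ ?n))) \<longlonglongrightarrow> 0"
      using tendsto_mult[OF tendsto_const tendsto_mult[OF tendsto_const tendsto_diff[OF tendsto_const tendsto_power[OF t1]]],
          of C "measure lborel K" 1 ?n] by simp
    show "\<forall>\<^sub>F m in sequentially. norm ((t m ^ ?n * J m - J1) / (- r m)) \<le> C * (measure lborel K * (1 - t m ^ ?n))"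
    proof (rule always_eventually, rule allI)
      fix m
      have i1: "integrable lborel (\<lambda>x. indicator S x * \<psi> x)" if "compact S" for S
        using borel_integrable_compact[OF that continuous_on_subset[OF \<psi>c subset_UNIV]] by simp
      have i2: "integrable lborel (\<lambda>x. indicat_real S x)" if "compact S" for S :: "(real^'n) set"
        using borel_integrable_compact[OF that, of "\<lambda>x. 1::real"] by simp
      have vol: "(LINT x|lborel. indicat_real K x) = measure lborel K"
        "(LINT x|lborel. indicat_real (?K m) x) = t m ^ ?n * measure lborel K"
        using scale[of "\<lambda>x. 1" m] compact_K by (simp_all add: borel_compact)
      have "J1 - t m ^ ?n * J m = (LINT x|lborel. indicator K x * \<psi> x - indicator (?K m) x * \<psi> x)"
        unfolding J_def J1_def using scale[OF borel_measurable_continuous_onI[OF \<psi>c]] i1[OF compact_K] i1[OF cK[of m]]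
        by simp
      also have "norm \<dots> \<le> (LINT x|lborel. C * r m * (indicator K x - indicator (?K m) x))"
      proof (rule Bochner_Integration.integral_norm_bound_integral)
        show "integrable lborel (\<lambda>x. indicator K x * \<psi> x - indicator (?K m) x * \<psi> x)"
          using i1[OF compact_K] i1[OF cK[of m]] by (rule Bochner_Integration.integrable_diff)
        show "integrable lborel (\<lambda>x. C * r m * (indicator K x - indicator (?K m) x))"
          using i2[OF compact_K] i2[OF cK[of m]] by (intro integrable_mult_right Bochner_Integration.integrable_diff)
        fix x :: "real^'n"
        show "norm (indicator K x * \<psi> x - indicator (?K m) x * \<psi> x) \<le> C * r m * (indicator K x - indicator (?K m) x)"
        proof (cases "x \<in> K \<and> x \<notin> ?K m")
          case True
          then have "\<bar>\<psi> x\<bar> \<le> C * bary V a x" "bary V a x \<le> r m"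
            using C(2) by (auto simp: t_def)
          then have "\<bar>\<psi> x\<bar> \<le> C * r m"
            using C(1) by (meson mult_left_mono order_trans)
          then show ?thesis
            using True by simp
        qed (auto simp: indicator_def)
      qed
      also have "\<dots> = C * r m * (measure lborel K * (1 - t m ^ ?n))"
        using i2[OF compact_K] i2[OF cK[of m]] vol by (simp add: right_diff_distrib mult_ac)
      finally have "\<bar>J1 - t m ^ ?n * J m\<bar> \<le> C * r m * (measure lborel K * (1 - t m ^ ?n))"
        by simp
      then have "\<bar>t m ^ ?n * J m - J1\<bar> / r m \<le> C * (measure lborel K * (1 - t m ^ ?n))"
        using r[of m] by (simp add: pos_divide_le_eq abs_minus_commute mult_ac)
      then show "norm ((t m ^ ?n * J m - J1) / (- r m)) \<le> C * (measure lborel K * (1 - t m ^ ?n))"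
        using r[of m] by (simp add: abs_divide)
    qed
  qed
  \<comment> \<open>Discrete product rule: the same quotient splits into the change of the integrand
    and the change of the volume factor, whose limits are the two parts of the flux.\<close>
  have "(\<lambda>m. t m ^ ?n * ((J m - J1) / (- r m)) + J1 * ((t m ^ ?n - 1) / (- r m))) \<longlonglongrightarrow> 1 ^ ?n * P + J1 * real ?n"
    by (intro tendsto_intros J_lim pow_lim t1)
  moreover have "t m ^ ?n * ((J m - J1) / (- r m)) + J1 * ((t m ^ ?n - 1) / (- r m)) = (t m ^ ?n * J m - J1) / (- r m)" for m
    using mr[of m] by (simp add: field_simps)
  ultimately have "(\<lambda>m. (t m ^ ?n * J m - J1) / (- r m)) \<longlonglongrightarrow> 1 ^ ?n * P + J1 * real ?n"
    by (simp only:)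
  then have "1 ^ ?n * P + J1 * real ?n = 0"
    by (rule LIMSEQ_unique[OF _ F_lim])
  moreover have "flux K a \<psi> \<psi>' = P + real ?n * J1"
  proof -
    have "flux K a \<psi> \<psi>' = (LINT x|lborel. indicator K x * (\<psi>' x \<bullet> (x - a)) + real ?n * (indicator K x * \<psi> x))"
      unfolding flux_C1[OF \<psi>] by (intro Bochner_Integration.integral_cong) (auto simp: algebra_simps inner_commute)
    also have "\<dots> = P + (LINT x|lborel. real ?n * (indicator K x * \<psi> x))"
      unfolding P_def by (intro Bochner_Integration.integral_add integrable_mult_right integrable_K continuous_intros
          C1_withD[OF \<psi>] \<psi>c)
    finally show ?thesis
      by (simp add: J1_def)
  qed
  ultimately show ?thesis
    by (simp add: mult.commute)
qed

end

lemma flux_diff_C1: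
  assumes "nondegenerate_simplex V" "C1_with f f'" "C1_with g g'"
  shows "flux (convex hull V) a (\<lambda>x. f x - g x) (\<lambda>x. f' x - g' x)
    = flux (convex hull V) a f f' - flux (convex hull V) a g g'"
proof -
  interpret nondegenerate_simplex V by fact
  let ?F = "\<lambda>f f' x. indicator K x * ((x - a) \<bullet> f' x + real CARD('a) * f x)"
  have int: "integrable lborel (?F f f')" if "C1_with f f'" for f f'
    using C1_withD[OF that] by (intro integrable_K continuous_intros)
  have "flux K a (\<lambda>x. f x - g x) (\<lambda>x. f' x - g' x) = (LINT x|lborel. ?F f f' x - ?F g g' x)"
    unfolding flux_C1[OF C1_with_diff[OF assms(2,3)]]
    by (intro Bochner_Integration.integral_cong) (auto simp: algebra_simps inner_diff_right)
  also have "\<dots> = (LINT x|lborel. ?F f f' x) - (LINT x|lborel. ?F g g' x)"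
    by (intro Bochner_Integration.integral_diff int assms)
  finally show ?thesis
    by (simp only: flux_C1[OF assms(2)] flux_C1[OF assms(3)])
qed

context nondegenerate_simplex
begin

text \<open>Since n + 1 times the value at the centroid is the sum of the vertex values, the
  right-hand side is the volume times the sum of the values at the vertices of the opposite
  face.\<close>

lemma flux_affine:
  "flux K a (\<lambda>x. g \<bullet> x + b) (\<lambda>_. g) = measure lborel K * ((real CARD('n) + 1) * (g \<bullet> mid K + b) - (g \<bullet> a + b))"
proof -
  have "C1_with (\<lambda>x. g \<bullet> x + b) (\<lambda>_. g)"
    by (auto simp: C1_with_def intro!: derivative_eq_intros continuous_intros)
  from flux_C1[OF this, of a] have "flux K a (\<lambda>x. g \<bullet> x + b) (\<lambda>_. g)
    = (LINT x|lborel. indicator K x * (((real CARD('n) + 1) *\<^sub>R g) \<bullet> x + (real CARD('n) * b - g \<bullet> a)))"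
    by (simp add: algebra_simps inner_commute)
  also have "\<dots> = measure lborel K * (((real CARD('n) + 1) *\<^sub>R g) \<bullet> mid K + (real CARD('n) * b - g \<bullet> a))"
    by (rule integral_K_affine)
  finally show ?thesis
    by (simp add: algebra_simps)
qed

text \<open>The affine map between two simplices with a common face that fixes the face turns one flux into the
  other, up to the flux of a function that vanishes on the face.\<close>

lemma flux_match:
  assumes a: "a \<in> V" and V': "V' = insert a' (V - {a})" "a' \<notin> V - {a}" "nondegenerate_simplex V'"
    and \<phi>: "C1_with \<phi> \<phi>'"
  shows "measure lborel K * flux (convex hull V') a' \<phi> \<phi>' = measure lborel (convex hull V') * flux K a \<phi> \<phi>'"
proof -
  interpret S': nondegenerate_simplex V' by fact
  let ?n = "real CARD('n)"
  let ?w = "a' - a"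
  let ?T = "\<lambda>x. x + bary V a x *\<^sub>R ?w"
  have V'': "V' - {a'} = V - {a}"
    using V' by auto
  have T_in: "?T x \<in> S'.K \<longleftrightarrow> x \<in> K" for x
  proof -
    \<comment> \<open>The map keeps barycentric coordinates and only replaces the vertex
      \<open>a\<close> by \<open>a'\<close>; hence it sends one simplex onto the other.\<close>
    define u where "u b = (if b = a' then bary V a x else bary V b x)" for b
    have u: "u b = bary V b x" if "b \<in> V - {a}" for b
      using that V'(2) by (auto simp: u_def)
    have ua: "u a' = bary V a x"
      by (simp add: u_def)
    have "sum u V' = u a' + (\<Sum>b\<in>V - {a}. u b)"
      unfolding V'(1) using finite_V V'(2) by simp
    also have "\<dots> = bary V a x + (\<Sum>b\<in>V - {a}. bary V b x)"
      unfolding ua by (intro arg_cong2[of _ _ _ _ "(+)"] sum.cong refl u)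
    also have "\<dots> = 1"
      using bary_sum[of x] by (simp add: sum.remove[OF finite_V a])
    finally have su: "sum u V' = 1" .
    have "(\<Sum>b\<in>V'. u b *\<^sub>R b) = u a' *\<^sub>R a' + (\<Sum>b\<in>V - {a}. u b *\<^sub>R b)"
      unfolding V'(1) using finite_V V'(2) by simp
    also have "\<dots> = bary V a x *\<^sub>R a' + (\<Sum>b\<in>V - {a}. bary V b x *\<^sub>R b)"
      unfolding ua by (intro arg_cong2[of _ _ _ _ "(+)"] sum.cong refl arg_cong2[of _ _ _ _ scaleR] u)
    also have "\<dots> = ?T x"
      using bary_expand[of x] by (simp add: sum.remove[OF finite_V a] algebra_simps)
    finally have eq: "?T x = (\<Sum>b\<in>V'. u b *\<^sub>R b)" by simp
    have "bary V' b (?T x) = u b" if "b \<in> V'" for b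
      unfolding eq by (rule S'.bary_affine_comb[OF su that])
    then have "?T x \<in> S'.K \<longleftrightarrow> (\<forall>b\<in>V'. u b \<ge> 0)"
      unfolding S'.K_eq by simp
    also have "\<dots> \<longleftrightarrow> x \<in> K"
      unfolding K_eq V'(1) using u ua a by auto
    finally show ?thesis .
  qed
  \<comment> \<open>Otherwise \<open>a'\<close> would lie in the hyperplane of the common face and
    the second simplex would be degenerate. This is also what makes the shear invertible.\<close>
  have "bary V a a' \<noteq> 0"
  proof
    assume 0: "bary V a a' = 0"
    have "(\<Sum>b\<in>V - {a}. bary V b a') = 1" "(\<Sum>b\<in>V - {a}. bary V b a' *\<^sub>R b) = a'"
      using bary_sum[of a'] bary_expand[of a'] 0 by (simp_all add: sum.remove[OF finite_V a])
    then have "a' \<in> affine hull (V' - {a'})"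
      unfolding V'' affine_hull_finite[OF finite_Diff[OF finite_V]] by blast
    then show False
      using S'.indep V'(1) unfolding affine_dependent_def by blast
  qed
  moreover have "1 + bary_grad V a \<bullet> ?w = bary V a a'"
    using bary_vertex[OF a a] by (simp add: bary_def inner_diff_right)
  ultimately have nz: "1 + bary_grad V a \<bullet> ?w \<noteq> 0"
    by simp
  obtain c where c: "c > 0" "\<And>f::_ \<Rightarrow> real. f \<in> borel_measurable borel \<Longrightarrow>
    (LINT x|lborel. f (?T x)) = c * (LINT x|lborel. f x)"
    using integral_shear[OF nz, of "- (bary_grad V a \<bullet> foot V a)"] unfolding bary_def by blast
  have cov: "(LINT x|lborel. indicator K x * f (?T x)) = c * (LINT x|lborel. indicator S'.K x * f x)"
    if "f \<in> borel_measurable borel" for f :: "_ \<Rightarrow> real"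
  proof -
    have "(\<lambda>x. indicator S'.K x * f x) \<in> borel_measurable borel"
      using that S'.compact_K by (intro borel_measurable_times borel_measurable_indicator) (auto intro: borel_compact)
    moreover have "indicator S'.K (?T x) = (indicator K x :: real)" for x
      using T_in[of x] by (simp only: indicator_def)
    ultimately show ?thesis
      using c(2)[of "\<lambda>x. indicator S'.K x * f x"] by (simp only:)
  qed
  have vol: "(LINT x|lborel. indicator K x * 1) = measure lborel K"
    "(LINT x|lborel. indicator S'.K x * 1) = measure lborel S'.K"
    using compact_K S'.compact_K by (simp_all add: borel_compact)
  have cK: "measure lborel K = c * measure lborel S'.K"
    using cov[OF borel_measurable_const[of 1]] unfolding vol .
  let ?\<psi> = "\<lambda>x. \<phi> (?T x)" and ?\<psi>' = "\<lambda>x. \<phi>' (?T x) + (?w \<bullet> \<phi>' (?T x)) *\<^sub>R bary_grad V a"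
  have T_der: "(?T has_derivative (\<lambda>h. h + (bary_grad V a \<bullet> h) *\<^sub>R ?w)) (at x)" for x
    unfolding bary_def by (auto intro!: derivative_eq_intros)
  have Tc: "continuous_on UNIV ?T"
    by (intro continuous_intros cont_bary)
  have \<phi>Tc: "continuous_on UNIV (\<lambda>x. \<phi>' (?T x))"
    by (rule continuous_on_compose2[OF C1_withD(2)[OF \<phi>] Tc]) simp
  have \<psi>: "C1_with ?\<psi> ?\<psi>'"
    unfolding C1_with_def
  proof (intro conjI allI)
    fix x
    have "(?\<psi> has_derivative (\<lambda>h. \<phi>' (?T x) \<bullet> (h + (bary_grad V a \<bullet> h) *\<^sub>R ?w))) (at x)"
      by (rule has_derivative_compose[OF T_der C1_withD(1)[OF \<phi>]])
    then show "(?\<psi> has_derivative (\<lambda>h. ?\<psi>' x \<bullet> h)) (at x)"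
      by (simp add: inner_add_left inner_add_right inner_commute mult.commute)
  qed (intro continuous_intros \<phi>Tc)
  let ?F = "\<lambda>y. (y - a') \<bullet> \<phi>' y + ?n * \<phi> y"
  have Fm: "?F \<in> borel_measurable borel"
    using C1_withD[OF \<phi>] by (intro borel_measurable_continuous_onI continuous_intros)
  have "flux K a ?\<psi> ?\<psi>' = (LINT x|lborel. indicator K x * ?F (?T x))"
    unfolding flux_C1[OF \<psi>]
  proof (intro Bochner_Integration.integral_cong refl)
    fix x
    have "?T x - a' = x - a + (bary_grad V a \<bullet> (x - a)) *\<^sub>R ?w"
      using bary_vertex[OF a a] by (simp add: bary_def inner_diff_right algebra_simps)
    then have "(?T x - a') \<bullet> \<phi>' (?T x) = (x - a) \<bullet> ?\<psi>' x"
      by (simp only: inner_add_left inner_add_right inner_scaleR_left inner_scaleR_right inner_commute mult.commute)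
    then show "indicator K x * ((x - a) \<bullet> ?\<psi>' x + ?n * ?\<psi> x) = indicator K x * ?F (?T x)"
      by (simp only:)
  qed
  also have "\<dots> = c * flux S'.K a' \<phi> \<phi>'"
    unfolding cov[OF Fm] S'.flux_C1[OF \<phi>] ..
  finally have 1: "flux K a ?\<psi> ?\<psi>' = c * flux S'.K a' \<phi> \<phi>'" .
  have "flux K a (\<lambda>x. ?\<psi> x - \<phi> x) (\<lambda>x. ?\<psi>' x - \<phi>' x) = 0"
    by (rule flux_eq_0[OF a C1_with_diff[OF \<psi> \<phi>]]) (simp add: face_eq[OF a])
  then have "flux K a \<phi> \<phi>' = c * flux S'.K a' \<phi> \<phi>'"
    using flux_diff_C1[OF nondegenerate_simplex_axioms \<psi> \<phi>, of a] 1 by linarith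
  then show ?thesis
    by (simp add: cK)
qed

text \<open>By the definition of \<open>face_measure\<close> the integral becomes a volume integral
  over the part of a slab that projects onto the face. Vertex swaps of the face, extended along the
  normal direction, preserve this set, so all barycentric coordinates of the face have the same
  integral. An affine function therefore integrates to a multiple of the sum of its vertex
  values.\<close>

lemma face_integral_affine_eq_0:
  assumes a: "a \<in> V" and zero: "(\<Sum>p\<in>V - {a}. g \<bullet> p + b) = 0"
  shows "face_integral (convex hull (V - {a})) (\<lambda>x. g \<bullet> x + b) = 0"
proof -
  let ?E = "convex hull (V - {a})" and ?H = "affine hull (V - {a})"
  let ?\<nu> = "a - foot V a"
  \<comment> \<open>The orthogonal projection onto the hyperplane of the face, made explicit by the
    height vector.\<close>
  let ?P = "\<lambda>x. x - bary V a x *\<^sub>R ?\<nu>"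
  have g\<nu>: "bary_grad V a \<bullet> ?\<nu> = 1"
    using foot_neq[OF a] by (simp add: bary_grad_def power2_norm_eq_inner)
  have bary_P: "bary V r (?P x) = bary V r x - bary V a x * (bary_grad V r \<bullet> ?\<nu>)" for r x
    by (simp add: bary_def inner_diff_right algebra_simps)
  have aP: "bary V a (?P x) = 0" for x
    by (simp add: bary_P g\<nu>)
  have PH: "?P x \<in> ?H" for x
  proof -
    have "(\<Sum>b\<in>V - {a}. bary V b (?P x)) = 1" "(\<Sum>b\<in>V - {a}. bary V b (?P x) *\<^sub>R b) = ?P x"
      using bary_sum[of "?P x"] bary_expand[of "?P x"] aP[of x] by (simp_all add: sum.remove[OF finite_V a])
    then show ?thesis
      unfolding affine_hull_finite[OF finite_Diff[OF finite_V]] by blast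
  qed
  have cp: "closest_point ?H x = ?P x" for x
  proof (rule closest_point_unique[symmetric])
    show "convex ?H" "closed ?H" "?P x \<in> ?H"
      using PH by (auto simp: affine_imp_convex)
    show "\<forall>z\<in>?H. dist x (?P x) \<le> dist x z"
    proof
      fix z assume z: "z \<in> ?H"
      have "?\<nu> \<bullet> (?P x - z) = 0"
        using foot_orth[OF a PH[of x]] foot_orth[OF a z] by (simp only: inner_diff_right)
      then have "orthogonal (bary V a x *\<^sub>R ?\<nu>) (?P x - z)"
        by (simp add: orthogonal_def)
      from norm_add_Pythagorean[OF this] have "(norm (bary V a x *\<^sub>R ?\<nu>))\<^sup>2 \<le> (norm (x - z))\<^sup>2"
        by simp
      then have "norm (bary V a x *\<^sub>R ?\<nu>) \<le> norm (x - z)"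
        by (rule power2_le_imp_le) simp
      then show "dist x (?P x) \<le> dist x z"
        by (simp add: dist_norm)
    qed
  qed
  have Hne: "?H \<noteq> {}"
    using PH by blast
  have dist: "infdist x ?H = \<bar>bary V a x\<bar> * norm ?\<nu>" for x
    using setdist_closest_point[of ?H x] Hne by (simp add: infdist_eq_setdist cp dist_norm)
  let ?slab = "{x. infdist x ?H \<le> 1/2}"
  let ?S = "{x. \<bar>bary V a x\<bar> * norm ?\<nu> \<le> 1/2} \<inter> ?P -` ?E"
  have Pc: "continuous_on UNIV ?P"
    by (intro continuous_intros cont_bary)
  have Pm: "?P \<in> borel_measurable borel"
    by (rule borel_measurable_continuous_onI[OF Pc])
  have compE: "compact ?E"
    using finite_V by (intro finite_imp_compact_convex_hull) simp
  have slab_borel: "?slab \<in> sets borel"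
    by (intro borel_closed closed_Collect_le continuous_intros)
  have fi: "face_integral ?E f = (LINT x|lborel. indicator ?S x * f (?P x))"
    if f: "f \<in> borel_measurable borel" for f :: "_ \<Rightarrow> real"
  proof -
    have fm: "(\<lambda>x. indicator ?E x *\<^sub>R f x) \<in> borel_measurable borel"
      using f compE by (intro borel_measurable_scaleR borel_measurable_indicator) (auto intro: borel_compact)
    have cpm: "closest_point ?H \<in> borel_measurable (restrict_space lborel ?slab)"
      using Pm by (intro measurable_restrict_space1) (simp add: cp[abs_def])
    have "face_integral ?E f = (LINT x|restrict_space lborel ?slab. indicator ?E (?P x) *\<^sub>R f (?P x))"
      unfolding face_integral_def face_measure_def set_lebesgue_integral_def affine_hull_convex_hull
      using integral_distr[OF cpm fm] by (simp only: cp)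
    also have "\<dots> = (LINT x|lborel. indicator ?slab x *\<^sub>R (indicator ?E (?P x) *\<^sub>R f (?P x)))"
      using slab_borel by (subst integral_restrict_space) simp_all
    also have "\<dots> = (LINT x|lborel. indicator ?S x * f (?P x))"
      by (intro Bochner_Integration.integral_cong) (auto simp: indicator_def dist)
    finally show ?thesis .
  qed
  have closed_S: "closed ?S"
    using compE by (intro closed_Int closed_Collect_le continuous_intros cont_bary closed_vimage Pc compact_imp_closed)
  moreover have "bounded ?S"
  proof -
    obtain R where R: "\<And>y. y \<in> ?E \<Longrightarrow> norm y \<le> R"
      using compact_imp_bounded[OF compE] unfolding bounded_iff by blast
    have "norm x \<le> R + 1/2" if "x \<in> ?S" for x
    proof -
      have "norm x \<le> norm (?P x) + norm (bary V a x *\<^sub>R ?\<nu>)"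
        using norm_triangle_ineq[of "?P x" "bary V a x *\<^sub>R ?\<nu>"] by simp
      then show ?thesis
        using that R[of "?P x"] by auto
    qed
    then show ?thesis
      unfolding bounded_iff by blast
  qed
  ultimately have compS: "compact ?S"
    by (simp only: compact_eq_bounded_closed)
  have eq: "(LINT x|lborel. indicator ?S x * bary V p (?P x)) = (LINT x|lborel. indicator ?S x * bary V q (?P x))"
    if p: "p \<in> V - {a}" and q: "q \<in> V - {a}" and pq: "p \<noteq> q" for p q
  proof -
    \<comment> \<open>The gradient of the difference of the coordinates of p and q after projection.
      With it, \<open>?T\<close> leaves the distance to the hyperplane unchanged and acts after
      projection as \<open>swap p q\<close>.\<close>
    let ?\<gamma> = "bary_grad V p - bary_grad V q - ((bary_grad V p - bary_grad V q) \<bullet> ?\<nu>) *\<^sub>R bary_grad V a"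
    define \<beta> where "\<beta> = bary V p (?P 0) - bary V q (?P 0)"
    have bary_0: "bary V r x = bary V r 0 + bary_grad V r \<bullet> x" for r x
      using bary_add[of V r 0 x] by simp
    have \<beta>: "bary V p (?P x) - bary V q (?P x) = ?\<gamma> \<bullet> x + \<beta>" for x
      unfolding \<beta>_def bary_P
      by (subst (1 2 3 4) bary_0[of _ x]) (simp add: inner_diff_left[of _ _ x] left_diff_distrib right_diff_distrib
        inner_diff_left[of "bary_grad V p" "bary_grad V q" ?\<nu>] algebra_simps)
    let ?T = "\<lambda>x. x + (?\<gamma> \<bullet> x + \<beta>) *\<^sub>R (q - p)"
    have pV: "p \<in> V" "q \<in> V" using p q by auto
    have ga: "bary_grad V a \<bullet> (q - p) = 0"
      using bary_grad_vertex[OF a pV] p q by auto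
    have "?\<gamma> \<bullet> (q - p) = - 2"
      using bary_grad_vertex[OF pV(1,1,2)] bary_grad_vertex[OF pV(2,1,2)] pq ga by (simp add: inner_diff_left)
    note inv = integral_shear_involution[OF this]
    have aT: "bary V a (?T x) = bary V a x" for x
      by (simp only: bary_add inner_scaleR_right ga)
    have PT: "?P (?T x) = swap p q (?P x)" for x
      unfolding aT by (simp only: swap_def \<beta>) simp
    have E: "swap p q y \<in> ?E \<longleftrightarrow> y \<in> ?E" for y
      using p q pq a swap_in_K[OF pV pq, of y] bary_swap[OF pV pq a, of y] unfolding face_eq[OF a] by auto
    have S: "?T x \<in> ?S \<longleftrightarrow> x \<in> ?S" for x
    proof -
      have "?P (?T x) \<in> ?E \<longleftrightarrow> ?P x \<in> ?E"
        unfolding PT by (rule E)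
      then show ?thesis
        unfolding Int_iff vimage_eq mem_Collect_eq aT by (simp only:)
    qed
    have meas: "(\<lambda>x. indicator ?S x * bary V p (?P x)) \<in> borel_measurable borel"
      using measurable_compose[OF Pm bary_measurable] compS
      by (intro borel_measurable_times borel_measurable_indicator) (auto intro: borel_compact)
    have "(LINT x|lborel. indicator ?S x * bary V p (?P x)) = (LINT x|lborel. indicator ?S (?T x) * bary V p (?P (?T x)))"
      by (rule inv[OF meas, symmetric])
    also have "\<dots> = (LINT x|lborel. indicator ?S x * bary V q (?P x))"
    proof (rule Bochner_Integration.integral_cong[OF refl])
      fix x
      have "indicator ?S (?T x) = (indicator ?S x :: real)"
        using S[of x] by (simp only: indicator_def)
      moreover have "bary V p (?P (?T x)) = bary V q (?P x)"
        unfolding PT using bary_swap[OF pV pq pV(1)] by simp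
      ultimately show "indicator ?S (?T x) * bary V p (?P (?T x)) = indicator ?S x * bary V q (?P x)"
        by (simp only:)
    qed
    finally show ?thesis .
  qed
  obtain q where q: "q \<in> V" "q \<noteq> a" by (rule other_vertex)
  define I where "I = (LINT x|lborel. indicator ?S x * bary V q (?P x))"
  have I: "(LINT x|lborel. indicator ?S x * bary V p (?P x)) = I" if "p \<in> V - {a}" for p
    using eq[OF that, of q] q by (cases "p = q") (auto simp: I_def)
  have int: "integrable lborel (\<lambda>x. indicator ?S x * bary V p (?P x))" for p
    using borel_integrable_compact[OF compS, of "\<lambda>x. bary V p (?P x)"]
      continuous_on_subset[OF continuous_on_compose2[OF cont_bary Pc] subset_UNIV] by simp
  have gm: "(\<lambda>x. g \<bullet> x + b) \<in> borel_measurable borel"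
    by (intro borel_measurable_continuous_onI continuous_intros)
  have "face_integral ?E (\<lambda>x. g \<bullet> x + b) = (LINT x|lborel. indicator ?S x * (g \<bullet> ?P x + b))"
    by (rule fi[OF gm])
  also have "\<dots> = (LINT x|lborel. (\<Sum>p\<in>V - {a}. (indicator ?S x * bary V p (?P x)) * (g \<bullet> p + b)))"
  proof (rule Bochner_Integration.integral_cong[OF refl])
    fix x
    have "g \<bullet> ?P x + b = (\<Sum>p\<in>V - {a}. bary V p (?P x) * (g \<bullet> p + b))"
      unfolding affine_bary_expand[of g "?P x" b] sum.remove[OF finite_V a] aP by simp
    then show "indicator ?S x * (g \<bullet> ?P x + b) = (\<Sum>p\<in>V - {a}. (indicator ?S x * bary V p (?P x)) * (g \<bullet> p + b))"
      by (simp only: sum_distrib_left mult.assoc)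
  qed
  also have "\<dots> = (\<Sum>p\<in>V - {a}. (LINT x|lborel. (indicator ?S x * bary V p (?P x)) * (g \<bullet> p + b)))"
    by (intro Bochner_Integration.integral_sum integrable_mult_left int)
  also have "\<dots> = (\<Sum>p\<in>V - {a}. I * (g \<bullet> p + b))"
    by (intro sum.cong refl) (simp only: integral_mult_left_zero I)
  also have "\<dots> = 0"
    by (simp only: sum_distrib_left[symmetric] zero mult_zero_right)
  finally show ?thesis .
qed

text \<open>The variance identity in the quadratic form of \<open>B_bar\<close>: the sum of squared
  edge lengths is the number of vertices times the sum of squared distances to the centroid. The
  mixed terms vanish because the vectors \<open>a - mid K\<close> sum to 0.\<close>

lemma H_const_eq: "H_const A K = (real CARD('n) + 1) * (\<Sum>a\<in>V. (a - mid K) \<bullet> (B_bar A K *v (a - mid K)))"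
proof -
  let ?B = "B_bar A K" and ?d = "\<lambda>a. a - mid K" and ?n = "real CARD('n)"
  let ?q = "\<lambda>x y. x \<bullet> (?B *v y)"
  have q: "?q x y = (\<Sum>i\<in>UNIV. \<Sum>j\<in>UNIV. ?B $ i $ j * (x $ i * y $ j))" for x y
    by (simp add: inner_vec_def matrix_vector_mult_def sum_distrib_left mult_ac)
  have "H_const A K = (\<Sum>i\<in>UNIV. \<Sum>j\<in>UNIV. ?B $ i $ j * edge_sum K i j)"
  proof -
    have "(\<Sum>j\<in>UNIV. ?B $ i $ j * edge_sum K i j) = ?B $ i $ i * edge_sum K i i + (\<Sum>j\<in>UNIV - {i}. ?B $ i $ j * edge_sum K i j)" for i
      by (rule sum.remove) auto
    then show ?thesis
      unfolding H_const_def by (simp add: sum.distrib)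
  qed
  also have "\<dots> = (\<Sum>i\<in>UNIV. \<Sum>j\<in>UNIV. \<Sum>a\<in>V. \<Sum>a'\<in>V. ?B $ i $ j * ((a $ i - a' $ i) * (a $ j - a' $ j)) / 2)"
    by (simp add: edge_sum_def vertices_K sum_distrib_left sum_divide_distrib)
  also have "\<dots> = (\<Sum>a\<in>V. \<Sum>a'\<in>V. \<Sum>i\<in>UNIV. \<Sum>j\<in>UNIV. ?B $ i $ j * ((a $ i - a' $ i) * (a $ j - a' $ j)) / 2)"
  proof -
    have "(\<Sum>i\<in>UNIV. \<Sum>j\<in>UNIV. \<Sum>a\<in>V. \<Sum>a'\<in>V. f i j a a') = (\<Sum>a\<in>V. \<Sum>a'\<in>V. \<Sum>i\<in>UNIV. \<Sum>j\<in>UNIV. f i j a a')"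
      for f :: "'n \<Rightarrow> 'n \<Rightarrow> real^'n \<Rightarrow> real^'n \<Rightarrow> real"
    proof -
      have "(\<Sum>i\<in>UNIV. \<Sum>j\<in>UNIV. \<Sum>a\<in>V. \<Sum>a'\<in>V. f i j a a') = (\<Sum>i\<in>UNIV. \<Sum>a\<in>V. \<Sum>j\<in>UNIV. \<Sum>a'\<in>V. f i j a a')"
        by (intro sum.cong refl sum.swap)
      also have "\<dots> = (\<Sum>a\<in>V. \<Sum>i\<in>UNIV. \<Sum>a'\<in>V. \<Sum>j\<in>UNIV. f i j a a')"
        by (subst sum.swap) (intro sum.cong refl sum.swap)
      also have "\<dots> = (\<Sum>a\<in>V. \<Sum>a'\<in>V. \<Sum>i\<in>UNIV. \<Sum>j\<in>UNIV. f i j a a')"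
        by (intro sum.cong refl sum.swap)
      finally show ?thesis .
    qed
    then show ?thesis .
  qed
  also have "\<dots> = (\<Sum>a\<in>V. \<Sum>a'\<in>V. ?q (?d a - ?d a') (?d a - ?d a') / 2)"
    by (simp add: q sum_divide_distrib)
  also have "\<dots> = (\<Sum>a\<in>V. \<Sum>a'\<in>V. ?q (?d a) (?d a) / 2 + ?q (?d a') (?d a') / 2 - ?q (?d a) (?d a') / 2 - ?q (?d a') (?d a) / 2)"
    by (intro sum.cong refl) (simp add: matrix_vector_mult_diff_distrib inner_diff_left inner_diff_right field_simps)
  also have "\<dots> = (?n + 1) * (\<Sum>a\<in>V. ?q (?d a) (?d a))
      - (\<Sum>a\<in>V. \<Sum>a'\<in>V. ?q (?d a) (?d a') / 2) - (\<Sum>a\<in>V. \<Sum>a'\<in>V. ?q (?d a') (?d a) / 2)"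
    using card by (simp add: sum.distrib sum_subtractf flip: sum_distrib_left sum_divide_distrib)
  also have z: "(\<Sum>a\<in>V. \<Sum>a'\<in>V. ?q (?d a) (?d a') / 2) = 0"
    using inner_matrix_sum[of "\<lambda>_. 1" ?d V ?B] sum_V_diff_mid by (simp del: sum_subtractf flip: sum_divide_distrib)
  also have "(\<Sum>a\<in>V. \<Sum>a'\<in>V. ?q (?d a') (?d a) / 2) = 0"
    by (subst sum.swap) (rule z)
  finally show ?thesis by simp
qed

section \<open>The bubble function and its normalization\<close>

definition bubble_coeff :: "(real^'n \<Rightarrow> real^'n^'n) \<Rightarrow> real" where
  "bubble_coeff A = real CARD('n) * (real CARD('n) + 1)\<^sup>2 * (real CARD('n) + 2) / (2 * H_const A K)"

definition bubble_grad :: "(real^'n \<Rightarrow> real^'n^'n) \<Rightarrow> real^'n \<Rightarrow> real^'n" where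
  "bubble_grad A x = (- (2 * bubble_coeff A)) *\<^sub>R (B_bar A K *v (x - mid K))"

lemma gcr_bubble_eq: "gcr_bubble A K x
    = (real CARD('n) + 2) / 2 - bubble_coeff A * ((x - mid K) \<bullet> (B_bar A K *v (x - mid K)))"
  by (simp add: gcr_bubble_def bubble_coeff_def Let_def)

lemma C1_bubble:
  assumes sym: "transpose (B_bar A K) = B_bar A K"
  shows "C1_with (gcr_bubble A K) (bubble_grad A)"
  unfolding C1_with_def
proof (intro conjI allI)
  fix x
  let ?B = "B_bar A K"
  have comm: "y \<bullet> (?B *v z) = (?B *v y) \<bullet> z" for y z
    using dot_lmul_matrix[of y ?B z] transpose_matrix_vector[of ?B y] sym by simp
  have bl: "((\<lambda>x. ?B *v (x - mid K)) has_derivative (\<lambda>h. ?B *v h)) (at x)"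
  proof -
    have "((\<lambda>x. x - mid K) has_derivative (\<lambda>h. h)) (at x)"
      by (auto intro!: derivative_eq_intros)
    from bounded_linear.has_derivative[OF matrix_vector_mul_bounded_linear this] show ?thesis .
  qed
  have "((\<lambda>x. (x - mid K) \<bullet> (?B *v (x - mid K))) has_derivative
      (\<lambda>h. (x - mid K) \<bullet> (?B *v h) + h \<bullet> (?B *v (x - mid K)))) (at x)"
    by (rule has_derivative_inner[OF _ bl]) (auto intro!: derivative_eq_intros)
  then have "(gcr_bubble A K has_derivative
      (\<lambda>h. 0 - bubble_coeff A * ((x - mid K) \<bullet> (?B *v h) + h \<bullet> (?B *v (x - mid K))))) (at x)"
    unfolding gcr_bubble_eq[abs_def] by (intro has_derivative_diff has_derivative_const has_derivative_mult_right)
  moreover have "0 - bubble_coeff A * ((x - mid K) \<bullet> (?B *v h) + h \<bullet> (?B *v (x - mid K))) = bubble_grad A x \<bullet> h" for h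
    unfolding bubble_grad_def comm[of "x - mid K" h] inner_commute[of h] by simp
  ultimately show "(gcr_bubble A K has_derivative (\<lambda>h. bubble_grad A x \<bullet> h)) (at x)"
    by (simp only:)
next
  show "continuous_on UNIV (bubble_grad A)"
    unfolding bubble_grad_def[abs_def]
    by (intro continuous_intros linear_continuous_on[OF matrix_vector_mul_bounded_linear, THEN continuous_on_compose2]) auto
qed

definition vertex_energy :: "(real^'n \<Rightarrow> real^'n^'n) \<Rightarrow> real" where
  "vertex_energy A = (\<Sum>a\<in>V. (a - mid K) \<bullet> (B_bar A K *v (a - mid K)))"

text \<open>This explains the constants of the bubble. The quotient is the mean of the quadratic
  form over the simplex, and the coefficient scales it to n/2: the bubble then has element mean (n +
  2)/2 - n/2 = 1, and its fluxes cancel.\<close>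

lemma bubble_coeff_eq:
  assumes "vertex_energy A \<noteq> 0"
  shows "bubble_coeff A * (vertex_energy A / ((real CARD('n) + 1) * (real CARD('n) + 2))) = real CARD('n) / 2"
proof -
  have eq: "n * (n + 1)\<^sup>2 * (n + 2) / (2 * ((n + 1) * S)) * (S / ((n + 1) * (n + 2))) = n / 2"
    if "S \<noteq> 0" "n + 1 \<noteq> 0" "n + 2 \<noteq> 0" for n S :: real
    using that by (simp add: divide_simps power2_eq_square)
  show ?thesis
    unfolding bubble_coeff_def H_const_eq vertex_energy_def[symmetric]
    by (rule eq[OF assms]) linarith+
qed

lemma continuous_quadratic: "continuous_on UNIV (\<lambda>x. (x - mid K) \<bullet> (M *v (x - mid K)))"
  by (intro continuous_intros linear_continuous_on[OF matrix_vector_mul_bounded_linear, THEN continuous_on_compose2]) auto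

lemma integral_bubble:
  assumes "vertex_energy A \<noteq> 0"
  shows "(LINT x|lborel. indicator K x * gcr_bubble A K x) = measure lborel K"
proof -
  let ?n = "real CARD('n)" and ?Q = "\<lambda>x. (x - mid K) \<bullet> (B_bar A K *v (x - mid K))"
  have "(LINT x|lborel. indicator K x * gcr_bubble A K x)
    = (LINT x|lborel. indicator K x * (0 \<bullet> x + (?n + 2) / 2) - bubble_coeff A * (indicator K x * ?Q x))"
    by (intro Bochner_Integration.integral_cong refl) (simp add: gcr_bubble_eq algebra_simps)
  also have "\<dots> = (LINT x|lborel. indicator K x * (0 \<bullet> x + (?n + 2) / 2)) - (LINT x|lborel. bubble_coeff A * (indicator K x * ?Q x))"
    by (intro Bochner_Integration.integral_diff integrable_mult_right integrable_K continuous_quadratic continuous_intros)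
  also have "\<dots> = measure lborel K * ((?n + 2) / 2) - bubble_coeff A * (measure lborel K / ((?n + 1) * (?n + 2)) * vertex_energy A)"
    by (simp only: integral_K_affine integral_mult_right_zero integral_K_quadratic vertex_energy_def) simp
  also have "\<dots> = measure lborel K * ((?n + 2) / 2 - bubble_coeff A * (vertex_energy A / ((?n + 1) * (?n + 2))))"
    by (simp add: algebra_simps)
  also have "\<dots> = measure lborel K"
    unfolding bubble_coeff_eq[OF assms] by (simp add: field_simps)
  finally show ?thesis .
qed

text \<open>Vanishing flux means vanishing face mean, so adding a bubble changes an element mean
  without disturbing the face conditions.\<close>

lemma flux_bubble:
  assumes sym: "transpose (B_bar A K) = B_bar A K" and "vertex_energy A \<noteq> 0"
  shows "flux K a (gcr_bubble A K) (bubble_grad A) = 0"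
proof -
  let ?n = "real CARD('n)" and ?Q = "\<lambda>x. (x - mid K) \<bullet> (B_bar A K *v (x - mid K))"
  let ?c = "2 * bubble_coeff A" and ?g = "(mid K - a) v* B_bar A K"
  let ?\<phi> = "gcr_bubble A K"
  \<comment> \<open>Splitting x - a at the centroid yields the quadratic form once more, plus an
    affine function that is 0 at the centroid and integrates to 0. What remains is n times the
    volume minus twice n/2 times the volume.\<close>
  have pt: "(x - a) \<bullet> bubble_grad A x + ?n * ?\<phi> x = ?n * ?\<phi> x - ?c * ?Q x - ?c * (?g \<bullet> x + - (?g \<bullet> mid K))" for x
  proof -
    have "(x - a) \<bullet> (B_bar A K *v (x - mid K)) = ?Q x + (mid K - a) \<bullet> (B_bar A K *v (x - mid K))"
      by (simp add: inner_diff_left)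
    also have "(mid K - a) \<bullet> (B_bar A K *v (x - mid K)) = ?g \<bullet> x + - (?g \<bullet> mid K)"
      by (simp add: dot_lmul_matrix matrix_vector_mult_diff_distrib inner_diff_right)
    finally have eq: "(x - a) \<bullet> (B_bar A K *v (x - mid K)) = ?Q x + (?g \<bullet> x + - (?g \<bullet> mid K))" .
    show ?thesis
      unfolding bubble_grad_def inner_scaleR_right eq by (simp add: algebra_simps)
  qed
  have \<phi>c: "continuous_on UNIV ?\<phi>"
    using C1_withD(3)[OF C1_bubble[OF sym]] .
  have "flux K a ?\<phi> (bubble_grad A) = (LINT x|lborel. ?n * (indicator K x * ?\<phi> x) - ?c * (indicator K x * ?Q x)
      - ?c * (indicator K x * (?g \<bullet> x + - (?g \<bullet> mid K))))"
    unfolding flux_C1[OF C1_bubble[OF sym]] pt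
    by (intro Bochner_Integration.integral_cong refl) (simp add: algebra_simps)
  also have "\<dots> = (LINT x|lborel. ?n * (indicator K x * ?\<phi> x)) - (LINT x|lborel. ?c * (indicator K x * ?Q x))
      - (LINT x|lborel. ?c * (indicator K x * (?g \<bullet> x + - (?g \<bullet> mid K))))"
    by (subst Bochner_Integration.integral_diff; (subst Bochner_Integration.integral_diff)?;
      intro Bochner_Integration.integrable_diff integrable_mult_right integrable_K continuous_quadratic continuous_intros \<phi>c refl)
  also have "\<dots> = ?n * measure lborel K - ?c * (measure lborel K / ((?n + 1) * (?n + 2)) * vertex_energy A)"
    by (simp only: integral_mult_right_zero integral_bubble[OF assms(2)] integral_K_affine integral_K_quadratic
      vertex_energy_def) simp
  also have "\<dots> = measure lborel K * (?n - 2 * (bubble_coeff A * (vertex_energy A / ((?n + 1) * (?n + 2)))))"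
    by (simp add: algebra_simps)
  also have "\<dots> = 0"
    unfolding bubble_coeff_eq[OF assms(2)] by simp
  finally show ?thesis .
qed

end

section \<open>Poincare inequality\<close>

text \<open>The integral of the squared deviation from the mean \<open>m\<close> is
  nonnegative.\<close>

lemma square_integral_le:
  fixes f :: "real \<Rightarrow> real"
  assumes f: "continuous_on {a..b} f" and ab: "a < b"
  shows "(integral {a..b} f)\<^sup>2 \<le> (b - a) * integral {a..b} (\<lambda>t. (f t)\<^sup>2)"
proof -
  define m where "m = integral {a..b} f / (b - a)"
  have i: "f integrable_on {a..b}" "(\<lambda>t. (f t)\<^sup>2) integrable_on {a..b}"
    using f by (auto intro!: integrable_continuous_real continuous_intros)
  have "((\<lambda>t. (f t)\<^sup>2 - 2 * m * f t + m\<^sup>2) has_integral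
      (integral {a..b} (\<lambda>t. (f t)\<^sup>2) - 2 * m * integral {a..b} f + m\<^sup>2 * (b - a))) {a..b}"
    using i ab by (intro has_integral_add has_integral_diff has_integral_mult_right integrable_integral)
      (use has_integral_const_real[of "m\<^sup>2" a b] in \<open>simp_all add: mult.commute\<close>)
  then have "0 \<le> integral {a..b} (\<lambda>t. (f t)\<^sup>2) - 2 * m * integral {a..b} f + m\<^sup>2 * (b - a)"
  proof (rule has_integral_nonneg)
    fix t
    have "(f t)\<^sup>2 - 2 * m * f t + m\<^sup>2 = (f t - m)\<^sup>2"
      by (simp add: power2_diff)
    then show "0 \<le> (f t)\<^sup>2 - 2 * m * f t + m\<^sup>2" by simp
  qed
  also have "\<dots> = integral {a..b} (\<lambda>t. (f t)\<^sup>2) - (integral {a..b} f)\<^sup>2 / (b - a)"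
  proof -
    have "J - 2 * (I / d) * I + (I / d)\<^sup>2 * d = J - I\<^sup>2 / d" if "d > 0" for I J d :: real
      using that by (simp add: power2_eq_square field_simps)
    from this[of "b - a"] show ?thesis
      using ab by (simp add: m_def)
  qed
  finally show ?thesis
    using ab by (simp add: pos_divide_le_eq mult.commute)
qed

text \<open>The fundamental theorem of calculus from the midpoint to x, followed by Cauchy-Schwarz;
  the parameter interval of length 1/2 gives the factor 1/2. By convexity the indicator of K may be
  inserted, so that a later substitution in x only meets gradient values inside K.\<close>

lemma C1_segment_bound:
  fixes v :: "real^'n \<Rightarrow> real"
  assumes v: "C1_with v v'" and K: "convex K" "x \<in> K" "y \<in> K" and D: "norm (x - y) \<le> D"
  shows "ennreal ((v x - v ((1/2) *\<^sub>R (x + y)))\<^sup>2) \<le> ennreal (D\<^sup>2 / 2) *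
    (\<integral>\<^sup>+t. indicator {1/2..1} t * ennreal (indicator K (y + t *\<^sub>R (x - y)) * (norm (v' (y + t *\<^sub>R (x - y))))\<^sup>2) \<partial>lborel)"
proof -
  let ?p = "\<lambda>t. y + t *\<^sub>R (x - y)"
  let ?f = "\<lambda>t. v' (?p t) \<bullet> (x - y)"
  have v'c: "continuous_on UNIV v'"
    using C1_withD[OF v] by blast
  have pc: "continuous_on S (\<lambda>t. v' (?p t))" for S
    by (rule continuous_on_compose2[OF v'c]) (auto intro!: continuous_intros)
  have der: "((\<lambda>t. v (?p t)) has_vector_derivative ?f t) (at t within {1/2..1})" for t
  proof -
    have "(?p has_derivative (\<lambda>h. h *\<^sub>R (x - y))) (at t within {1/2..1})"
      by (auto intro!: derivative_eq_intros)
    from has_derivative_compose[OF this C1_withD(1)[OF v]] show ?thesis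
      by (simp add: has_vector_derivative_def)
  qed
  have "(?f has_integral (v (?p 1) - v (?p (1/2)))) {1/2..1}"
    by (rule fundamental_theorem_of_calculus) (use der in auto)
  moreover have "?p 1 = x" "?p (1/2) = (1/2) *\<^sub>R (x + y)"
    by (auto simp: algebra_simps) (simp add: vec_eq_iff)
  ultimately have "integral {1/2..1} ?f = v x - v ((1/2) *\<^sub>R (x + y))"
    by (simp add: integral_unique)
  then have "(v x - v ((1/2) *\<^sub>R (x + y)))\<^sup>2 \<le> (1/2) * integral {1/2..1} (\<lambda>t. (?f t)\<^sup>2)"
    using square_integral_le[of "1/2" 1 ?f] continuous_on_inner[OF pc continuous_on_const, of _ "x - y"] by simp
  also have "integral {1/2..1} (\<lambda>t. (?f t)\<^sup>2) \<le> integral {1/2..1} (\<lambda>t. D\<^sup>2 * (norm (v' (?p t)))\<^sup>2)"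
  proof (rule integral_le)
    fix t
    have "(?f t)\<^sup>2 \<le> (norm (v' (?p t)) * norm (x - y))\<^sup>2"
      using Cauchy_Schwarz_ineq2[of "v' (?p t)" "x - y"] abs_le_square_iff by fastforce
    also have "\<dots> \<le> (norm (v' (?p t)) * D)\<^sup>2"
      using D by (intro power_mono mult_left_mono) auto
    finally show "(?f t)\<^sup>2 \<le> D\<^sup>2 * (norm (v' (?p t)))\<^sup>2"
      by (simp add: power_mult_distrib mult.commute)
  qed (use pc in \<open>auto intro!: integrable_continuous_real continuous_intros\<close>)
  also have "integral {1/2..1} (\<lambda>t. D\<^sup>2 * (norm (v' (?p t)))\<^sup>2) = D\<^sup>2 * integral {1/2..1} (\<lambda>t. (norm (v' (?p t)))\<^sup>2)"
    by simp
  finally have real: "(v x - v ((1/2) *\<^sub>R (x + y)))\<^sup>2 \<le> D\<^sup>2 / 2 * integral {1/2..1} (\<lambda>t. (norm (v' (?p t)))\<^sup>2)"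
    by simp
  have "(\<integral>\<^sup>+t. indicator {1/2..1} t * ennreal (indicator K (?p t) * (norm (v' (?p t)))\<^sup>2) \<partial>lborel)
    = (\<integral>\<^sup>+t. ennreal (indicator {1/2..1} t * (norm (v' (?p t)))\<^sup>2) \<partial>lborel)"
  proof (rule nn_integral_cong)
    fix t :: real
    show "indicator {1/2..1} t * ennreal (indicator K (?p t) * (norm (v' (?p t)))\<^sup>2)
      = ennreal (indicator {1/2..1} t * (norm (v' (?p t)))\<^sup>2)"
    proof (cases "t \<in> {1/2..1}")
      case True
      then have "(1 - t) *\<^sub>R y + t *\<^sub>R x \<in> K"
        using K by (intro convexD) auto
      moreover have "(1 - t) *\<^sub>R y + t *\<^sub>R x = ?p t"
        by (simp add: algebra_simps)
      ultimately show ?thesis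
        using True by simp
    qed simp
  qed
  also have "\<dots> = ennreal (integral {1/2..1} (\<lambda>t. (norm (v' (?p t)))\<^sup>2))"
  proof (rule nn_integral_has_integral_lborel)
    have hi: "((\<lambda>t. (norm (v' (?p t)))\<^sup>2) has_integral integral {1/2..1} (\<lambda>t. (norm (v' (?p t)))\<^sup>2)) {1/2..1}"
      using pc by (intro integrable_integral integrable_continuous_real continuous_intros)
    then show "((\<lambda>t. indicator {1/2..1::real} t * (norm (v' (?p t)))\<^sup>2) has_integral integral {1/2..1} (\<lambda>t. (norm (v' (?p t)))\<^sup>2)) UNIV"
    proof -
      have "(\<lambda>t. indicator {1/2..1} t * (norm (v' (?p t)))\<^sup>2) = (\<lambda>t. if t \<in> {1/2..1} then (norm (v' (?p t)))\<^sup>2 else 0)"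
        by (auto simp: fun_eq_iff indicator_def)
      then show ?thesis
        using hi by (simp only: has_integral_restrict_UNIV)
    qed
    show "(\<lambda>t. indicator {1/2..1} t * (norm (v' (?p t)))\<^sup>2) \<in> borel_measurable borel"
      using pc by (intro borel_measurable_times borel_measurable_indicator borel_measurable_continuous_onI continuous_intros) auto
  qed simp
  finally have eq: "(\<integral>\<^sup>+t. indicator {1/2..1} t * ennreal (indicator K (?p t) * (norm (v' (?p t)))\<^sup>2) \<partial>lborel)
    = ennreal (integral {1/2..1} (\<lambda>t. (norm (v' (?p t)))\<^sup>2))" .
  have "0 \<le> integral {1/2..1} (\<lambda>t. (norm (v' (?p t)))\<^sup>2)"
    using pc by (intro integral_nonneg integrable_continuous_real continuous_intros) auto
  then have "ennreal (D\<^sup>2 / 2 * integral {1/2..1} (\<lambda>t. (norm (v' (?p t)))\<^sup>2))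
    = ennreal (D\<^sup>2 / 2) * ennreal (integral {1/2..1} (\<lambda>t. (norm (v' (?p t)))\<^sup>2))"
    by (intro ennreal_mult) auto
  with ennreal_leI[OF real] show ?thesis
    by (simp only: eq)
qed

text \<open>Both \<open>v x\<close> and \<open>v y\<close> are compared with the value at the midpoint. This keeps the Jacobian of the
  homothety \<open>x \<mapsto> y + t (x - y)\<close>, \<open>1/2 \<le> t \<le> 1\<close>, bounded from below.\<close>

lemma poincare_C1:
  fixes v :: "real^'n \<Rightarrow> real"
  assumes v: "C1_with v v'" and K: "convex K" "compact K" and D: "\<And>x y. x \<in> K \<Longrightarrow> y \<in> K \<Longrightarrow> norm (x - y) \<le> D"
    and mean: "(LINT x|lborel. indicator K x * v x) = 0" and pos: "measure lborel K > 0"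
  shows "(LINT x|lborel. indicator K x * (v x)\<^sup>2) \<le> 2 ^ CARD('n) * D\<^sup>2 * (LINT x|lborel. indicator K x * (norm (v' x))\<^sup>2)"
proof -
  note [measurable] = C1_withD_measurable[OF v]
  have [measurable]: "K \<in> sets borel"
    using K(2) by (rule borel_compact)
  have intK: "integrable lborel (\<lambda>x. indicator K x * f x)" if "continuous_on UNIV f" for f :: "real^'n \<Rightarrow> real"
    using borel_integrable_compact[OF K(2) continuous_on_subset[OF that subset_UNIV]] by simp
  let ?G = "LINT x|lborel. indicator K x * (norm (v' x))\<^sup>2"
  let ?I = "LINT x|lborel. indicator K x * (v x)\<^sup>2"
  let ?F = "\<lambda>x. ennreal (indicator K x * (norm (v' x))\<^sup>2)"
  let ?W = "\<lambda>x y. indicator K x * (indicator K y * ennreal ((v x - v ((1/2) *\<^sub>R (x + y)))\<^sup>2))"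
  have cont: "continuous_on UNIV v" "continuous_on UNIV v'"
    using C1_withD[OF v] by auto
  have G: "(\<integral>\<^sup>+x. ?F x \<partial>lborel) = ennreal ?G"
    by (intro nn_integral_eq_integral intK continuous_intros cont) auto
  have I0: "?I \<ge> 0" and G0: "?G \<ge> 0"
    by (auto intro!: Bochner_Integration.integral_nonneg)
  \<comment> \<open>For fixed y and t the substitution has Jacobian t^n, at least 2^(-n) as t is at
    least 1/2. This is the origin of the factor 2^n in the result.\<close>
  have scale: "(\<integral>\<^sup>+x. ?F (y + t *\<^sub>R (x - y)) \<partial>lborel) \<le> ennreal (2 ^ CARD('n) * ?G)" if t: "t \<in> {1/2..1}" for t :: real and y
  proof -
    have F: "?F (y + t *\<^sub>R (x - y)) = ?F ((1 - t) *\<^sub>R y + t *\<^sub>R x)" for x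
      by (simp add: algebra_simps)
    have "ennreal ?G = (\<integral>\<^sup>+x. ?F x \<partial>density (distr lborel borel (\<lambda>x. (1 - t) *\<^sub>R y + t *\<^sub>R x)) (\<lambda>_. ennreal (\<bar>t\<bar> ^ CARD('n))))"
      using lborel_affine[of t "(1 - t) *\<^sub>R y"] t by (simp add: G ennreal_power)
    also have "\<dots> = ennreal (t ^ CARD('n)) * (\<integral>\<^sup>+x. ?F (y + t *\<^sub>R (x - y)) \<partial>lborel)"
      unfolding F using t by (simp add: nn_integral_density nn_integral_distr nn_integral_cmult)
    finally have eq: "ennreal ?G = ennreal (t ^ CARD('n)) * (\<integral>\<^sup>+x. ?F (y + t *\<^sub>R (x - y)) \<partial>lborel)" .
    have "(1::real) \<le> (2 * t) ^ CARD('n)"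
      using t by (intro one_le_power) auto
    then have "1 * (\<integral>\<^sup>+x. ?F (y + t *\<^sub>R (x - y)) \<partial>lborel)
      \<le> ennreal ((2 * t) ^ CARD('n)) * (\<integral>\<^sup>+x. ?F (y + t *\<^sub>R (x - y)) \<partial>lborel)"
      by (intro mult_right_mono) (simp_all flip: ennreal_1)
    also have "\<dots> = ennreal (2 ^ CARD('n)) * ennreal ?G"
      unfolding eq power_mult_distrib using t by (simp add: ennreal_mult mult.assoc)
    finally show ?thesis
      using G0 by (simp add: ennreal_mult)
  qed
  have W: "(\<integral>\<^sup>+y. (\<integral>\<^sup>+x. ?W x y \<partial>lborel) \<partial>lborel) \<le> ennreal (D\<^sup>2 / 2 * (2 ^ CARD('n) * ?G / 2) * measure lborel K)"
  proof -
    have inner: "(\<integral>\<^sup>+x. ?W x y \<partial>lborel) \<le> indicator K y * ennreal (D\<^sup>2 / 2 * (2 ^ CARD('n) * ?G / 2))" for y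
    proof (cases "y \<in> K")
      case True
      have "(\<integral>\<^sup>+x. ?W x y \<partial>lborel) \<le> (\<integral>\<^sup>+x. ennreal (D\<^sup>2 / 2) *
          (\<integral>\<^sup>+t. indicator {1/2..1} t * ?F (y + t *\<^sub>R (x - y)) \<partial>lborel) \<partial>lborel)"
      proof (rule nn_integral_mono)
        fix x :: "real^'n"
        show "?W x y \<le> ennreal (D\<^sup>2 / 2) * (\<integral>\<^sup>+t. indicator {1/2..1} t * ?F (y + t *\<^sub>R (x - y)) \<partial>lborel)"
        proof (cases "x \<in> K")
          case x: True
          show ?thesis
            using C1_segment_bound[OF v K(1) x True D[OF x True]] x True by simp
        qed simp
      qed
      also have "\<dots> = ennreal (D\<^sup>2 / 2) * (\<integral>\<^sup>+x. (\<integral>\<^sup>+t. indicator {1/2..1} t * ?F (y + t *\<^sub>R (x - y)) \<partial>lborel) \<partial>lborel)"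
        by (rule nn_integral_cmult) measurable
      also have "(\<integral>\<^sup>+x. (\<integral>\<^sup>+t. indicator {1/2..1} t * ?F (y + t *\<^sub>R (x - y)) \<partial>lborel) \<partial>lborel)
        = (\<integral>\<^sup>+t. (\<integral>\<^sup>+x. indicator {1/2..1} t * ?F (y + t *\<^sub>R (x - y)) \<partial>lborel) \<partial>lborel)"
        by (rule lborel_pair.Fubini') measurable
      also have "\<dots> \<le> (\<integral>\<^sup>+t. indicator {1/2..1::real} t * ennreal (2 ^ CARD('n) * ?G) \<partial>lborel)"
      proof (rule nn_integral_mono)
        fix t :: real
        show "(\<integral>\<^sup>+x. indicator {1/2..1} t * ?F (y + t *\<^sub>R (x - y)) \<partial>lborel) \<le> indicator {1/2..1} t * ennreal (2 ^ CARD('n) * ?G)"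
          using scale[of t y] by (cases "t \<in> {1/2..1}") simp_all
      qed
      also have "\<dots> = ennreal (2 ^ CARD('n) * ?G / 2)"
        using G0 by (simp add: nn_integral_multc) (simp add: divide_ennreal_def divide_ennreal[symmetric] mult.commute)
      also have "ennreal (D\<^sup>2 / 2) * ennreal (2 ^ CARD('n) * ?G / 2) = ennreal (D\<^sup>2 / 2 * (2 ^ CARD('n) * ?G / 2))"
        using G0 by (intro ennreal_mult[symmetric]) auto
      finally show ?thesis
        using True by (simp add: mult_left_mono)
    qed simp
    have "(\<integral>\<^sup>+y. (\<integral>\<^sup>+x. ?W x y \<partial>lborel) \<partial>lborel) \<le> (\<integral>\<^sup>+y. indicator K y * ennreal (D\<^sup>2 / 2 * (2 ^ CARD('n) * ?G / 2)) \<partial>lborel)"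
      by (intro nn_integral_mono inner)
    also have "\<dots> = ennreal (measure lborel K) * ennreal (D\<^sup>2 / 2 * (2 ^ CARD('n) * ?G / 2))"
      using emeasure_compact_finite[OF K(2)] by (simp add: nn_integral_multc emeasure_eq_ennreal_measure)
    finally show ?thesis
      using G0 by (simp add: ennreal_mult[symmetric] mult.commute)
  qed
  have W': "(\<integral>\<^sup>+x. (\<integral>\<^sup>+y. ?W x y \<partial>lborel) \<partial>lborel) = (\<integral>\<^sup>+y. (\<integral>\<^sup>+x. ?W x y \<partial>lborel) \<partial>lborel)"
    by (rule lborel_pair.Fubini') measurable
  \<comment> \<open>Expanding the square and using the zero mean, the integral over y equals
    \<open>measure lborel K * (v x)\<^sup>2\<close> plus a nonnegative constant.\<close>
  have lower: "ennreal (measure lborel K * ?I) \<le> (\<integral>\<^sup>+x. (\<integral>\<^sup>+y. ennreal (indicator K x * (indicator K y * (v x - v y)\<^sup>2)) \<partial>lborel) \<partial>lborel)"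
  proof -
    have "(\<integral>\<^sup>+y. ennreal (indicator K x * (indicator K y * (v x - v y)\<^sup>2)) \<partial>lborel)
      \<ge> ennreal (measure lborel K * (indicator K x * (v x)\<^sup>2))" for x
    proof -
      have "(LINT y|lborel. indicator K y * (v x - v y)\<^sup>2)
        = (LINT y|lborel. indicator K y * (v x)\<^sup>2 - 2 * v x * (indicator K y * v y) + indicator K y * (v y)\<^sup>2)"
        by (intro Bochner_Integration.integral_cong refl) (simp add: power2_diff algebra_simps)
      also have "\<dots> = (LINT y|lborel. indicator K y * (v x)\<^sup>2) - (LINT y|lborel. 2 * v x * (indicator K y * v y)) + ?I"
        by (subst Bochner_Integration.integral_add; (subst Bochner_Integration.integral_diff)?;
          intro Bochner_Integration.integrable_diff integrable_mult_right intK continuous_intros cont refl)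
      also have "\<dots> = measure lborel K * (v x)\<^sup>2 + ?I"
        by (simp only: integral_mult_right_zero mean) simp
      finally have eq: "(LINT y|lborel. indicator K y * (v x - v y)\<^sup>2) = measure lborel K * (v x)\<^sup>2 + ?I" .
      have "(\<integral>\<^sup>+y. ennreal (indicator K x * (indicator K y * (v x - v y)\<^sup>2)) \<partial>lborel)
        = ennreal (LINT y|lborel. indicator K x * (indicator K y * (v x - v y)\<^sup>2))"
        by (intro nn_integral_eq_integral integrable_mult_right intK continuous_intros cont) auto
      also have "\<dots> = ennreal (indicator K x * (measure lborel K * (v x)\<^sup>2 + ?I))"
        by (simp only: integral_mult_right_zero eq)
      finally show ?thesis
        using I0 by (auto simp: indicator_def intro!: ennreal_leI)
    qed
    then have "(\<integral>\<^sup>+x. ennreal (measure lborel K * (indicator K x * (v x)\<^sup>2)) \<partial>lborel)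
      \<le> (\<integral>\<^sup>+x. (\<integral>\<^sup>+y. ennreal (indicator K x * (indicator K y * (v x - v y)\<^sup>2)) \<partial>lborel) \<partial>lborel)"
      by (intro nn_integral_mono)
    moreover have "(\<integral>\<^sup>+x. ennreal (measure lborel K * (indicator K x * (v x)\<^sup>2)) \<partial>lborel) = ennreal (measure lborel K * ?I)"
      by (subst nn_integral_eq_integral) (auto intro!: integrable_mult_right intK continuous_intros cont)
    ultimately show ?thesis by simp
  qed
  also have "\<dots> \<le> (\<integral>\<^sup>+x. (\<integral>\<^sup>+y. 2 * ?W x y + 2 * ?W y x \<partial>lborel) \<partial>lborel)"
  proof (intro nn_integral_mono)
    fix x y :: "real^'n"
    let ?z = "(1/2) *\<^sub>R (x + y)"
    have "(v x - v y)\<^sup>2 \<le> 2 * (v x - v ?z)\<^sup>2 + 2 * (v y - v ?z)\<^sup>2"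
      using sum_squares_bound[of "v x - v ?z" "- (v y - v ?z)"] by (simp add: power2_eq_square algebra_simps)
    then have "ennreal ((v x - v y)\<^sup>2) \<le> ennreal (2 * (v x - v ?z)\<^sup>2 + 2 * (v y - v ?z)\<^sup>2)"
      by (rule ennreal_leI)
    also have "\<dots> = 2 * ennreal ((v x - v ?z)\<^sup>2) + 2 * ennreal ((v y - v ?z)\<^sup>2)"
      by (simp add: ennreal_plus ennreal_mult)
    finally show "ennreal (indicator K x * (indicator K y * (v x - v y)\<^sup>2)) \<le> 2 * ?W x y + 2 * ?W y x"
      by (auto simp: indicator_def add.commute)
  qed
  \<comment> \<open>The two terms coincide after an interchange of variables. The factor 4 cancels
    the two halves in the bound for \<open>?W\<close>, one from Cauchy-Schwarz and one from the
    length of the t-interval.\<close>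
  also have "\<dots> = 4 * (\<integral>\<^sup>+y. (\<integral>\<^sup>+x. ?W x y \<partial>lborel) \<partial>lborel)"
  proof -
    have "(\<integral>\<^sup>+x. (\<integral>\<^sup>+y. 2 * ?W x y + 2 * ?W y x \<partial>lborel) \<partial>lborel)
      = (\<integral>\<^sup>+x. 2 * (\<integral>\<^sup>+y. ?W x y \<partial>lborel) + 2 * (\<integral>\<^sup>+y. ?W y x \<partial>lborel) \<partial>lborel)"
      by (subst nn_integral_add) (simp_all add: nn_integral_cmult)
    also have "\<dots> = 2 * (\<integral>\<^sup>+x. (\<integral>\<^sup>+y. ?W x y \<partial>lborel) \<partial>lborel) + 2 * (\<integral>\<^sup>+x. (\<integral>\<^sup>+y. ?W y x \<partial>lborel) \<partial>lborel)"
      by (subst nn_integral_add) (simp_all add: nn_integral_cmult)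
    finally show ?thesis
      unfolding W' by (simp flip: distrib_right)
  qed
  also have "\<dots> \<le> 4 * ennreal (D\<^sup>2 / 2 * (2 ^ CARD('n) * ?G / 2) * measure lborel K)"
    by (intro mult_left_mono W) simp
  also have "\<dots> = ennreal (measure lborel K * (2 ^ CARD('n) * D\<^sup>2 * ?G))"
    using G0 by (subst ennreal_numeral[symmetric], subst ennreal_mult[symmetric]) (simp_all add: mult_ac)
  finally have "measure lborel K * ?I \<le> measure lborel K * (2 ^ CARD('n) * D\<^sup>2 * ?G)"
    using G0 by (subst (asm) ennreal_le_iff) auto
  then show ?thesis
    using pos by simp
qed

section \<open>Square integrable functions\<close>

lemma borel_measurable_norm_square:
  fixes f :: "'a \<Rightarrow> 'b::euclidean_space"
  shows "f \<in> borel_measurable M \<Longrightarrow> (\<lambda>x. (norm (f x))\<^sup>2) \<in> borel_measurable M"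
  by simp

lemma L2_spaceI:
  assumes "(\<lambda>x. indicator S x *\<^sub>R f x) \<in> borel_measurable lebesgue"
    "integrable lebesgue (\<lambda>x. (norm (indicator S x *\<^sub>R f x))\<^sup>2)"
  shows "f \<in> L2_space S"
proof -
  have "(norm (indicator S x *\<^sub>R f x))\<^sup>2 = indicator S x *\<^sub>R (norm (f x))\<^sup>2" for x
    by (simp add: indicator_def)
  with assms show ?thesis
    by (simp only: L2_space_def set_borel_measurable_def set_integrable_def mem_Collect_eq)
qed

lemma L2_spaceD:
  assumes "f \<in> L2_space S"
  shows "(\<lambda>x. indicator S x *\<^sub>R f x) \<in> borel_measurable lebesgue"
    "integrable lebesgue (\<lambda>x. (norm (indicator S x *\<^sub>R f x))\<^sup>2)"
proof -
  have "(norm (indicator S x *\<^sub>R f x))\<^sup>2 = indicator S x *\<^sub>R (norm (f x))\<^sup>2" for x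
    by (simp add: indicator_def)
  then show "(\<lambda>x. indicator S x *\<^sub>R f x) \<in> borel_measurable lebesgue"
    "integrable lebesgue (\<lambda>x. (norm (indicator S x *\<^sub>R f x))\<^sup>2)"
    using assms by (simp_all only: L2_space_def set_borel_measurable_def set_integrable_def mem_Collect_eq)
qed

lemma L2_inner_alt: "L2_inner S f g = (LINT x|lebesgue. (indicator S x *\<^sub>R f x) \<bullet> (indicator S x *\<^sub>R g x))"
  unfolding L2_inner_def set_lebesgue_integral_def
  by (intro Bochner_Integration.integral_cong) (auto simp: indicator_def)

lemma L2_integrable:
  assumes f: "f \<in> L2_space S" and g: "g \<in> L2_space S"
  shows "integrable lebesgue (\<lambda>x. (indicator S x *\<^sub>R f x) \<bullet> (indicator S x *\<^sub>R g x))"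
proof (rule Bochner_Integration.integrable_bound)
  show "integrable lebesgue (\<lambda>x. (norm (indicator S x *\<^sub>R f x))\<^sup>2 + (norm (indicator S x *\<^sub>R g x))\<^sup>2)"
    using L2_spaceD[OF f] L2_spaceD[OF g] by (intro Bochner_Integration.integrable_add)
  show "(\<lambda>x. (indicator S x *\<^sub>R f x) \<bullet> (indicator S x *\<^sub>R g x)) \<in> borel_measurable lebesgue"
    using L2_spaceD[OF f] L2_spaceD[OF g] by (intro borel_measurable_inner)
  show "AE x in lebesgue. norm ((indicator S x *\<^sub>R f x) \<bullet> (indicator S x *\<^sub>R g x))
      \<le> norm ((norm (indicator S x *\<^sub>R f x))\<^sup>2 + (norm (indicator S x *\<^sub>R g x))\<^sup>2)"
  proof (rule AE_I2)
    fix x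
    let ?a = "indicator S x *\<^sub>R f x" and ?b = "indicator S x *\<^sub>R g x"
    have "\<bar>?a \<bullet> ?b\<bar> \<le> norm ?a * norm ?b"
      by (rule Cauchy_Schwarz_ineq2)
    also have "\<dots> \<le> (norm ?a)\<^sup>2 + (norm ?b)\<^sup>2"
      using sum_squares_bound[of "norm ?a" "norm ?b"] mult_nonneg_nonneg[OF norm_ge_zero norm_ge_zero, of ?a ?b]
      by linarith
    finally show "norm (?a \<bullet> ?b) \<le> norm ((norm ?a)\<^sup>2 + (norm ?b)\<^sup>2)"
      by simp
  qed
qed

lemma L2_set_integrable:
  assumes "f \<in> L2_space S" "g \<in> L2_space S"
  shows "set_integrable lebesgue S (\<lambda>x. f x \<bullet> g x)"
proof -
  have "(indicator S x *\<^sub>R f x) \<bullet> (indicator S x *\<^sub>R g x) = indicator S x *\<^sub>R (f x \<bullet> g x)" for x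
    by (simp add: indicator_def)
  then show ?thesis
    using L2_integrable[OF assms] by (simp only: set_integrable_def)
qed

lemma L2_space_lincomb:
  assumes f: "f \<in> L2_space S" and g: "g \<in> L2_space S"
  shows "(\<lambda>x. a *\<^sub>R f x + b *\<^sub>R g x) \<in> L2_space S"
proof (rule L2_spaceI)
  have eq: "indicator S x *\<^sub>R (a *\<^sub>R f x + b *\<^sub>R g x) = a *\<^sub>R (indicator S x *\<^sub>R f x) + b *\<^sub>R (indicator S x *\<^sub>R g x)" for x
    by (simp add: indicator_def)
  show "(\<lambda>x. indicator S x *\<^sub>R (a *\<^sub>R f x + b *\<^sub>R g x)) \<in> borel_measurable lebesgue"
    unfolding eq by (intro borel_measurable_add borel_measurable_const_scaleR L2_spaceD(1)[OF f] L2_spaceD(1)[OF g])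
  have "(norm (indicator S x *\<^sub>R (a *\<^sub>R f x + b *\<^sub>R g x)))\<^sup>2 = a\<^sup>2 * (norm (indicator S x *\<^sub>R f x))\<^sup>2
      + 2 * a * b * ((indicator S x *\<^sub>R f x) \<bullet> (indicator S x *\<^sub>R g x)) + b\<^sup>2 * (norm (indicator S x *\<^sub>R g x))\<^sup>2" for x
    unfolding eq power2_norm_eq_inner
    by (simp add: inner_add_left inner_add_right inner_commute power2_eq_square algebra_simps)
  then show "integrable lebesgue (\<lambda>x. (norm (indicator S x *\<^sub>R (a *\<^sub>R f x + b *\<^sub>R g x)))\<^sup>2)"
    using L2_spaceD[OF f] L2_spaceD[OF g] L2_integrable[OF f g]
    by (simp only:) (intro Bochner_Integration.integrable_add integrable_mult_right)
qed

lemma L2_space_diff: "f \<in> L2_space S \<Longrightarrow> g \<in> L2_space S \<Longrightarrow> (\<lambda>x. f x - g x) \<in> L2_space S"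
  using L2_space_lincomb[of f S g 1 "-1"] by simp

lemma L2_space_scaleR: "f \<in> L2_space S \<Longrightarrow> (\<lambda>x. a *\<^sub>R f x) \<in> L2_space S"
  using L2_space_lincomb[of f S f a 0] by simp

lemma L2_inner_commute: "L2_inner S f g = L2_inner S g f"
  by (simp add: L2_inner_def inner_commute)

lemma L2_inner_lincomb_left:
  assumes f: "f \<in> L2_space S" and g: "g \<in> L2_space S" and h: "h \<in> L2_space S"
  shows "L2_inner S (\<lambda>x. a *\<^sub>R f x + b *\<^sub>R g x) h = a * L2_inner S f h + b * L2_inner S g h"
proof -
  have "L2_inner S (\<lambda>x. a *\<^sub>R f x + b *\<^sub>R g x) h
    = (LINT x|lebesgue. a * ((indicator S x *\<^sub>R f x) \<bullet> (indicator S x *\<^sub>R h x)) + b * ((indicator S x *\<^sub>R g x) \<bullet> (indicator S x *\<^sub>R h x)))"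
    unfolding L2_inner_alt by (intro Bochner_Integration.integral_cong refl) (auto simp: indicator_def inner_add_left)
  also have "\<dots> = a * L2_inner S f h + b * L2_inner S g h"
    unfolding L2_inner_alt using L2_integrable[OF f h] L2_integrable[OF g h]
    by (subst Bochner_Integration.integral_add) simp_all
  finally show ?thesis .
qed

lemma L2_inner_diff_left:
  "f \<in> L2_space S \<Longrightarrow> g \<in> L2_space S \<Longrightarrow> h \<in> L2_space S \<Longrightarrow>
    L2_inner S (\<lambda>x. f x - g x) h = L2_inner S f h - L2_inner S g h"
  using L2_inner_lincomb_left[of f S g h 1 "-1"] by simp

lemma L2_inner_diff_right:
  "f \<in> L2_space S \<Longrightarrow> g \<in> L2_space S \<Longrightarrow> h \<in> L2_space S \<Longrightarrow>
    L2_inner S h (\<lambda>x. f x - g x) = L2_inner S h f - L2_inner S h g"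
  using L2_inner_diff_left[of f S g h] by (simp add: L2_inner_commute[of S h])

lemma L2_inner_nonneg: "0 \<le> L2_inner S f f"
  unfolding L2_inner_alt by (intro Bochner_Integration.integral_nonneg) simp

lemma L2_norm_nonneg: "0 \<le> L2_norm S f"
  by (simp add: L2_norm_def L2_inner_nonneg)

lemma L2_norm_square: "(L2_norm S f)\<^sup>2 = L2_inner S f f"
  by (simp add: L2_norm_def L2_inner_nonneg)

lemma quadratic_nonneg_discriminant:
  fixes a b c :: real
  assumes "\<And>t. 0 \<le> a - 2 * t * b + t\<^sup>2 * c"
  shows "b\<^sup>2 \<le> a * c"
proof (cases "c = 0")
  case True
  have "b = 0"
  proof (rule ccontr)
    assume "b \<noteq> 0"
    then show False
      using assms[of "(a + 1) / (2 * b)"] True by simp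
  qed
  with True show ?thesis by simp
next
  case False
  have "0 \<le> a - b\<^sup>2 / c"
    using assms[of "b / c"] False by (simp add: power2_eq_square field_simps)
  moreover have "c > 0"
  proof (rule ccontr)
    assume "\<not> c > 0"
    with False have c: "c < 0" by simp
    \<comment> \<open>At this t the negative leading term outweighs both other terms: t is at least
      1 and \<open>t * (- c)\<close> exceeds the sum of the absolute value of a and twice that of
      b.\<close>
    define t where "t = 1 + \<bar>a\<bar> / (- c) + 2 * \<bar>b\<bar> / (- c)"
    have t1: "t \<ge> 1"
    proof -
      have "0 \<le> \<bar>a\<bar> / (- c)" "0 \<le> 2 * \<bar>b\<bar> / (- c)"
        by (rule divide_nonneg_pos; use c in simp)+
      then show ?thesis
        unfolding t_def by linarith
    qed
    have "t * (- c) = - c + \<bar>a\<bar> + 2 * \<bar>b\<bar>"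
      using c by (simp add: t_def field_simps)
    then have "t * (t * (- c)) = t * (- c + \<bar>a\<bar> + 2 * \<bar>b\<bar>)"
      by simp
    also have "\<dots> = t * (- c) + t * \<bar>a\<bar> + 2 * (t * \<bar>b\<bar>)"
      by (simp add: algebra_simps)
    finally have "t * (t * (- c)) > \<bar>a\<bar> + 2 * (t * \<bar>b\<bar>)"
      using t1 c mult_right_mono[OF t1, of "\<bar>a\<bar>"] mult_pos_pos[of t "- c"] by linarith
    moreover have "t * \<bar>b\<bar> \<ge> - (t * b)"
      using t1 mult_left_mono[of "- b" "\<bar>b\<bar>" t] by simp
    ultimately have "a - 2 * t * b + t\<^sup>2 * c < 0"
      by (simp add: power2_eq_square algebra_simps)
    with assms[of t] show False by simp
  qed
  ultimately show ?thesis
    by (simp add: pos_divide_le_eq)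
qed

lemma L2_Cauchy_Schwarz:
  assumes f: "f \<in> L2_space S" and g: "g \<in> L2_space S"
  shows "\<bar>L2_inner S f g\<bar> \<le> L2_norm S f * L2_norm S g"
proof -
  have "0 \<le> L2_inner S f f - 2 * t * L2_inner S f g + t\<^sup>2 * L2_inner S g g" for t
  proof -
    let ?h = "\<lambda>x. 1 *\<^sub>R f x + (- t) *\<^sub>R g x"
    have h: "?h \<in> L2_space S"
      by (rule L2_space_lincomb[OF f g])
    have "L2_inner S ?h ?h = L2_inner S f ?h - t * L2_inner S g ?h"
      using L2_inner_lincomb_left[OF f g h, of 1 "- t"] by simp
    also have "L2_inner S f ?h = L2_inner S f f - t * L2_inner S f g"
      using L2_inner_lincomb_left[OF f g f, of 1 "- t"] L2_inner_commute[of S f ?h] L2_inner_commute[of S g f] by simp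
    also have "L2_inner S g ?h = L2_inner S f g - t * L2_inner S g g"
      using L2_inner_lincomb_left[OF f g g, of 1 "- t"] L2_inner_commute[of S g ?h] by simp
    finally show ?thesis
      using L2_inner_nonneg[of S ?h] by (simp add: power2_eq_square algebra_simps)
  qed
  then have "(L2_inner S f g)\<^sup>2 \<le> L2_inner S f f * L2_inner S g g"
    by (rule quadratic_nonneg_discriminant)
  also have "\<dots> = (L2_norm S f * L2_norm S g)\<^sup>2"
    by (simp add: power_mult_distrib L2_norm_square)
  finally show ?thesis
    using L2_norm_nonneg[of S f] L2_norm_nonneg[of S g] by (simp add: abs_le_square_iff[symmetric])
qed

text \<open>The hypothesis compares extensions by zero, so the set and the function may change
  together: a simplex against its interior, or the support of a test function against the
  domain.\<close>

lemma L2_space_cong: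
  fixes f :: "real^'n \<Rightarrow> 'b::euclidean_space"
  assumes f: "f \<in> L2_space S" and ae: "AE x in lebesgue. indicat_real S x *\<^sub>R f x = indicator T x *\<^sub>R g x"
  shows "g \<in> L2_space T"
proof (rule L2_spaceI)
  show m: "(\<lambda>x. indicator T x *\<^sub>R g x) \<in> borel_measurable lebesgue"
    by (rule borel_measurable_AE[OF L2_spaceD(1)[OF f] ae])
  show "integrable lebesgue (\<lambda>x. (norm (indicator T x *\<^sub>R g x))\<^sup>2)"
  proof (rule integrable_cong_AE_imp[OF L2_spaceD(2)[OF f]])
    show "(\<lambda>x. (norm (indicator T x *\<^sub>R g x))\<^sup>2) \<in> borel_measurable lebesgue"
      using m by (rule borel_measurable_norm_square)
    show "AE x in lebesgue. (norm (indicator S x *\<^sub>R f x))\<^sup>2 = (norm (indicator T x *\<^sub>R g x))\<^sup>2"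
      using ae by eventually_elim (simp only:)
  qed
qed

lemma L2_inner_cong:
  fixes f1 f2 :: "real^'n \<Rightarrow> 'b::euclidean_space"
  assumes f: "f1 \<in> L2_space S" "f2 \<in> L2_space S"
    and ae: "AE x in lebesgue. indicat_real S x *\<^sub>R f1 x = indicator T x *\<^sub>R g1 x"
      "AE x in lebesgue. indicat_real S x *\<^sub>R f2 x = indicator T x *\<^sub>R g2 x"
  shows "L2_inner S f1 f2 = L2_inner T g1 g2"
  unfolding L2_inner_alt
proof (rule integral_cong_AE)
  note g = L2_space_cong[OF f(1) ae(1)] L2_space_cong[OF f(2) ae(2)]
  show "(\<lambda>x. (indicator S x *\<^sub>R f1 x) \<bullet> (indicator S x *\<^sub>R f2 x)) \<in> borel_measurable lebesgue"
    "(\<lambda>x. (indicator T x *\<^sub>R g1 x) \<bullet> (indicator T x *\<^sub>R g2 x)) \<in> borel_measurable lebesgue"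
    using L2_integrable[OF f] L2_integrable[OF g] by (auto dest: borel_measurable_integrable)
  show "AE x in lebesgue. (indicator S x *\<^sub>R f1 x) \<bullet> (indicator S x *\<^sub>R f2 x) = (indicator T x *\<^sub>R g1 x) \<bullet> (indicator T x *\<^sub>R g2 x)"
    using ae by eventually_elim (simp only:)
qed

lemma L2_space_subset:
  assumes f: "f \<in> L2_space S" and T: "T \<subseteq> S" "T \<in> sets lebesgue"
  shows "f \<in> L2_space T"
proof (rule L2_spaceI)
  have eq: "indicator T x *\<^sub>R f x = indicat_real T x *\<^sub>R (indicat_real S x *\<^sub>R f x)" for x
    using T(1) by (auto simp: indicator_def)
  show m: "(\<lambda>x. indicator T x *\<^sub>R f x) \<in> borel_measurable lebesgue"
    unfolding eq by (rule borel_measurable_scaleR[OF borel_measurable_indicator[OF T(2)] L2_spaceD(1)[OF f]])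
  show "integrable lebesgue (\<lambda>x. (norm (indicator T x *\<^sub>R f x))\<^sup>2)"
  proof (rule Bochner_Integration.integrable_bound[OF L2_spaceD(2)[OF f]])
    show "(\<lambda>x. (norm (indicator T x *\<^sub>R f x))\<^sup>2) \<in> borel_measurable lebesgue"
      using m by (rule borel_measurable_norm_square)
    show "AE x in lebesgue. norm ((norm (indicator T x *\<^sub>R f x))\<^sup>2) \<le> norm ((norm (indicator S x *\<^sub>R f x))\<^sup>2)"
      using T(1) by (intro AE_I2) (auto simp: indicator_def)
  qed
qed

lemma L2_inner_subset_le:
  assumes f: "f \<in> L2_space S" and T: "T \<subseteq> S" "T \<in> sets lebesgue"
  shows "L2_inner T f f \<le> L2_inner S f f"
  unfolding L2_inner_alt
proof (rule integral_mono)
  show "integrable lebesgue (\<lambda>x. (indicator T x *\<^sub>R f x) \<bullet> (indicator T x *\<^sub>R f x))"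
    "integrable lebesgue (\<lambda>x. (indicator S x *\<^sub>R f x) \<bullet> (indicator S x *\<^sub>R f x))"
    using L2_integrable f L2_space_subset[OF assms] by blast+
  show "(indicator T x *\<^sub>R f x) \<bullet> (indicator T x *\<^sub>R f x) \<le> (indicator S x *\<^sub>R f x) \<bullet> (indicator S x *\<^sub>R f x)" for x
    using T(1) by (auto simp: indicator_def)
qed

lemma continuous_L2_space:
  fixes f :: "real^'n \<Rightarrow> 'b::euclidean_space"
  assumes f: "continuous_on UNIV f" and K: "compact K"
  shows "f \<in> L2_space K"
proof (rule L2_spaceI)
  have i: "set_integrable lebesgue K f" "set_integrable lebesgue K (\<lambda>x. (norm (f x))\<^sup>2)"
    by (intro continuous_absolutely_integrable_compact continuous_intros f K)+
  then show "(\<lambda>x. indicator K x *\<^sub>R f x) \<in> borel_measurable lebesgue"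
    unfolding set_integrable_def by (intro borel_measurable_integrable)
  have "indicator K x *\<^sub>R (norm (f x))\<^sup>2 = (norm (indicator K x *\<^sub>R f x))\<^sup>2" for x
    by (simp add: indicator_def)
  then show "integrable lebesgue (\<lambda>x. (norm (indicator K x *\<^sub>R f x))\<^sup>2)"
    using i(2) by (simp only: set_integrable_def)
qed

lemma L2_space_matrix_mult:
  fixes q :: "real^'n \<Rightarrow> real^'n" and M :: "real^'n^'n"
  assumes q: "q \<in> L2_space S"
  shows "(\<lambda>x. M *v q x) \<in> L2_space S"
proof (rule L2_spaceI)
  have eq: "indicator S x *\<^sub>R (M *v q x) = M *v (indicator S x *\<^sub>R q x)" for x
    by (simp add: indicator_def)
  have Mm: "(*v) M \<in> borel_measurable borel"
    by (intro borel_measurable_continuous_onI linear_continuous_on matrix_vector_mul_bounded_linear)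
  show m: "(\<lambda>x. indicator S x *\<^sub>R (M *v q x)) \<in> borel_measurable lebesgue"
    unfolding eq by (rule measurable_compose[OF L2_spaceD(1)[OF q] Mm])
  obtain C where C: "C > 0" "\<And>y. norm (M *v y) \<le> norm y * C"
    using bounded_linear.pos_bounded[OF matrix_vector_mul_bounded_linear, of M] by blast
  show "integrable lebesgue (\<lambda>x. (norm (indicator S x *\<^sub>R (M *v q x)))\<^sup>2)"
  proof (rule Bochner_Integration.integrable_bound)
    show "integrable lebesgue (\<lambda>x. C\<^sup>2 * (norm (indicator S x *\<^sub>R q x))\<^sup>2)"
      using L2_spaceD(2)[OF q] by (rule integrable_mult_right)
    show "(\<lambda>x. (norm (indicator S x *\<^sub>R (M *v q x)))\<^sup>2) \<in> borel_measurable lebesgue"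
      using m by (rule borel_measurable_norm_square)
    show "AE x in lebesgue. norm ((norm (indicator S x *\<^sub>R (M *v q x)))\<^sup>2) \<le> norm (C\<^sup>2 * (norm (indicator S x *\<^sub>R q x))\<^sup>2)"
    proof (rule AE_I2)
      fix x
      have "(norm (M *v (indicator S x *\<^sub>R q x)))\<^sup>2 \<le> (norm (indicator S x *\<^sub>R q x) * C)\<^sup>2"
        by (intro power_mono C(2)) simp
      then show "norm ((norm (indicator S x *\<^sub>R (M *v q x)))\<^sup>2) \<le> norm (C\<^sup>2 * (norm (indicator S x *\<^sub>R q x))\<^sup>2)"
        unfolding eq by (simp add: power_mult_distrib mult.commute)
    qed
  qed
qed

section \<open>Convergence in L2\<close>

definition L2_tendsto :: "(real^'n) set \<Rightarrow> (nat \<Rightarrow> real^'n \<Rightarrow> 'b::euclidean_space) \<Rightarrow> (real^'n \<Rightarrow> 'b) \<Rightarrow> bool" where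
  "L2_tendsto S f l \<longleftrightarrow> l \<in> L2_space S \<and> (\<forall>j. f j \<in> L2_space S) \<and> (\<lambda>j. L2_norm S (\<lambda>x. f j x - l x)) \<longlonglongrightarrow> 0"

lemma L2_tendstoD:
  assumes "L2_tendsto S f l"
  shows "l \<in> L2_space S" "f j \<in> L2_space S" "(\<lambda>j. L2_norm S (\<lambda>x. f j x - l x)) \<longlonglongrightarrow> 0"
  using assms by (auto simp: L2_tendsto_def)

lemma L2_tendsto_inner:
  assumes f: "L2_tendsto S f l" and h: "h \<in> L2_space S"
  shows "(\<lambda>j. L2_inner S (f j) h) \<longlonglongrightarrow> L2_inner S l h"
proof (rule LIM_zero_cancel, rule Lim_null_comparison)
  note fD = L2_tendstoD[OF f]
  show "(\<lambda>j. L2_norm S (\<lambda>x. f j x - l x) * L2_norm S h) \<longlonglongrightarrow> 0"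
    using tendsto_mult_left_zero[OF fD(3)] .
  show "\<forall>\<^sub>F j in sequentially. norm (L2_inner S (f j) h - L2_inner S l h) \<le> L2_norm S (\<lambda>x. f j x - l x) * L2_norm S h"
    using L2_Cauchy_Schwarz[OF L2_space_diff[OF fD(2,1)] h] L2_inner_diff_left[OF fD(2,1) h] by simp
qed

lemma L2_tendsto_norm_square:
  assumes f: "L2_tendsto S f l"
  shows "(\<lambda>j. L2_inner S (f j) (f j)) \<longlonglongrightarrow> L2_inner S l l"
proof -
  note fD = L2_tendstoD[OF f]
  have "L2_inner S (f j) (f j) = (L2_norm S (\<lambda>x. f j x - l x))\<^sup>2 + 2 * L2_inner S (f j) l - L2_inner S l l" for j
    using fD(1) fD(2)[of j] L2_space_diff[OF fD(2)[of j] fD(1)]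
    by (simp add: L2_norm_square L2_inner_diff_left L2_inner_diff_right L2_inner_commute[of S l "f j"])
  moreover have "(\<lambda>j. (L2_norm S (\<lambda>x. f j x - l x))\<^sup>2 + 2 * L2_inner S (f j) l - L2_inner S l l)
      \<longlonglongrightarrow> 0\<^sup>2 + 2 * L2_inner S l l - L2_inner S l l"
    by (intro tendsto_intros fD(3) L2_tendsto_inner f fD(1))
  ultimately show ?thesis by simp
qed

lemma L2_tendsto_diff_const:
  assumes f: "L2_tendsto S f l" and h: "h \<in> L2_space S"
  shows "L2_tendsto S (\<lambda>j x. f j x - h x) (\<lambda>x. l x - h x)"
  using L2_tendstoD[OF f] L2_space_diff[OF _ h] by (auto simp: L2_tendsto_def)

lemma L2_tendsto_subset:
  assumes f: "L2_tendsto S f l" and T: "T \<subseteq> S" "T \<in> sets lebesgue"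
  shows "L2_tendsto T f l"
  unfolding L2_tendsto_def
proof (intro conjI allI)
  note fD = L2_tendstoD[OF f]
  show "l \<in> L2_space T" "f j \<in> L2_space T" for j
    using fD L2_space_subset[OF _ T] by blast+
  show "(\<lambda>j. L2_norm T (\<lambda>x. f j x - l x)) \<longlonglongrightarrow> 0"
  proof (rule Lim_null_comparison[OF _ fD(3)])
    show "\<forall>\<^sub>F j in sequentially. norm (L2_norm T (\<lambda>x. f j x - l x)) \<le> L2_norm S (\<lambda>x. f j x - l x)"
      using L2_inner_subset_le[OF L2_space_diff[OF fD(2,1)] T]
      by (intro always_eventually allI) (simp add: L2_norm_nonneg, simp add: L2_norm_def)
  qed
qed

lemma L2_tendsto_cong_set:
  assumes f: "L2_tendsto S f l" and ae: "AE x in lebesgue. x \<in> S \<longleftrightarrow> x \<in> T"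
  shows "L2_tendsto T f l"
proof -
  have ae': "AE x in lebesgue. indicat_real S x *\<^sub>R h x = indicator T x *\<^sub>R h x" for h :: "real^'a \<Rightarrow> 'b"
    using ae by eventually_elim (auto simp: indicator_def)
  note fD = L2_tendstoD[OF f]
  have "L2_norm T (\<lambda>x. f j x - l x) = L2_norm S (\<lambda>x. f j x - l x)" for j
    unfolding L2_norm_def
    using L2_inner_cong[OF L2_space_diff[OF fD(2,1)] L2_space_diff[OF fD(2,1)] ae' ae'] by simp
  with fD show ?thesis
    using L2_space_cong[OF _ ae'] by (auto simp: L2_tendsto_def)
qed

text \<open>Serves to correct the means of approximating functions when only their limit has mean
  zero.\<close>

lemma L2_tendsto_add_vanishing:
  fixes r :: "nat \<Rightarrow> real"
  assumes f: "L2_tendsto S f l" and h: "h \<in> L2_space S" and r: "r \<longlonglongrightarrow> 0"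
  shows "L2_tendsto S (\<lambda>j x. f j x - r j *\<^sub>R h x) l"
  unfolding L2_tendsto_def
proof (intro conjI allI)
  note fD = L2_tendstoD[OF f]
  show "l \<in> L2_space S" "(\<lambda>x. f j x - r j *\<^sub>R h x) \<in> L2_space S" for j
    using fD h by (auto intro: L2_space_diff L2_space_scaleR)
  have eq: "L2_norm S (\<lambda>x. (f j x - r j *\<^sub>R h x) - l x)
    = sqrt ((L2_norm S (\<lambda>x. f j x - l x))\<^sup>2 - 2 * r j * L2_inner S (\<lambda>x. f j x - l x) h + (r j)\<^sup>2 * L2_inner S h h)" for j
  proof -
    let ?d = "\<lambda>x. f j x - l x" and ?h = "\<lambda>x. r j *\<^sub>R h x"
    have d: "?d \<in> L2_space S" and h': "?h \<in> L2_space S"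
      using fD h by (auto intro: L2_space_diff L2_space_scaleR)
    have s: "L2_inner S ?h k = r j * L2_inner S h k" if "k \<in> L2_space S" for k
      using L2_inner_lincomb_left[OF h h that, of "r j" 0] by simp
    have "L2_inner S (\<lambda>x. ?d x - ?h x) (\<lambda>x. ?d x - ?h x)
      = L2_inner S ?d ?d - 2 * L2_inner S ?h ?d + L2_inner S ?h ?h"
      using d h' L2_space_diff[OF d h'] by (simp add: L2_inner_diff_left[OF d h'] L2_inner_diff_right[OF d h'] L2_inner_commute[of S ?d ?h])
    also have "\<dots> = (L2_norm S ?d)\<^sup>2 - 2 * r j * L2_inner S ?d h + (r j)\<^sup>2 * L2_inner S h h"
      unfolding s[OF d] s[OF h'] L2_inner_commute[of S h ?h] s[OF h] L2_norm_square
      by (simp add: power2_eq_square L2_inner_commute[of S h ?d])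
    finally show ?thesis
      unfolding L2_norm_def[of S "\<lambda>x. (f j x - r j *\<^sub>R h x) - l x"] by (simp add: algebra_simps)
  qed
  have "(\<lambda>j. L2_inner S (\<lambda>x. f j x - l x) h) \<longlonglongrightarrow> L2_inner S l h - L2_inner S l h"
    using tendsto_diff[OF L2_tendsto_inner[OF f h] tendsto_const[of "L2_inner S l h"]]
      L2_inner_diff_left[OF fD(2,1) h] by simp
  then have "(\<lambda>j. sqrt ((L2_norm S (\<lambda>x. f j x - l x))\<^sup>2 - 2 * r j * L2_inner S (\<lambda>x. f j x - l x) h + (r j)\<^sup>2 * L2_inner S h h))
    \<longlonglongrightarrow> sqrt (0\<^sup>2 - 2 * 0 * (L2_inner S l h - L2_inner S l h) + 0\<^sup>2 * L2_inner S h h)"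
    by (intro tendsto_intros fD(3) r)
  then show "(\<lambda>j. L2_norm S (\<lambda>x. (f j x - r j *\<^sub>R h x) - l x)) \<longlonglongrightarrow> 0"
    unfolding eq by simp
qed

section \<open>Interpolation on a simplex\<close>

lemma L2_inner_lborel:
  fixes f g :: "real^'n \<Rightarrow> 'b::euclidean_space"
  assumes "continuous_on UNIV f" "continuous_on UNIV g" "compact K"
  shows "L2_inner K f g = (LINT x|lborel. indicator K x * (f x \<bullet> g x))"
  unfolding L2_inner_def using assms
  by (intro set_integral_lebesgue_lborel borel_measurable_continuous_onI continuous_intros borel_compact)

text \<open>The flux is a sum of two L2 inner products with fixed functions, hence continuous under
  L2 convergence of function and gradient. This is how trace information reaches functions that are
  only limits.\<close>

lemma flux_L2:
  fixes K :: "(real^'n) set"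
  assumes "compact K" "v \<in> L2_space K" "g \<in> L2_space K"
  shows "flux K a v g = L2_inner K g (\<lambda>x. x - a) + real CARD('n) * L2_inner K v (\<lambda>x. 1)"
proof -
  have one: "(\<lambda>x. 1::real) \<in> L2_space K" and id: "(\<lambda>x. x - a) \<in> L2_space K"
    using assms(1) by (auto intro!: continuous_L2_space continuous_intros)
  have "flux K a v g = (LINT x:K|lebesgue. g x \<bullet> (x - a) + real CARD('n) * (v x \<bullet> 1))"
    by (simp add: flux_def inner_commute)
  also have "\<dots> = L2_inner K g (\<lambda>x. x - a) + (LINT x:K|lebesgue. real CARD('n) * (v x \<bullet> 1))"
    unfolding L2_inner_def by (intro set_integral_add L2_set_integrable id one assms set_integrable_mult_right)
  finally show ?thesis
    by (simp add: L2_inner_def)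
qed

lemma flux_diff:
  fixes K :: "(real^'n) set"
  assumes "compact K" "v \<in> L2_space K" "g \<in> L2_space K" "w \<in> L2_space K" "k \<in> L2_space K"
  shows "flux K a (\<lambda>x. v x - w x) (\<lambda>x. g x - k x) = flux K a v g - flux K a w k"
  using assms continuous_L2_space[of "\<lambda>x. 1::real" K] continuous_L2_space[of "\<lambda>x. x - a" K]
  by (simp add: flux_L2 L2_space_diff L2_inner_diff_left continuous_intros algebra_simps)

lemma flux_tendsto:
  assumes K: "compact K" and v: "L2_tendsto K f v" and g: "L2_tendsto K f' g"
  shows "(\<lambda>j. flux K a (f j) (f' j)) \<longlonglongrightarrow> flux K a v g"
proof -
  have "(\<lambda>x. 1::real) \<in> L2_space K" and "(\<lambda>x. x - a) \<in> L2_space K"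
    using K by (auto intro!: continuous_L2_space continuous_intros)
  then show ?thesis
    unfolding flux_L2[OF K L2_tendstoD(1)[OF v] L2_tendstoD(1)[OF g]] flux_L2[OF K L2_tendstoD(2)[OF v] L2_tendstoD(2)[OF g]]
    by (intro tendsto_intros L2_tendsto_inner v g)
qed

lemma C1_L2_space:
  assumes "C1_with f f'" "compact K"
  shows "f \<in> L2_space K" "f' \<in> L2_space K"
  using C1_withD[OF assms(1)] assms(2) by (auto intro: continuous_L2_space)

lemma C1_with_add:
  assumes "C1_with f f'" "C1_with g g'"
  shows "C1_with (\<lambda>x. f x + g x) (\<lambda>x. f' x + g' x)"
  using assms by (auto simp: C1_with_def inner_add_left intro!: derivative_eq_intros continuous_intros)

lemma C1_with_cmult:
  assumes "C1_with f f'"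
  shows "C1_with (\<lambda>x. c * f x) (\<lambda>x. c *\<^sub>R f' x)"
  using assms by (auto simp: C1_with_def intro!: derivative_eq_intros continuous_intros)

lemma C1_with_affine: "C1_with (\<lambda>x. g \<bullet> x + b) (\<lambda>_. g)"
  by (auto simp: C1_with_def intro!: derivative_eq_intros continuous_intros)

section \<open>Shape functions on one simplex\<close>

context nondegenerate_simplex
begin

definition shape :: "(real^'n \<Rightarrow> real^'n^'n) \<Rightarrow> real^'n \<Rightarrow> real \<Rightarrow> real \<Rightarrow> real^'n \<Rightarrow> real" where
  "shape A g b c x = g \<bullet> x + b + c * gcr_bubble A K x"

definition shape_grad :: "(real^'n \<Rightarrow> real^'n^'n) \<Rightarrow> real^'n \<Rightarrow> real \<Rightarrow> real^'n \<Rightarrow> real^'n" where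
  "shape_grad A g c x = g + c *\<^sub>R bubble_grad A x"

lemma C1_shape:
  assumes "transpose (B_bar A K) = B_bar A K"
  shows "C1_with (shape A g b c) (shape_grad A g c)"
  unfolding shape_def[abs_def] shape_grad_def[abs_def]
  by (intro C1_with_add C1_with_affine C1_with_cmult C1_bubble assms)

lemma flux_shape:
  assumes sym: "transpose (B_bar A K) = B_bar A K" and pos: "vertex_energy A \<noteq> 0"
  shows "flux K a (shape A g b c) (shape_grad A g c)
    = measure lborel K * ((real CARD('n) + 1) * (g \<bullet> mid K + b) - (g \<bullet> a + b))"
proof -
  let ?m = "\<lambda>x. (- c) * gcr_bubble A K x" and ?m' = "\<lambda>x. (- c) *\<^sub>R bubble_grad A x"
  have m: "C1_with ?m ?m'"
    by (intro C1_with_cmult C1_bubble sym)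
  have "flux K a (\<lambda>x. (g \<bullet> x + b) - ?m x) (\<lambda>x. g - ?m' x)
    = flux K a (\<lambda>x. g \<bullet> x + b) (\<lambda>x. g) - flux K a ?m ?m'"
    by (rule flux_diff_C1[OF nondegenerate_simplex_axioms C1_with_affine m])
  moreover have "flux K a ?m ?m' = 0"
  proof -
    have "flux K a ?m ?m' = (- c) * flux K a (gcr_bubble A K) (bubble_grad A)"
      unfolding flux_def set_integral_mult_right[symmetric]
      by (simp add: algebra_simps)
    then show ?thesis
      by (simp add: flux_bubble[OF sym pos])
  qed
  ultimately show ?thesis
    by (simp add: flux_affine shape_def[abs_def] shape_grad_def[abs_def])
qed

lemma integral_shape:
  assumes sym: "transpose (B_bar A K) = B_bar A K" and pos: "vertex_energy A \<noteq> 0"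
  shows "L2_inner K (shape A g b c) (\<lambda>x. 1) = measure lborel K * (g \<bullet> mid K + b + c)"
proof -
  note C = C1_withD(3)[OF C1_shape[OF sym]] C1_withD(3)[OF C1_bubble[OF sym]]
  have "L2_inner K (shape A g b c) (\<lambda>x. 1) = (LINT x|lborel. indicator K x * (shape A g b c x \<bullet> 1))"
    by (rule L2_inner_lborel[OF C(1) continuous_on_const compact_K])
  also have "\<dots> = (LINT x|lborel. indicator K x * (g \<bullet> x + b) + c * (indicator K x * gcr_bubble A K x))"
    by (intro Bochner_Integration.integral_cong refl) (simp add: shape_def algebra_simps)
  also have "\<dots> = (LINT x|lborel. indicator K x * (g \<bullet> x + b)) + (LINT x|lborel. c * (indicator K x * gcr_bubble A K x))"
    by (intro Bochner_Integration.integral_add integrable_mult_right integrable_K C continuous_intros)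
  finally show ?thesis
    by (simp only: integral_K_affine integral_mult_right_zero integral_bubble[OF pos]) (simp add: algebra_simps)
qed

lemma affine_interpolation:
  obtains g b where "\<And>a. a \<in> V \<Longrightarrow> g \<bullet> a + b = y a"
proof -
  let ?g = "\<Sum>r\<in>V. y r *\<^sub>R bary_grad V r" and ?b = "\<Sum>r\<in>V. y r * (- (bary_grad V r \<bullet> foot V r))"
  have "?g \<bullet> a + ?b = y a" if a: "a \<in> V" for a
  proof -
    have "?g \<bullet> a + ?b = (\<Sum>r\<in>V. y r * bary V r a)"
      by (simp add: inner_sum_left bary_def algebra_simps flip: sum.distrib)
    also have "\<dots> = (\<Sum>r\<in>V. if r = a then y a else 0)"
      by (intro sum.cong refl) (auto simp: bary_vertex a)
    finally show ?thesis
      using finite_V a by simp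
  qed
  then show ?thesis
    using that by blast
qed

text \<open>The fluxes do not see the bubble, so they determine the affine part, and the bubble
  coefficient is then free to adjust the element mean. The third conclusion is the form in which the
  face conditions are compared between neighbours.\<close>

lemma element_interpolation:
  fixes M :: "real^'n \<Rightarrow> real" and I :: real
  assumes sym: "transpose (B_bar A K) = B_bar A K" and pos: "vertex_energy A \<noteq> 0"
  obtains g b c where "\<And>a. a \<in> V \<Longrightarrow> flux K a (shape A g b c) (shape_grad A g c) = M a"
    "L2_inner K (shape A g b c) (\<lambda>x. 1) = I"
    "\<And>a. a \<in> V \<Longrightarrow> (\<Sum>p\<in>V - {a}. g \<bullet> p + b) = M a / measure lborel K"
proof -
  let ?n = "real CARD('n)" and ?k = "measure lborel K"
  \<comment> \<open>The sum of all vertex values: each vertex lies on n of the n + 1 faces, so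
    adding up the prescribed face sums counts it n times.\<close>
  define S where "S = (\<Sum>a\<in>V. M a / ?k) / ?n"
  obtain g b where gb: "\<And>a. a \<in> V \<Longrightarrow> g \<bullet> a + b = S - M a / ?k"
    using affine_interpolation[of "\<lambda>a. S - M a / ?k"] by blast
  have sumV: "(\<Sum>a\<in>V. g \<bullet> a + b) = S"
  proof -
    have "(\<Sum>a\<in>V. g \<bullet> a + b) = (\<Sum>a\<in>V. S - M a / ?k)"
      by (intro sum.cong refl gb)
    also have "\<dots> = (?n + 1) * S - ?n * S"
      using card by (simp add: sum_subtractf S_def)
    finally show ?thesis
      by (simp add: algebra_simps)
  qed
  have midS: "(?n + 1) * (g \<bullet> mid K + b) = S"
    unfolding sumV[symmetric] using card by (simp add: sum.distrib mid_K inner_sum_right field_simps add_pos_nonneg)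
  define c where "c = I / ?k - (g \<bullet> mid K + b)"
  show ?thesis
  proof (rule that[of g b c])
    show "flux K a (shape A g b c) (shape_grad A g c) = M a" if "a \<in> V" for a
      unfolding flux_shape[OF sym pos] midS gb[OF that] using measure_K_pos by simp
    show "L2_inner K (shape A g b c) (\<lambda>x. 1) = I"
      unfolding integral_shape[OF sym pos] c_def using measure_K_pos by simp
    show "(\<Sum>p\<in>V - {a}. g \<bullet> p + b) = M a / ?k" if a: "a \<in> V" for a
      using sumV gb[OF a] unfolding sum.remove[OF finite_V a] by simp
  qed
qed

text \<open>The bubble is designed so that \<open>A (K) \<nabla>w\<close> is a combination of the fields \<open>x - a\<close>, \<open>a\<close> a vertex, for
  every shape function \<open>w\<close>.\<close>

lemma shape_orthogonal:
  assumes M: "M ** B_bar A K = mat 1" and v: "v \<in> L2_space K" "vg \<in> L2_space K"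
    and flux: "\<And>a. a \<in> V \<Longrightarrow> flux K a v vg = 0" and mean: "L2_inner K v (\<lambda>x. 1) = 0"
  shows "L2_inner K vg (\<lambda>x. M *v shape_grad A g c x) = 0"
proof -
  have cL2: "(\<lambda>x. w) \<in> L2_space K" for w :: "real^'n"
    using compact_K by (auto intro!: continuous_L2_space continuous_intros)
  have idL2: "(\<lambda>x. x - w) \<in> L2_space K" for w :: "real^'n"
    using compact_K by (auto intro!: continuous_L2_space continuous_intros)
  \<comment> \<open>With zero element mean the zeroth-order part of the flux drops out, leaving
    orthogonality to the field x - a.\<close>
  have vert: "L2_inner K vg (\<lambda>x. x - a) = 0" if "a \<in> V" for a
    using flux[OF that] mean by (simp add: flux_L2[OF compact_K v])
  define F where "F w = L2_inner K vg (\<lambda>x. w)" for w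
  have lin: "linear F"
  proof (rule linearI)
    show "F (x + y) = F x + F y" for x y
      using L2_inner_lincomb_left[OF cL2[of x] cL2[of y] v(2), of 1 1] by (simp add: F_def L2_inner_commute[of K vg])
    show "F (r *\<^sub>R x) = r *\<^sub>R F x" for r x
      using L2_inner_lincomb_left[OF cL2[of x] cL2[of x] v(2), of r 0] by (simp add: F_def L2_inner_commute[of K vg])
  qed
  have Fa: "F (a - b) = 0" if "a \<in> V" "b \<in> V" for a b
  proof -
    have "F (a - b) = L2_inner K vg (\<lambda>x. (x - b) - (x - a))"
      by (simp add: F_def)
    also have "\<dots> = 0"
      by (subst L2_inner_diff_right[OF idL2 idL2 v(2)]) (simp add: vert that)
    finally show ?thesis .
  qed
  \<comment> \<open>F takes the same value at all vertices. Every point is an affine combination of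
    vertices, so F is constant, and a constant linear functional is 0.\<close>
  have F0: "F w = 0" for w
  proof -
    obtain a where a: "a \<in> V"
      using V_nonempty by blast
    have aff: "F y = F a" for y
    proof -
      have "F y = (\<Sum>b\<in>V. bary V b y * F b)"
        using linear_sum[OF lin, of "\<lambda>b. bary V b y *\<^sub>R b" V] linear_cmul[OF lin] by (simp add: bary_expand)
      also have "\<dots> = (\<Sum>b\<in>V. bary V b y * F a)"
        using Fa[OF _ a] linear_diff[OF lin] by (intro sum.cong refl) auto
      finally show ?thesis
        by (simp add: bary_sum flip: sum_distrib_right)
    qed
    show ?thesis
      using aff[of w] aff[of 0] linear_0[OF lin] by simp
  qed
  have midz: "L2_inner K vg (\<lambda>x. x - mid K) = 0"
  proof -
    obtain a where a: "a \<in> V"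
      using V_nonempty by blast
    have "L2_inner K vg (\<lambda>x. x - mid K) = L2_inner K vg (\<lambda>x. (x - a) - (mid K - a))"
      by simp
    also have "\<dots> = L2_inner K vg (\<lambda>x. x - a) - F (mid K - a)"
      by (subst L2_inner_diff_right[OF idL2 cL2 v(2)]) (simp add: F_def)
    finally show ?thesis
      by (simp add: vert[OF a] F0)
  qed
  \<comment> \<open>Here the design of the bubble enters: its gradient contains the inverse of M, so
    that multiplication by M leaves a multiple of x minus the centroid.\<close>
  have eq: "M *v shape_grad A g c x = 1 *\<^sub>R (M *v g) + (- (2 * bubble_coeff A * c)) *\<^sub>R (x - mid K)" for x
  proof -
    have "M *v (B_bar A K *v y) = y" for y
      by (simp add: matrix_vector_mul_assoc M)
    then show ?thesis
      by (simp add: shape_grad_def bubble_grad_def matrix_vector_right_distrib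
        matrix_vector_mult_diff_distrib matrix_vector_mult_scaleR mult_ac)
  qed
  show ?thesis
    unfolding eq L2_inner_commute[of K vg] L2_inner_lincomb_left[OF cL2 idL2 v(2)]
    using F0[of "M *v g"] midz unfolding F_def L2_inner_commute[of K vg] by simp
qed

text \<open>The inequality for smooth functions passes to the limit once the mean of each
  approximant is subtracted; these means tend to the mean of \<open>v\<close>, which is 0.\<close>

lemma poincare_L2:
  assumes v: "L2_tendsto K f v" and vg: "L2_tendsto K f' vg" and C1: "\<And>j. C1_with (f j) (f' j)"
    and D: "\<And>x y. x \<in> K \<Longrightarrow> y \<in> K \<Longrightarrow> norm (x - y) \<le> D" and mean: "L2_inner K v (\<lambda>x. 1) = 0"
  shows "L2_inner K v v \<le> 2 ^ CARD('n) * D\<^sup>2 * L2_inner K vg vg"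
proof -
  let ?k = "measure lborel K"
  have one: "(\<lambda>x. 1::real) \<in> L2_space K"
    using compact_K by (auto intro!: continuous_L2_space continuous_intros)
  define r where "r j = L2_inner K (f j) (\<lambda>x. 1) / ?k" for j
  have "r \<longlonglongrightarrow> L2_inner K v (\<lambda>x. 1) / ?k"
    unfolding r_def using measure_K_pos by (intro tendsto_divide L2_tendsto_inner v one tendsto_const) auto
  then have r0: "r \<longlonglongrightarrow> 0"
    by (simp add: mean)
  let ?F = "\<lambda>j x. f j x - r j *\<^sub>R 1"
  have F: "L2_tendsto K ?F v"
    by (rule L2_tendsto_add_vanishing[OF v one r0])
  have FC1: "C1_with (?F j) (f' j)" for j
    using C1_with_diff[OF C1 C1_with_affine[of 0 "r j"]] by simp
  have oneK: "L2_inner K (\<lambda>x. 1::real) (\<lambda>x. 1) = ?k"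
    using compact_K by (simp add: L2_inner_lborel borel_compact)
  have "L2_inner K (?F j) (?F j) \<le> 2 ^ CARD('n) * D\<^sup>2 * L2_inner K (f' j) (f' j)" for j
  proof -
    note c = C1_withD(2,3)[OF FC1[of j]]
    have "L2_inner K (?F j) (\<lambda>x. 1) = L2_inner K (f j) (\<lambda>x. 1) - r j * ?k"
      using L2_inner_lincomb_left[OF L2_tendstoD(2)[OF v] one one, of 1 j "- r j"] by (simp add: oneK)
    then have "L2_inner K (?F j) (\<lambda>x. 1) = 0"
      using measure_K_pos by (simp add: r_def)
    then have m: "(LINT x|lborel. indicator K x * ?F j x) = 0"
      using L2_inner_lborel[OF c(2) continuous_on_const[of UNIV 1] compact_K] by simp
    have e1: "L2_inner K (?F j) (?F j) = (LINT x|lborel. indicator K x * (?F j x)\<^sup>2)"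
      unfolding L2_inner_lborel[OF c(2) c(2) compact_K] by (simp only: power2_eq_square inner_real_def)
    have e2: "L2_inner K (f' j) (f' j) = (LINT x|lborel. indicator K x * (norm (f' j x))\<^sup>2)"
      unfolding L2_inner_lborel[OF c(1) c(1) compact_K] by (simp only: power2_norm_eq_inner)
    show ?thesis
      unfolding e1 e2 by (rule poincare_C1[OF FC1 convex_convex_hull compact_K D m measure_K_pos])
  qed
  then show ?thesis
    by (intro LIMSEQ_le[OF L2_tendsto_norm_square[OF F] tendsto_mult_left[OF L2_tendsto_norm_square[OF vg]]]) auto
qed

text \<open>Guarantees that the matrix at the centroid is the value of a piecewise constant matrix
  function on the whole open simplex.\<close>

lemma mid_interior: "mid K \<in> interior K"
proof (rule interiorI)
  let ?O = "\<Inter>a\<in>V. {x. 0 < bary V a x}"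
  show "open ?O"
    using finite_V by (intro open_INT ballI open_Collect_less cont_bary continuous_on_const) auto
  show "?O \<subseteq> K"
    unfolding K_eq by (auto intro: less_imp_le)
  have "bary V a (mid K) = 1 / (real CARD('n) + 1)" if "a \<in> V" for a
  proof -
    have "mid K = (\<Sum>b\<in>V. (1 / (real CARD('n) + 1)) *\<^sub>R b)"
      unfolding mid_K by (simp add: scaleR_sum_right)
    moreover have "(\<Sum>b\<in>V. 1 / (real CARD('n) + 1)) = 1"
      using card by (simp add: add_pos_nonneg)
    ultimately show ?thesis
      using bary_affine_comb[of "\<lambda>_. 1 / (real CARD('n) + 1)" a] that by simp
  qed
  then show "mid K \<in> ?O"
    by (auto intro!: divide_pos_pos add_nonneg_pos)
qed

text \<open>Coercivity of M at the vector \<open>B_bar A K *v y\<close> bounds the form of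
  \<open>B_bar\<close> from below by the squared norm of that vector, which is nonzero for nonzero y
  because M inverts \<open>B_bar\<close>. Some vertex differs from the centroid.\<close>

lemma vertex_energy_pos:
  assumes M: "M ** B_bar A K = mat 1" and pos: "\<And>y. (norm y)\<^sup>2 \<le> C * ((M *v y) \<bullet> y)" and C: "C > 0"
  shows "vertex_energy A > 0"
proof -
  let ?d = "\<lambda>a. a - mid K"
  have nonneg: "(norm (B_bar A K *v y))\<^sup>2 \<le> C * (y \<bullet> (B_bar A K *v y))" for y
    using pos[of "B_bar A K *v y"] by (simp add: matrix_vector_mul_assoc M)
  have nn: "0 \<le> ?d a \<bullet> (B_bar A K *v ?d a)" for a
  proof -
    have "0 \<le> C * (?d a \<bullet> (B_bar A K *v ?d a))"
      by (rule order_trans[OF zero_le_power2 nonneg])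
    then show ?thesis
      using C by (simp add: zero_le_mult_iff)
  qed
  obtain a where a: "a \<in> V" "a \<noteq> mid K"
    using other_vertex[of "mid K"] by blast
  have "B_bar A K *v ?d a \<noteq> 0"
  proof
    assume 0: "B_bar A K *v ?d a = 0"
    have "M *v (B_bar A K *v ?d a) = ?d a"
      by (simp add: matrix_vector_mul_assoc M)
    with 0 a(2) show False by simp
  qed
  then have "0 < C * (?d a \<bullet> (B_bar A K *v ?d a))"
    by (intro order_less_le_trans[OF _ nonneg]) simp
  then have "0 < ?d a \<bullet> (B_bar A K *v ?d a)"
    using C by (simp add: zero_less_mult_iff)
  then show ?thesis
    unfolding vertex_energy_def using finite_V a(1) nn by (intro sum_pos2[of V a]) auto
qed

end

section \<open>Interpolation on a mesh\<close>

lemma facet_vertices: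
  assumes V: "nondegenerate_simplex V" and E: "E facet_of convex hull V"
  obtains a where "a \<in> V" "E = convex hull (V - {a})"
  using facet_of_convex_hull_affine_independent[OF nondegenerate_simplex.indep[OF V]] E that by blast

text \<open>Affinely independent points are the extreme points of their hull. Hence two simplices
  with a common face share the vertices of that face.\<close>

lemma convex_hull_eq_imp_eq:
  fixes S T :: "'a::euclidean_space set"
  assumes "\<not> affine_dependent S" "\<not> affine_dependent T" "convex hull S = convex hull T"
  shows "S = T"
  using extreme_point_of_convex_hull_affine_independent[OF assms(1)]
    extreme_point_of_convex_hull_affine_independent[OF assms(2)] assms(3) by auto

locale gcr_mesh =
  fixes \<Omega> :: "(real^'n) set" and A :: "real^'n \<Rightarrow> real^'n^'n" and \<T> :: "(real^'n) set set" and C\<^sub>0 :: real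
  assumes domain: "polytopal_domain \<Omega>" and partition: "simplicial_partition \<Omega> \<T>"
    and A_sym: "\<And>x. x \<in> \<Omega> \<Longrightarrow> transpose (A x) = A x"
    and C\<^sub>0: "C\<^sub>0 > 0" and coercive: "\<And>q. q \<in> L2_space \<Omega> \<Longrightarrow> L2_inner \<Omega> q q \<le> C\<^sub>0 * A_inner A \<Omega> q q"
    and const: "piecewise_constant \<T> A"
begin

lemma \<Omega>: "open \<Omega>" "interior (closure \<Omega>) = \<Omega>" "\<Omega> \<noteq> {}"
  using domain by (auto simp: polytopal_domain_def)

lemma mesh: "finite \<T>" "\<Union>\<T> = closure \<Omega>"
  "\<And>K K'. K \<in> \<T> \<Longrightarrow> K' \<in> \<T> \<Longrightarrow> (K \<inter> K') face_of K"
  using partition by (auto simp: simplicial_partition_def triangulation_def)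

lemma mesh_simplex:
  assumes "K \<in> \<T>"
  obtains V where "nondegenerate_simplex V" "K = convex hull V"
proof -
  have "int CARD('n) simplex K"
    using partition assms by (auto simp: simplicial_partition_def)
  then obtain V where V: "\<not> affine_dependent V" "int (card V) = int CARD('n) + 1" "K = convex hull V"
    unfolding simplex_def by blast
  have "card V = CARD('n) + 1"
    using V(2) by linarith
  with V that show ?thesis
    by (auto simp: nondegenerate_simplex_def)
qed

lemma compact_mesh: "K \<in> \<T> \<Longrightarrow> compact K" and convex_mesh: "K \<in> \<T> \<Longrightarrow> convex K"
  by (metis mesh_simplex nondegenerate_simplex.compact_K) (metis mesh_simplex convex_convex_hull)

text \<open>Conformity is what makes the interiors disjoint: the intersection is a face of each
  simplex, and a face that meets the interior is the whole simplex.\<close>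

lemma interior_disjoint:
  assumes "K \<in> \<T>" "K' \<in> \<T>" "x \<in> interior K" "x \<in> interior K'"
  shows "K = K'"
proof -
  have x: "x \<in> K" "x \<in> K'"
    using assms interior_subset by blast+
  have "K \<inter> K' = K"
    using face_of_disjoint_interior[OF mesh(3)[OF assms(1,2)]] assms(3) x by blast
  moreover have "K' \<inter> K = K'"
    using face_of_disjoint_interior[OF mesh(3)[OF assms(2,1)]] assms(4) x by blast
  ultimately show ?thesis by blast
qed

lemma interior_mesh_subset: "K \<in> \<T> \<Longrightarrow> interior K \<subseteq> \<Omega>"
  using mesh(2) \<Omega>(2) interior_mono[of K "closure \<Omega>"] by blast

lemma AE_interior: "AE x in lebesgue. \<forall>K\<in>\<T>. x \<in> K \<longrightarrow> x \<in> interior K"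
proof (subst AE_finite_all[OF mesh(1)], intro ballI)
  fix K assume K: "K \<in> \<T>"
  have "negligible (frontier K)"
    by (rule negligible_convex_frontier[OF convex_mesh[OF K]])
  then have "AE x in lebesgue. x \<notin> frontier K"
    by (intro AE_not_in) (simp add: negligible_iff_null_sets)
  then show "AE x in lebesgue. x \<in> K \<longrightarrow> x \<in> interior K"
    by eventually_elim (use closure_subset[of K] in \<open>auto simp: frontier_def\<close>)
qed

text \<open>Functions on \<open>\<Omega>\<close> are handled as families of functions, one for each simplex.\<close>

definition agrees :: "(real^'n \<Rightarrow> 'b) \<Rightarrow> ((real^'n) set \<Rightarrow> real^'n \<Rightarrow> 'b) \<Rightarrow> bool" where
  "agrees f F \<longleftrightarrow> (\<forall>K\<in>\<T>. AE x in lebesgue. x \<in> K \<longrightarrow> f x = F K x)"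

lemma agrees_sum:
  fixes F :: "(real^'n) set \<Rightarrow> real^'n \<Rightarrow> 'b::real_normed_vector"
  assumes "agrees f F"
  shows "AE x in lebesgue. indicat_real \<Omega> x *\<^sub>R f x = (\<Sum>K\<in>\<T>. indicat_real K x *\<^sub>R F K x)"
proof -
  have "AE x in lebesgue. \<forall>K\<in>\<T>. x \<in> K \<longrightarrow> f x = F K x"
    using assms unfolding agrees_def by (subst AE_finite_all[OF mesh(1)])
  with AE_interior show ?thesis
  proof eventually_elim
    fix x assume int: "\<forall>K\<in>\<T>. x \<in> K \<longrightarrow> x \<in> interior K" and eq: "\<forall>K\<in>\<T>. x \<in> K \<longrightarrow> f x = F K x"
    show "indicat_real \<Omega> x *\<^sub>R f x = (\<Sum>K\<in>\<T>. indicat_real K x *\<^sub>R F K x)"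
    proof (cases "x \<in> \<Omega>")
      case True
      then have "x \<in> \<Union>\<T>"
        using closure_subset[of \<Omega>] by (auto simp: mesh(2))
      then obtain K where K: "K \<in> \<T>" "x \<in> K" by blast
      have "indicat_real K' x *\<^sub>R F K' x = (if K' = K then f x else 0)" if "K' \<in> \<T>" for K'
      proof (cases "x \<in> K'")
        case True
        then have "K' = K"
          using int K that interior_disjoint by blast
        then show ?thesis
          using K eq by simp
      next
        case False
        then show ?thesis
          using K(2) by auto
      qed
      then show ?thesis
        using True K(1) mesh(1) by (simp cong: sum.cong)
    next
      case False
      then have "x \<notin> K" if "K \<in> \<T>" for K
        using that int interior_mesh_subset by blast
      then show ?thesis
        using False by (simp add: indicator_def)
    qed
  qed
qed

lemma integral_agrees:
  fixes f :: "real^'n \<Rightarrow> real"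
  assumes f: "agrees f F" and F: "\<And>K. K \<in> \<T> \<Longrightarrow> set_integrable lebesgue K (F K)"
  shows "(LINT x:\<Omega>|lebesgue. f x) = (\<Sum>K\<in>\<T>. LINT x:K|lebesgue. F K x)"
proof -
  have i: "integrable lebesgue (\<lambda>x. \<Sum>K\<in>\<T>. indicat_real K x *\<^sub>R F K x)"
    using F by (intro Bochner_Integration.integrable_sum) (simp add: set_integrable_def)
  have ae: "AE x in lebesgue. (\<Sum>K\<in>\<T>. indicat_real K x *\<^sub>R F K x) = indicat_real \<Omega> x *\<^sub>R f x"
    using agrees_sum[OF f] by eventually_elim (rule sym)
  have "(LINT x:\<Omega>|lebesgue. f x) = (LINT x|lebesgue. (\<Sum>K\<in>\<T>. indicat_real K x *\<^sub>R F K x))"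
    unfolding set_lebesgue_integral_def
    by (rule integral_cong_AE[OF borel_measurable_AE[OF borel_measurable_integrable[OF i] ae] borel_measurable_integrable[OF i] agrees_sum[OF f]])
  also have "\<dots> = (\<Sum>K\<in>\<T>. LINT x:K|lebesgue. F K x)"
    unfolding set_lebesgue_integral_def using F by (intro Bochner_Integration.integral_sum) (simp add: set_integrable_def)
  finally show ?thesis .
qed

lemma agrees_inner:
  assumes "agrees f F" "agrees h H"
  shows "agrees (\<lambda>x. f x \<bullet> h x) (\<lambda>K x. F K x \<bullet> H K x)"
  unfolding agrees_def
proof
  fix K assume "K \<in> \<T>"
  then have "AE x in lebesgue. x \<in> K \<longrightarrow> f x = F K x" "AE x in lebesgue. x \<in> K \<longrightarrow> h x = H K x"
    using assms unfolding agrees_def by blast+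
  then show "AE x in lebesgue. x \<in> K \<longrightarrow> f x \<bullet> h x = F K x \<bullet> H K x"
    by eventually_elim simp
qed

lemma L2_inner_agrees:
  assumes "agrees f F" "agrees h H" "\<And>K. K \<in> \<T> \<Longrightarrow> F K \<in> L2_space K" "\<And>K. K \<in> \<T> \<Longrightarrow> H K \<in> L2_space K"
  shows "L2_inner \<Omega> f h = (\<Sum>K\<in>\<T>. L2_inner K (F K) (H K))"
  unfolding L2_inner_def by (intro integral_agrees agrees_inner L2_set_integrable assms)

lemma L2_space_agrees:
  fixes F :: "(real^'n) set \<Rightarrow> real^'n \<Rightarrow> 'b::euclidean_space"
  assumes f: "agrees f F" and F: "\<And>K. K \<in> \<T> \<Longrightarrow> F K \<in> L2_space K"
  shows "f \<in> L2_space \<Omega>"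
proof (rule L2_spaceI)
  have "(\<lambda>x. \<Sum>K\<in>\<T>. indicat_real K x *\<^sub>R F K x) \<in> borel_measurable lebesgue"
    by (intro borel_measurable_sum L2_spaceD(1) F)
  moreover have "AE x in lebesgue. (\<Sum>K\<in>\<T>. indicat_real K x *\<^sub>R F K x) = indicat_real \<Omega> x *\<^sub>R f x"
    using agrees_sum[OF f] by eventually_elim (rule sym)
  ultimately show m: "(\<lambda>x. indicat_real \<Omega> x *\<^sub>R f x) \<in> borel_measurable lebesgue"
    by (rule borel_measurable_AE)
  have i: "integrable lebesgue (\<lambda>x. \<Sum>K\<in>\<T>. indicat_real K x *\<^sub>R (F K x \<bullet> F K x))"
    using L2_set_integrable[OF F F] by (intro Bochner_Integration.integrable_sum) (simp add: set_integrable_def)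
  show "integrable lebesgue (\<lambda>x. (norm (indicat_real \<Omega> x *\<^sub>R f x))\<^sup>2)"
  proof (rule integrable_cong_AE_imp[OF i borel_measurable_norm_square[OF m]])
    show "AE x in lebesgue. (\<Sum>K\<in>\<T>. indicat_real K x *\<^sub>R (F K x \<bullet> F K x)) = (norm (indicat_real \<Omega> x *\<^sub>R f x))\<^sup>2"
    proof -
      have eq: "(norm (indicat_real \<Omega> x *\<^sub>R f x))\<^sup>2 = indicat_real \<Omega> x *\<^sub>R (f x \<bullet> f x)" for x
        by (simp add: indicator_def power2_norm_eq_inner)
      show ?thesis
        using agrees_sum[OF agrees_inner[OF f f]] by eventually_elim (simp only: eq)
    qed
  qed
qed

lemma agrees_self: "agrees f (\<lambda>_. f)"
  by (simp add: agrees_def)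

lemma agrees_diff:
  fixes F :: "(real^'n) set \<Rightarrow> real^'n \<Rightarrow> 'b::real_normed_vector"
  assumes "agrees f F" "agrees h H"
  shows "agrees (\<lambda>x. f x - h x) (\<lambda>K x. F K x - H K x)"
  unfolding agrees_def
proof
  fix K assume "K \<in> \<T>"
  then have "AE x in lebesgue. x \<in> K \<longrightarrow> f x = F K x" "AE x in lebesgue. x \<in> K \<longrightarrow> h x = H K x"
    using assms unfolding agrees_def by blast+
  then show "AE x in lebesgue. x \<in> K \<longrightarrow> f x - h x = F K x - H K x"
    by eventually_elim simp
qed

lemma L2_tendsto_mesh:
  assumes "L2_tendsto \<Omega> f l" "K \<in> \<T>"
  shows "L2_tendsto K f l"
proof (rule L2_tendsto_cong_set)
  show "L2_tendsto (interior K) f l"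
    by (intro L2_tendsto_subset[OF assms(1)] interior_mesh_subset assms(2)) simp
  show "AE x in lebesgue. x \<in> interior K \<longleftrightarrow> x \<in> K"
    using AE_interior by eventually_elim (use assms(2) interior_subset[of K] in blast)
qed

lemma L2_space_mesh: "f \<in> L2_space \<Omega> \<Longrightarrow> K \<in> \<T> \<Longrightarrow> f \<in> L2_space K"
  using L2_tendstoD(1)[OF L2_tendsto_mesh[of "\<lambda>_. f" f K]] by (simp add: L2_tendsto_def L2_norm_def L2_inner_def)

text \<open>The same construction as in \<open>nc_grad\<close>. At most one summand is present; on
  the skeleton of the mesh, a null set, the empty sum gives 0.\<close>

definition glue :: "((real^'n) set \<Rightarrow> real^'n \<Rightarrow> 'b::real_normed_vector) \<Rightarrow> real^'n \<Rightarrow> 'b" where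
  "glue F x = (\<Sum>K | K \<in> \<T> \<and> x \<in> interior K. F K x)"

lemma glue_eq: "K \<in> \<T> \<Longrightarrow> x \<in> interior K \<Longrightarrow> glue F x = F K x"
proof -
  assume K: "K \<in> \<T>" "x \<in> interior K"
  then have "{K'. K' \<in> \<T> \<and> x \<in> interior K'} = {K}"
    using interior_disjoint by blast
  then show ?thesis
    by (simp add: glue_def)
qed

lemma agrees_glue: "agrees (glue F) F"
  unfolding agrees_def
proof
  fix K assume K: "K \<in> \<T>"
  show "AE x in lebesgue. x \<in> K \<longrightarrow> glue F x = F K x"
    using AE_interior by eventually_elim (use K glue_eq in blast)
qed

lemma agrees_nc_grad:
  assumes "\<And>K. K \<in> \<T> \<Longrightarrow> is_weak_grad (interior K) v (F K)"
  shows "agrees (nc_grad \<T> v) F"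
  unfolding agrees_def
proof
  fix K assume K: "K \<in> \<T>"
  have eq: "nc_grad \<T> v x = weak_grad (interior K) v x" if "x \<in> interior K" for x
    using glue_eq[OF K that, of "\<lambda>K. weak_grad (interior K) v"] by (simp add: glue_def nc_grad_def)
  show "AE x in lebesgue. x \<in> K \<longrightarrow> nc_grad \<T> v x = F K x"
    using weak_grad_AE[OF open_interior assms[OF K]] AE_interior
    by eventually_elim (use K eq in auto)
qed

lemma A_const: "K \<in> \<T> \<Longrightarrow> x \<in> interior K \<Longrightarrow> A x = A (mid K)"
proof -
  assume K: "K \<in> \<T>" "x \<in> interior K"
  obtain V where V: "nondegenerate_simplex V" "K = convex hull V"
    using mesh_simplex[OF K(1)] .
  obtain c where "\<forall>x\<in>interior K. A x = c"
    using const K(1) unfolding piecewise_constant_def by blast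
  then show ?thesis
    using K(2) nondegenerate_simplex.mid_interior[OF V(1)] V(2) by simp
qed

lemma A_mid_sym:
  assumes "K \<in> \<T>"
  shows "transpose (A (mid K)) = A (mid K)"
proof -
  obtain V where V: "nondegenerate_simplex V" "K = convex hull V"
    using mesh_simplex[OF assms] .
  then have "mid K \<in> \<Omega>"
    using nondegenerate_simplex.mid_interior[OF V(1)] interior_mesh_subset[OF assms] by auto
  then show ?thesis by (rule A_sym)
qed

text \<open>The broken energy form on families of fields, with the matrix frozen at the centroids.
  Working with it turns the comparison of the eigenvalues into finite algebra.\<close>

definition form :: "((real^'n) set \<Rightarrow> real^'n \<Rightarrow> real^'n) \<Rightarrow> ((real^'n) set \<Rightarrow> real^'n \<Rightarrow> real^'n) \<Rightarrow> real" where
  "form F H = (\<Sum>K\<in>\<T>. L2_inner K (\<lambda>x. A (mid K) *v F K x) (H K))"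

abbreviation L2_family :: "((real^'n) set \<Rightarrow> real^'n \<Rightarrow> 'b::euclidean_space) \<Rightarrow> bool" where
  "L2_family F \<equiv> (\<forall>K\<in>\<T>. F K \<in> L2_space K)"

lemma A_inner_form:
  assumes f: "agrees f F" and h: "agrees h H" and F: "L2_family F" "L2_family H"
  shows "A_inner A \<Omega> f h = form F H"
  unfolding A_inner_def form_def
proof (rule L2_inner_agrees[OF _ h])
  show "agrees (\<lambda>x. A x *v f x) (\<lambda>K x. A (mid K) *v F K x)"
    unfolding agrees_def
  proof
    fix K assume K: "K \<in> \<T>"
    then have "AE x in lebesgue. x \<in> K \<longrightarrow> f x = F K x"
      using f unfolding agrees_def by blast
    with AE_interior show "AE x in lebesgue. x \<in> K \<longrightarrow> A x *v f x = A (mid K) *v F K x"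
      by eventually_elim (use K A_const in auto)
  qed
qed (use F in \<open>auto intro: L2_space_matrix_mult\<close>)

lemma form_diff_left:
  assumes "L2_family F" "L2_family G" "L2_family H"
  shows "form (\<lambda>K x. F K x - G K x) H = form F H - form G H"
  unfolding form_def sum_subtractf[symmetric] using assms
  by (intro sum.cong refl) (simp add: matrix_vector_mult_diff_distrib L2_inner_diff_left L2_space_matrix_mult)

lemma L2_inner_matrix_sym:
  fixes M :: "real^'n^'n"
  assumes "transpose M = M"
  shows "L2_inner K (\<lambda>x. M *v f x) h = L2_inner K f (\<lambda>x. M *v h x)"
proof -
  have "(M *v y) \<bullet> z = y \<bullet> (M *v z)" for y z
    using dot_lmul_matrix[of y M z] transpose_matrix_vector[of M y] assms by simp
  then show ?thesis
    by (simp add: L2_inner_def)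
qed

lemma form_commute: "form F H = form H F"
  unfolding form_def
  by (intro sum.cong refl) (metis A_mid_sym L2_inner_matrix_sym L2_inner_commute)

lemma form_diff_right:
  assumes "L2_family F" "L2_family G" "L2_family H"
  shows "form H (\<lambda>K x. F K x - G K x) = form H F - form H G"
  using form_diff_left[OF assms] by (simp add: form_commute[of H])

lemma form_coercive:
  assumes "L2_family F"
  shows "(\<Sum>K\<in>\<T>. L2_inner K (F K) (F K)) \<le> C\<^sub>0 * form F F"
  using coercive[OF L2_space_agrees[OF agrees_glue[of F]]] assms
  by (simp add: L2_inner_agrees[OF agrees_glue agrees_glue] A_inner_form[OF agrees_glue agrees_glue])

lemma form_nonneg: "L2_family F \<Longrightarrow> 0 \<le> form F F"
proof -
  assume "L2_family F"
  from form_coercive[OF this] have "0 \<le> C\<^sub>0 * form F F"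
    by (meson L2_inner_nonneg order_trans sum_nonneg)
  then show ?thesis
    using C\<^sub>0 by (simp add: zero_le_mult_iff)
qed

text \<open>Coercivity is assumed for fields on the whole domain. The field that is y on K and 0 on
  all other simplices localizes it to the single matrix of K.\<close>

lemma A_mid_pos:
  assumes K: "K \<in> \<T>"
  shows "(norm y)\<^sup>2 \<le> C\<^sub>0 * ((A (mid K) *v y) \<bullet> y)"
proof -
  obtain V where V: "nondegenerate_simplex V" "K = convex hull V"
    using mesh_simplex[OF K] .
  have k: "measure lborel K > 0"
    using nondegenerate_simplex.measure_K_pos[OF V(1)] V(2) by simp
  let ?F = "\<lambda>K' x. if K' = K then y else 0"
  have L2: "L2_family ?F"
    using compact_mesh by (auto intro!: continuous_L2_space continuous_intros)
  have c: "L2_inner K (\<lambda>x. z) (\<lambda>x. w) = measure lborel K * (z \<bullet> w)" for z w :: "real^'n"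
    using compact_mesh[OF K] by (simp add: L2_inner_lborel borel_compact)
  have "L2_inner K' (?F K') (?F K') = (if K' = K then measure lborel K * (y \<bullet> y) else 0)" for K'
    using c[of y y] by (auto simp: L2_inner_def set_lebesgue_integral_def)
  then have 1: "(\<Sum>K'\<in>\<T>. L2_inner K' (?F K') (?F K')) = measure lborel K * (y \<bullet> y)"
    using K mesh(1) by simp
  have "L2_inner K' (\<lambda>x. A (mid K') *v ?F K' x) (?F K') = (if K' = K then measure lborel K * ((A (mid K) *v y) \<bullet> y) else 0)" for K'
    using c[of "A (mid K) *v y" y] by (auto simp: L2_inner_def set_lebesgue_integral_def)
  then have 2: "form ?F ?F = measure lborel K * ((A (mid K) *v y) \<bullet> y)"
    unfolding form_def using K mesh(1) by simp
  have "measure lborel K * (y \<bullet> y) \<le> measure lborel K * (C\<^sub>0 * ((A (mid K) *v y) \<bullet> y))"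
    using form_coercive[OF L2] unfolding 1 2 by (simp add: mult_ac)
  then show ?thesis
    using k by (simp add: power2_norm_eq_inner)
qed

lemma
  assumes K: "K \<in> \<T>"
  shows A_mid_B_bar: "A (mid K) ** B_bar A K = mat 1"
    and B_bar_sym: "transpose (B_bar A K) = B_bar A K"
proof -
  have "x = 0" if "A (mid K) *v x = 0" for x
    using A_mid_pos[OF K, of x] that by simp
  then have "invertible (A (mid K))"
    using matrix_left_invertible_ker[of "A (mid K)"] invertible_left_inverse by blast
  then show AB: "A (mid K) ** B_bar A K = mat 1"
    unfolding B_bar_def invertible_def matrix_inv_def by (rule someI2_ex) blast
  \<comment> \<open>A right inverse of a symmetric matrix is symmetric: insert A B = 1 on the right,
    regroup, and recognize the transpose of A B.\<close>
  have "transpose (B_bar A K) = transpose (B_bar A K) ** (A (mid K) ** B_bar A K)"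
    by (simp add: AB matrix_mul_rid)
  also have "\<dots> = transpose (A (mid K) ** B_bar A K) ** B_bar A K"
    by (simp add: matrix_transpose_mul A_mid_sym[OF K] matrix_mul_assoc)
  also have "\<dots> = B_bar A K"
    by (simp add: AB transpose_mat matrix_mul_lid)
  finally show "transpose (B_bar A K) = B_bar A K" .
qed

lemma norm_le_mesh_size:
  assumes "K \<in> \<T>" "x \<in> K" "y \<in> K"
  shows "norm (x - y) \<le> mesh_size \<T>"
proof -
  have "norm (x - y) \<le> diameter K"
    using diameter_bounded_bound[OF compact_imp_bounded[OF compact_mesh[OF assms(1)]] assms(2,3)] by (simp add: dist_norm)
  also have "\<dots> \<le> mesh_size \<T>"
    unfolding mesh_size_def using mesh(1) assms(1) by (intro Max_ge) auto
  finally show ?thesis .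
qed

end

section \<open>Approximation in H1_0 by test functions\<close>

lemma L2_norm_diff_commute: "L2_norm S (\<lambda>x. f x - g x) = L2_norm S (\<lambda>x. g x - f x)"
  by (simp add: L2_norm_def L2_inner_def inner_diff_left inner_diff_right algebra_simps)

lemma test_function_L2_space:
  assumes "test_function S \<phi>"
  shows "\<phi> \<in> L2_space S" "(\<lambda>x. \<chi> i. partial i \<phi> x) \<in> L2_space S"
proof -
  note D = test_functionD[OF assms]
  let ?C = "closure {x. \<phi> x \<noteq> 0}"
  have L: "\<phi> \<in> L2_space ?C" "(\<lambda>x. \<chi> i. partial i \<phi> x) \<in> L2_space ?C"
    by (rule C1_L2_space[OF C1_with_test_function[OF assms] D(4)])+
  have S: "x \<in> S" if "x \<in> ?C" for x
    using that D(5) by blast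
  have "indicat_real ?C x *\<^sub>R \<phi> x = indicator S x *\<^sub>R \<phi> x" for x
    using S[of x] D(6)[of x] by (cases "x \<in> ?C") simp_all
  then show "\<phi> \<in> L2_space S"
    by (intro L2_space_cong[OF L(1)] AE_I2)
  have "indicat_real ?C x *\<^sub>R (\<chi> i. partial i \<phi> x) = indicator S x *\<^sub>R (\<chi> i. partial i \<phi> x)" for x
    using S[of x] D(7)[of x] by (cases "x \<in> ?C") (simp_all add: vec_eq_iff)
  then show "(\<lambda>x. \<chi> i. partial i \<phi> x) \<in> L2_space S"
    by (intro L2_space_cong[OF L(2)] AE_I2)
qed

lemma H1_weak_grad:
  assumes S: "open S" and u: "u \<in> H1 S"
  shows "is_weak_grad S u (weak_grad S u)" "weak_grad S u \<in> L2_space S" "u \<in> L2_space S"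
proof -
  obtain g where g: "u \<in> L2_space S" "g \<in> L2_space S" "is_weak_grad S u g"
    using u by (auto simp: H1_def)
  show "is_weak_grad S u (weak_grad S u)"
    unfolding weak_grad_def by (rule someI[of "is_weak_grad S u", OF g(3)])
  have "AE x in lebesgue. indicat_real S x *\<^sub>R g x = indicator S x *\<^sub>R weak_grad S u x"
    using weak_grad_AE[OF S g(3)] by eventually_elim (auto simp: indicator_def)
  then show "weak_grad S u \<in> L2_space S"
    by (rule L2_space_cong[OF g(2)])
  show "u \<in> L2_space S" by (rule g(1))
qed

lemma H1_0_approximation:
  assumes S: "open S" and u: "u \<in> H1_0 S"
  obtains \<phi> where "\<And>j. test_function S (\<phi> j)" "L2_tendsto S \<phi> u"
    "L2_tendsto S (\<lambda>j x. \<chi> i. partial i (\<phi> j) x) (weak_grad S u)"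
proof -
  have "u \<in> H1 S"
    using u by (simp add: H1_0_def)
  note G = H1_weak_grad[OF S this]
  have "\<exists>\<phi>. test_function S \<phi> \<and> H1_norm S (\<lambda>x. u x - \<phi> x) < inverse (real (Suc j))" for j
    using u by (simp add: H1_0_def)
  then obtain \<phi> where \<phi>: "\<And>j. test_function S (\<phi> j)" "\<And>j. H1_norm S (\<lambda>x. u x - \<phi> j x) < inverse (real (Suc j))"
    by metis
  let ?g = "\<lambda>j x. \<chi> i. partial i (\<phi> j) x"
  have bound: "L2_norm S (\<lambda>x. \<phi> j x - u x) \<le> inverse (real (Suc j))"
    "L2_norm S (\<lambda>x. ?g j x - weak_grad S u x) \<le> inverse (real (Suc j))" for j
  proof -
    let ?v = "\<lambda>x. u x - \<phi> j x" and ?h = "\<lambda>x. weak_grad S u x - ?g j x"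
    have wg: "is_weak_grad S ?v ?h"
      by (intro is_weak_grad_diff G(1) is_weak_grad_C1 C1_with_test_function[OF \<phi>(1)])
    have ae: "AE x in lebesgue. indicat_real S x *\<^sub>R ?h x = indicator S x *\<^sub>R weak_grad S ?v x"
      using weak_grad_AE[OF S wg] by eventually_elim (auto simp: indicator_def)
    have h: "?h \<in> L2_space S"
      by (intro L2_space_diff G(2) test_function_L2_space(2) \<phi>(1))
    have "L2_norm S ?h = L2_norm S (weak_grad S ?v)"
      unfolding L2_norm_def using L2_inner_cong[OF h h ae ae] by simp
    then have H: "sqrt ((L2_norm S ?v)\<^sup>2 + (L2_norm S ?h)\<^sup>2) < inverse (real (Suc j))"
      using \<phi>(2)[of j] by (simp add: H1_norm_def)
    have "L2_norm S ?v \<le> sqrt ((L2_norm S ?v)\<^sup>2 + (L2_norm S ?h)\<^sup>2)"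
      "L2_norm S ?h \<le> sqrt ((L2_norm S ?v)\<^sup>2 + (L2_norm S ?h)\<^sup>2)"
      by (simp_all add: real_le_rsqrt)
    with H show "L2_norm S (\<lambda>x. \<phi> j x - u x) \<le> inverse (real (Suc j))"
      "L2_norm S (\<lambda>x. ?g j x - weak_grad S u x) \<le> inverse (real (Suc j))"
      unfolding L2_norm_diff_commute[of S "\<phi> j" u] L2_norm_diff_commute[of S "?g j" "weak_grad S u"] by linarith+
  qed
  have lim: "(\<lambda>j. L2_norm S (f j)) \<longlonglongrightarrow> 0" if "\<And>j. L2_norm S (f j) \<le> inverse (real (Suc j))"
    for f :: "nat \<Rightarrow> real^'a \<Rightarrow> 'b::euclidean_space"
    by (rule Lim_null_comparison[OF _ LIMSEQ_inverse_real_of_nat]) (use that in \<open>simp add: L2_norm_nonneg\<close>)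
  show ?thesis
    by (rule that[OF \<phi>(1)]) (auto simp: L2_tendsto_def intro!: G(2,3) test_function_L2_space \<phi>(1) lim bound)
qed

section \<open>Families of shape functions and the global interpolant\<close>

context gcr_mesh
begin

lemma mesh_vertices:
  assumes "K \<in> \<T>"
  shows "nondegenerate_simplex (vertices K)" "convex hull (vertices K) = K"
  using mesh_simplex[OF assms] nondegenerate_simplex.vertices_K by metis+

lemma vertex_energy_mesh:
  assumes K: "K \<in> \<T>"
  shows "nondegenerate_simplex.vertex_energy (vertices K) A \<noteq> 0"
proof -
  interpret S: nondegenerate_simplex "vertices K"
    by (rule mesh_vertices(1)[OF K])
  have "S.vertex_energy A > 0"
    by (rule S.vertex_energy_pos[of "A (mid K)" A C\<^sub>0])
      (simp_all add: mesh_vertices(2)[OF K] A_mid_B_bar[OF K] A_mid_pos[OF K] C\<^sub>0)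
  then show ?thesis by simp
qed

definition shape_family :: "((real^'n) set \<Rightarrow> real^'n \<Rightarrow> real) \<Rightarrow> ((real^'n) set \<Rightarrow> real^'n \<Rightarrow> real^'n) \<Rightarrow> bool" where
  "shape_family F G \<longleftrightarrow> (\<forall>K\<in>\<T>. \<exists>g b c. F K = nondegenerate_simplex.shape (vertices K) A g b c \<and>
     G K = nondegenerate_simplex.shape_grad (vertices K) A g c)"

lemma shape_eq:
  assumes "K \<in> \<T>"
  shows "nondegenerate_simplex.shape (vertices K) A g b c = (\<lambda>x. g \<bullet> x + b + c * gcr_bubble A K x)"
  using nondegenerate_simplex.shape_def[OF mesh_vertices(1)[OF assms]] mesh_vertices(2)[OF assms] by auto

lemma shape_family_C1:
  assumes "shape_family F G" and K: "K \<in> \<T>"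
  shows "C1_with (F K) (G K)"
proof -
  interpret S: nondegenerate_simplex "vertices K"
    by (rule mesh_vertices(1)[OF K])
  show ?thesis
    using assms S.C1_shape[of A] B_bar_sym[OF K] mesh_vertices(2)[OF K] unfolding shape_family_def by auto
qed

lemma shape_family_L2: "shape_family F G \<Longrightarrow> L2_family F" "shape_family F G \<Longrightarrow> L2_family G"
  using shape_family_C1 C1_L2_space compact_mesh by blast+

lemma shape_family_weak_grad:
  assumes s: "shape_family F G" and w: "agrees w F" and K: "K \<in> \<T>"
  shows "is_weak_grad (interior K) w (G K)"
proof (rule is_weak_grad_cong_AE[OF is_weak_grad_C1[OF shape_family_C1[OF s K]]])
  have "AE x in lebesgue. x \<in> K \<longrightarrow> w x = F K x"
    using w K unfolding agrees_def by blast
  then show "AE x in lebesgue. x \<in> interior K \<longrightarrow> F K x = w x"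
    by eventually_elim (use interior_subset[of K] in auto)
qed

lemma V_GCR_shape_family:
  assumes "w \<in> V_GCR A \<Omega> \<T>"
  obtains F G where "shape_family F G" "agrees w F"
proof -
  obtain v z where w: "w = (\<lambda>x. v x + z x)" "v \<in> V_CR \<Omega> \<T>" "z \<in> V_B A \<Omega> \<T>"
    using assms unfolding V_GCR_def by blast
  have "\<exists>p. \<forall>K\<in>\<T>. (\<exists>a b. p K = (\<lambda>x. a \<bullet> x + b)) \<and> (AE x in lebesgue. x \<in> K \<longrightarrow> v x = p K x)"
    using w(2) unfolding V_CR_def mem_Collect_eq by (elim conjE exE) (rule exI, assumption)
  then obtain p where p: "\<forall>K\<in>\<T>. (\<exists>a b. p K = (\<lambda>x. a \<bullet> x + b)) \<and> (AE x in lebesgue. x \<in> K \<longrightarrow> v x = p K x)"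
    by (rule exE)
  have "\<forall>K\<in>\<T>. \<exists>t. AE x in lebesgue. x \<in> K \<longrightarrow> w x =
      nondegenerate_simplex.shape (vertices K) A (fst t) (fst (snd t)) (snd (snd t)) x"
  proof
    fix K assume K: "K \<in> \<T>"
    then obtain a b where "p K = (\<lambda>x. a \<bullet> x + b)" "AE x in lebesgue. x \<in> K \<longrightarrow> v x = p K x"
      using p by blast
    then have ab: "AE x in lebesgue. x \<in> K \<longrightarrow> v x = a \<bullet> x + b"
      by simp
    obtain c where c: "AE x in lebesgue. x \<in> K \<longrightarrow> z x = c * gcr_bubble A K x"
      using w(3) K unfolding V_B_def by blast
    from ab c have "AE x in lebesgue. x \<in> K \<longrightarrow> w x =
        nondegenerate_simplex.shape (vertices K) A (fst (a, b, c)) (fst (snd (a, b, c))) (snd (snd (a, b, c))) x"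
      by eventually_elim (simp add: w(1) shape_eq[OF K])
    then show "\<exists>t. AE x in lebesgue. x \<in> K \<longrightarrow> w x =
      nondegenerate_simplex.shape (vertices K) A (fst t) (fst (snd t)) (snd (snd t)) x" ..
  qed
  then obtain t where t: "\<forall>K\<in>\<T>. AE x in lebesgue. x \<in> K \<longrightarrow> w x =
      nondegenerate_simplex.shape (vertices K) A (fst (t K)) (fst (snd (t K))) (snd (snd (t K))) x"
    by (rule bchoice[THEN exE])
  show ?thesis
  proof (rule that)
    show "shape_family (\<lambda>K. nondegenerate_simplex.shape (vertices K) A (fst (t K)) (fst (snd (t K))) (snd (snd (t K))))
      (\<lambda>K. nondegenerate_simplex.shape_grad (vertices K) A (fst (t K)) (snd (snd (t K))))"
      unfolding shape_family_def by blast
    show "agrees w (\<lambda>K. nondegenerate_simplex.shape (vertices K) A (fst (t K)) (fst (snd (t K))) (snd (snd (t K))))"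
      using t unfolding agrees_def .
  qed
qed

lemma flux_limit:
  assumes \<phi>: "\<And>j. test_function \<Omega> (\<phi> j)" "L2_tendsto \<Omega> \<phi> u" "L2_tendsto \<Omega> (\<lambda>j x. \<chi> i. partial i (\<phi> j) x) G"
    and K: "K \<in> \<T>"
  shows "(\<lambda>j. flux K a (\<phi> j) (\<lambda>x. \<chi> i. partial i (\<phi> j) x)) \<longlonglongrightarrow> flux K a u G"
  by (rule flux_tendsto[OF compact_mesh[OF K] L2_tendsto_mesh[OF \<phi>(2) K] L2_tendsto_mesh[OF \<phi>(3) K]])

text \<open>The interpolant has the same fluxes and element means as \<open>u\<close>. That its affine part satisfies the
  face conditions of \<^const>\<open>V_CR\<close> carries over from the approximating test functions.\<close>

lemma interpolation:
  assumes \<phi>: "\<And>j. test_function \<Omega> (\<phi> j)" "L2_tendsto \<Omega> \<phi> u" "L2_tendsto \<Omega> (\<lambda>j x. \<chi> i. partial i (\<phi> j) x) G"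
  obtains w F H where "w \<in> V_GCR A \<Omega> \<T>" "agrees w F" "shape_family F H"
    "\<And>K a. K \<in> \<T> \<Longrightarrow> a \<in> vertices K \<Longrightarrow> flux K a (\<lambda>x. u x - F K x) (\<lambda>x. G x - H K x) = 0"
    "\<And>K. K \<in> \<T> \<Longrightarrow> L2_inner K (\<lambda>x. u x - F K x) (\<lambda>x. 1) = 0"
proof -
  let ?sh = "\<lambda>K t. nondegenerate_simplex.shape (vertices K) A (fst t) (fst (snd t)) (snd (snd t))"
  let ?sg = "\<lambda>K t. nondegenerate_simplex.shape_grad (vertices K) A (fst t) (snd (snd t))"
  have uL2: "u \<in> L2_space K" and GL2: "G \<in> L2_space K" if "K \<in> \<T>" for K
    using L2_tendstoD(1)[OF L2_tendsto_mesh[OF \<phi>(2) that]] L2_tendstoD(1)[OF L2_tendsto_mesh[OF \<phi>(3) that]] by auto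
  have "\<forall>K\<in>\<T>. \<exists>t. (\<forall>a\<in>vertices K. flux K a (?sh K t) (?sg K t) = flux K a u G) \<and>
      L2_inner K (?sh K t) (\<lambda>x. 1) = L2_inner K u (\<lambda>x. 1) \<and>
      (\<forall>a\<in>vertices K. (\<Sum>p\<in>vertices K - {a}. fst t \<bullet> p + fst (snd t)) = flux K a u G / measure lborel K)"
  proof
    fix K assume K: "K \<in> \<T>"
    interpret S: nondegenerate_simplex "vertices K"
      by (rule mesh_vertices(1)[OF K])
    note [simp] = mesh_vertices(2)[OF K]
    have sym: "transpose (B_bar A S.K) = B_bar A S.K"
      using B_bar_sym[OF K] by simp
    obtain g b c where gbc:
      "\<And>a. a \<in> vertices K \<Longrightarrow> flux S.K a (S.shape A g b c) (S.shape_grad A g c) = flux K a u G"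
      "L2_inner S.K (S.shape A g b c) (\<lambda>x. 1) = L2_inner K u (\<lambda>x. 1)"
      "\<And>a. a \<in> vertices K \<Longrightarrow> (\<Sum>p\<in>vertices K - {a}. g \<bullet> p + b) = flux K a u G / measure lborel S.K"
      using S.element_interpolation[OF sym vertex_energy_mesh[OF K], of "\<lambda>a. flux K a u G" "L2_inner K u (\<lambda>x. 1)"]
      by blast
    show "\<exists>t. (\<forall>a\<in>vertices K. flux K a (?sh K t) (?sg K t) = flux K a u G) \<and>
      L2_inner K (?sh K t) (\<lambda>x. 1) = L2_inner K u (\<lambda>x. 1) \<and>
      (\<forall>a\<in>vertices K. (\<Sum>p\<in>vertices K - {a}. fst t \<bullet> p + fst (snd t)) = flux K a u G / measure lborel K)"
      using gbc by (intro exI[of _ "(g, b, c)"]) simp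
  qed
  then obtain t where t: "\<forall>K\<in>\<T>. (\<forall>a\<in>vertices K. flux K a (?sh K (t K)) (?sg K (t K)) = flux K a u G) \<and>
      L2_inner K (?sh K (t K)) (\<lambda>x. 1) = L2_inner K u (\<lambda>x. 1) \<and>
      (\<forall>a\<in>vertices K. (\<Sum>p\<in>vertices K - {a}. fst (t K) \<bullet> p + fst (snd (t K))) = flux K a u G / measure lborel K)"
    by (rule bchoice[THEN exE])
  define g where "g K = fst (t K)" for K
  define b where "b K = fst (snd (t K))" for K
  define c where "c K = snd (snd (t K))" for K
  define F where "F K = ?sh K (t K)" for K
  define H where "H K = ?sg K (t K)" for K
  define l where "l K x = g K \<bullet> x + b K" for K x
  define \<beta> where "\<beta> K x = c K * gcr_bubble A K x" for K x
  have sf: "shape_family F H"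
    unfolding shape_family_def F_def H_def by blast
  have F: "F K x = l K x + \<beta> K x" if "K \<in> \<T>" for K x
    by (simp add: F_def shape_eq[OF that] l_def \<beta>_def g_def b_def c_def)
  have sums: "(\<Sum>p\<in>vertices K - {a}. l K p) = flux K a u G / measure lborel K" if "K \<in> \<T>" "a \<in> vertices K" for K a
    using t that by (simp add: l_def g_def b_def)
  let ?w = "\<lambda>x. glue l x + glue \<beta> x"
  have ag: "AE x in lebesgue. x \<in> K \<longrightarrow> glue l x = l K x" "AE x in lebesgue. x \<in> K \<longrightarrow> glue \<beta> x = \<beta> K x"
    if "K \<in> \<T>" for K
    using agrees_glue that unfolding agrees_def by blast+
  have wF: "agrees ?w F"
    unfolding agrees_def
  proof
    fix K assume K: "K \<in> \<T>"
    from ag[OF K] show "AE x in lebesgue. x \<in> K \<longrightarrow> ?w x = F K x"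
      by eventually_elim (simp add: F[OF K])
  qed
  have lL2: "l K \<in> L2_space K" and \<beta>L2: "\<beta> K \<in> L2_space K" if K: "K \<in> \<T>" for K
  proof -
    show lK: "l K \<in> L2_space K"
      unfolding l_def[abs_def] by (intro continuous_L2_space compact_mesh K continuous_intros)
    have "F K \<in> L2_space K"
      using shape_family_L2(1)[OF sf] K by blast
    from L2_space_diff[OF this lK] show "\<beta> K \<in> L2_space K"
      by (simp add: F[OF K])
  qed
  \<comment> \<open>Covers both kinds of faces: the second affine function is that of the neighbour
    on an interior face and 0 on a boundary face.\<close>
  have zero: "face_integral (convex hull (vertices K - {a})) (\<lambda>x. l K x - (g' \<bullet> x + b')) = 0"
    if "K \<in> \<T>" "a \<in> vertices K" "(\<Sum>p\<in>vertices K - {a}. l K p) = (\<Sum>p\<in>vertices K - {a}. g' \<bullet> p + b')" for K a g' b'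
  proof -
    have "(\<Sum>p\<in>vertices K - {a}. (g K - g') \<bullet> p + (b K - b')) = (\<Sum>p\<in>vertices K - {a}. l K p - (g' \<bullet> p + b'))"
      by (intro sum.cong refl) (simp add: l_def inner_diff_left)
    also have "\<dots> = 0"
      unfolding sum_subtractf that(3) by simp
    finally have "face_integral (convex hull (vertices K - {a})) (\<lambda>x. (g K - g') \<bullet> x + (b K - b')) = 0"
      by (rule nondegenerate_simplex.face_integral_affine_eq_0[OF mesh_vertices(1)[OF that(1)] that(2)])
    moreover have "(g K - g') \<bullet> x + (b K - b') = l K x - (g' \<bullet> x + b')" for x
      by (simp add: l_def inner_diff_left)
    ultimately show ?thesis by (simp only:)
  qed
  have pos: "measure lborel K > 0" if "K \<in> \<T>" for K
    using nondegenerate_simplex.measure_K_pos[OF mesh_vertices(1)[OF that]] mesh_vertices(2)[OF that] by simp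
  note \<phi>C1 = C1_with_test_function[OF \<phi>(1)]
  have interior: "face_integral E (\<lambda>x. l K x - l K' x) = 0"
    if K: "K \<in> \<T>" and K': "K' \<in> \<T>" and E: "E facet_of K" "E facet_of K'" for E K K'
  proof -
    note V = mesh_vertices[OF K] and V' = mesh_vertices[OF K']
    obtain a where a: "a \<in> vertices K" "E = convex hull (vertices K - {a})"
      using facet_vertices[OF V(1)] E(1) V(2) by metis
    obtain a' where a': "a' \<in> vertices K'" "E = convex hull (vertices K' - {a'})"
      using facet_vertices[OF V'(1)] E(2) V'(2) by metis
    have W: "vertices K - {a} = vertices K' - {a'}"
    proof (rule convex_hull_eq_imp_eq)
      show "\<not> affine_dependent (vertices K - {a})"
        by (rule affine_independent_Diff[OF nondegenerate_simplex.indep[OF V(1)]])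
      show "\<not> affine_dependent (vertices K' - {a'})"
        by (rule affine_independent_Diff[OF nondegenerate_simplex.indep[OF V'(1)]])
      show "convex hull (vertices K - {a}) = convex hull (vertices K' - {a'})"
        using a(2) a'(2) by (simp only:)
    qed
    have ins: "vertices K' = insert a' (vertices K - {a})" "a' \<notin> vertices K - {a}"
      using W a'(1) by auto
    have eq: "measure lborel K * flux K' a' (\<phi> j) (\<lambda>x. \<chi> i. partial i (\<phi> j) x)
      = measure lborel K' * flux K a (\<phi> j) (\<lambda>x. \<chi> i. partial i (\<phi> j) x)" for j
      using nondegenerate_simplex.flux_match[OF V(1) a(1) ins V'(1) \<phi>C1] by (simp only: V(2) V'(2))
    have "(\<lambda>j. measure lborel K * flux K' a' (\<phi> j) (\<lambda>x. \<chi> i. partial i (\<phi> j) x)) \<longlonglongrightarrow> measure lborel K * flux K' a' u G"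
      by (intro tendsto_mult_left flux_limit[OF \<phi> K'])
    moreover have "(\<lambda>j. measure lborel K' * flux K a (\<phi> j) (\<lambda>x. \<chi> i. partial i (\<phi> j) x)) \<longlonglongrightarrow> measure lborel K' * flux K a u G"
      by (intro tendsto_mult_left flux_limit[OF \<phi> K])
    ultimately have "measure lborel K * flux K' a' u G = measure lborel K' * flux K a u G"
      unfolding eq by (rule LIMSEQ_unique)
    \<comment> \<open>Flux per volume is n times the face mean and therefore depends only on the
      face, not on the simplex from which it is computed.\<close>
    then have "flux K a u G / measure lborel K = flux K' a' u G / measure lborel K'"
      using pos[OF K] pos[OF K'] by (simp add: field_simps)
    then have "(\<Sum>p\<in>vertices K - {a}. l K p) = (\<Sum>p\<in>vertices K - {a}. g K' \<bullet> p + b K')"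
      using sums[OF K a(1)] sums[OF K' a'(1)] unfolding W by (simp add: l_def)
    from zero[OF K a(1) this] show ?thesis
      unfolding a(2) by (simp add: l_def)
  qed
  have boundary: "face_integral E (l K) = 0" if K: "K \<in> \<T>" and E: "E facet_of K" "E \<subseteq> frontier \<Omega>" for E K
  proof -
    note V = mesh_vertices[OF K]
    obtain a where a: "a \<in> vertices K" "E = convex hull (vertices K - {a})"
      using facet_vertices[OF V(1)] E(1) V(2) by metis
    \<comment> \<open>Test functions vanish outside the open set \<Omega>, in particular on a face
      contained in its frontier.\<close>
    have "flux K a (\<phi> j) (\<lambda>x. \<chi> i. partial i (\<phi> j) x) = 0" for j
    proof -
      have "\<phi> j x = 0" if "x \<in> convex hull (vertices K - {a})" for x
      proof -
        have "x \<notin> \<Omega>"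
          using that E(2) a(2) \<Omega>(1) by (auto simp: frontier_def interior_open)
        then show ?thesis
          using test_functionD(5,6)[OF \<phi>(1)] by blast
      qed
      then show ?thesis
        using nondegenerate_simplex.flux_eq_0[OF V(1) a(1) \<phi>C1] by (simp only: V(2))
    qed
    then have "flux K a u G = 0"
      using flux_limit[OF \<phi> K, of a] by (simp add: LIMSEQ_const_iff)
    then have "(\<Sum>p\<in>vertices K - {a}. l K p) = (\<Sum>p\<in>vertices K - {a}. 0 \<bullet> p + 0)"
      using sums[OF K a(1)] by simp
    from zero[OF K a(1) this] show ?thesis
      unfolding a(2) by simp
  qed
  have "glue l \<in> V_CR \<Omega> \<T>"
    unfolding V_CR_def
  proof (intro CollectI conjI exI[of _ l] ballI impI)
    show "glue l \<in> L2_space \<Omega>"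
      by (rule L2_space_agrees[OF agrees_glue lL2])
    show "\<exists>a b. l K = (\<lambda>x. a \<bullet> x + b)" for K
      unfolding l_def[abs_def] by blast
  qed (use ag interior boundary in \<open>auto simp: boundary_faces_def\<close>)
  moreover have "glue \<beta> \<in> V_B A \<Omega> \<T>"
    unfolding V_B_def
  proof (intro CollectI conjI ballI)
    show "glue \<beta> \<in> L2_space \<Omega>"
      by (rule L2_space_agrees[OF agrees_glue \<beta>L2])
    show "\<exists>c. AE x in lebesgue. x \<in> K \<longrightarrow> glue \<beta> x = c * gcr_bubble A K x" if "K \<in> \<T>" for K
      using ag(2)[OF that] unfolding \<beta>_def by blast
  qed
  ultimately have wV: "?w \<in> V_GCR A \<Omega> \<T>"
    unfolding V_GCR_def by blast
  show ?thesis
  proof (rule that[OF wV wF sf])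
    fix K assume K: "K \<in> \<T>"
    have FK: "F K \<in> L2_space K" "H K \<in> L2_space K"
      using shape_family_L2[OF sf] K by auto
    show "flux K a (\<lambda>x. u x - F K x) (\<lambda>x. G x - H K x) = 0" if "a \<in> vertices K" for a
      using t K that flux_diff[OF compact_mesh[OF K] uL2[OF K] GL2[OF K] FK] by (simp add: F_def H_def)
    show "L2_inner K (\<lambda>x. u x - F K x) (\<lambda>x. 1) = 0"
      using t K L2_inner_diff_left[OF uL2[OF K] FK(1) continuous_L2_space[OF continuous_on_const compact_mesh[OF K]], of 1]
      by (simp add: F_def)
  qed
qed

end

section \<open>Comparison of the eigenvalues\<close>

context gcr_mesh
begin

lemma form_orthogonal:
  assumes X: "\<And>K. K \<in> \<T> \<Longrightarrow> v K \<in> L2_space K" "L2_family X"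
    and flux: "\<And>K a. K \<in> \<T> \<Longrightarrow> a \<in> vertices K \<Longrightarrow> flux K a (v K) (X K) = 0"
    and mean: "\<And>K. K \<in> \<T> \<Longrightarrow> L2_inner K (v K) (\<lambda>x. 1) = 0"
    and s: "shape_family F H"
  shows "form X H = 0"
  unfolding form_def
proof (intro sum.neutral ballI)
  fix K assume K: "K \<in> \<T>"
  interpret S: nondegenerate_simplex "vertices K"
    by (rule mesh_vertices(1)[OF K])
  obtain g c where H: "H K = S.shape_grad A g c"
    using s K unfolding shape_family_def by blast
  have "L2_inner S.K (X K) (\<lambda>x. A (mid K) *v S.shape_grad A g c x) = 0"
    by (rule S.shape_orthogonal[where v = "v K"])
      (use K X flux mean A_mid_B_bar in \<open>simp_all add: mesh_vertices(2)\<close>)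
  then show "L2_inner K (\<lambda>x. A (mid K) *v X K x) (H K) = 0"
    by (simp add: L2_inner_matrix_sym[OF A_mid_sym[OF K]] H mesh_vertices(2)[OF K])
qed

lemma poincare_mesh:
  assumes K: "K \<in> \<T>" and v: "L2_tendsto K f v" "L2_tendsto K f' vg" "\<And>j. C1_with (f j) (f' j)"
    and mean: "L2_inner K v (\<lambda>x. 1) = 0"
  shows "L2_norm K v \<le> sqrt (2 ^ CARD('n) * (mesh_size \<T>)\<^sup>2) * L2_norm K vg"
proof -
  interpret S: nondegenerate_simplex "vertices K"
    by (rule mesh_vertices(1)[OF K])
  note eq = mesh_vertices(2)[OF K]
  have "L2_inner K v v \<le> 2 ^ CARD('n) * (mesh_size \<T>)\<^sup>2 * L2_inner K vg vg"
    using S.poincare_L2[unfolded eq, OF v norm_le_mesh_size[OF K] mean] .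
  then show ?thesis
    by (simp add: L2_norm_def flip: real_sqrt_mult)
qed

text \<open>Everything that concerns a single mesh, before saturation and smallness of h enter; the
  only constants are those of coercivity and of the Poincare inequality.\<close>

lemma estimate:
  assumes u: "u \<in> H1_0 \<Omega>" and eigen: "eigenpair A \<Omega> \<mu> u" and eigen_h: "gcr_eigenpair A \<Omega> \<T> \<nu> uh"
  defines "e \<equiv> A_norm A \<Omega> (nc_grad \<T> (\<lambda>x. u x - uh x))" and "d \<equiv> L2_norm \<Omega> (\<lambda>x. u x - uh x)"
    and "h \<equiv> mesh_size \<T>"
  shows "0 \<le> e" "0 \<le> \<nu>" "\<nu> \<le> 2 * \<mu> + 2 * e\<^sup>2"
    "e\<^sup>2 - \<nu> * d\<^sup>2 - 2 * \<nu> * (2 ^ CARD('n) * h\<^sup>2 * (C\<^sub>0 * e * sqrt \<nu>)) \<le> \<mu> - \<nu>"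
proof -
  define G where "G = weak_grad \<Omega> u"
  have uH1: "u \<in> H1 \<Omega>"
    using u by (simp add: H1_0_def)
  note Gw = H1_weak_grad[OF \<Omega>(1) uH1, folded G_def]
  obtain \<phi> where \<phi>: "\<And>j. test_function \<Omega> (\<phi> j)" "L2_tendsto \<Omega> \<phi> u"
    "L2_tendsto \<Omega> (\<lambda>j x. \<chi> i. partial i (\<phi> j) x) G"
    using H1_0_approximation[OF \<Omega>(1) u, folded G_def] by blast
  obtain w F H where w: "w \<in> V_GCR A \<Omega> \<T>" "agrees w F" "shape_family F H"
    and flux: "\<And>K a. K \<in> \<T> \<Longrightarrow> a \<in> vertices K \<Longrightarrow> flux K a (\<lambda>x. u x - F K x) (\<lambda>x. G x - H K x) = 0"
    and mean: "\<And>K. K \<in> \<T> \<Longrightarrow> L2_inner K (\<lambda>x. u x - F K x) (\<lambda>x. 1) = 0"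
  proof (rule interpolation[OF \<phi>])
    fix w F H
    assume a: "w \<in> V_GCR A \<Omega> \<T>" "agrees w F" "shape_family F H"
      "\<And>K a. K \<in> \<T> \<Longrightarrow> a \<in> vertices K \<Longrightarrow> flux K a (\<lambda>x. u x - F K x) (\<lambda>x. G x - H K x) = 0"
      "\<And>K. K \<in> \<T> \<Longrightarrow> L2_inner K (\<lambda>x. u x - F K x) (\<lambda>x. 1) = 0"
    show thesis by (rule that[OF a])
  qed
  have uh: "uh \<in> V_GCR A \<Omega> \<T>" "L2_norm \<Omega> uh = 1"
    and uh_eq: "\<And>v. v \<in> V_GCR A \<Omega> \<T> \<Longrightarrow> A_inner A \<Omega> (nc_grad \<T> uh) (nc_grad \<T> v) = \<nu> * L2_inner \<Omega> uh v"
    using eigen_h unfolding gcr_eigenpair_def by blast+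
  obtain Fh Hh where Fh: "shape_family Fh Hh" "agrees uh Fh"
    using V_GCR_shape_family[OF uh(1)] .
  let ?G = "\<lambda>_::(real^'n) set. G"
  let ?X = "\<lambda>K x. G x - H K x" and ?N = "\<lambda>K x. G x - Hh K x"
  have L2: "L2_family ?G" "L2_family (\<lambda>_. u)" "L2_family F" "L2_family H" "L2_family Fh" "L2_family Hh"
    using L2_space_mesh[OF Gw(2)] L2_space_mesh[OF Gw(3)] shape_family_L2[OF w(3)] shape_family_L2[OF Fh(1)] by blast+
  have X2: "L2_family ?X" and N2: "L2_family ?N"
    using L2 by (auto intro: L2_space_diff)
  have v2: "(\<lambda>x. u x - F K x) \<in> L2_space K" if "K \<in> \<T>" for K
    using L2 that by (auto intro: L2_space_diff)
  have nH: "agrees (nc_grad \<T> w) H"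
    by (rule agrees_nc_grad[OF shape_family_weak_grad[OF w(3,2)]])
  have nHh: "agrees (nc_grad \<T> uh) Hh"
    by (rule agrees_nc_grad[OF shape_family_weak_grad[OF Fh]])
  have nN: "agrees (nc_grad \<T> (\<lambda>x. u x - uh x)) ?N"
  proof (rule agrees_nc_grad)
    fix K assume K: "K \<in> \<T>"
    show "is_weak_grad (interior K) (\<lambda>x. u x - uh x) (?N K)"
      by (rule is_weak_grad_diff[OF is_weak_grad_subset[OF Gw(1) interior_mesh_subset[OF K]] shape_family_weak_grad[OF Fh K]])
  qed
  have uL2: "u \<in> L2_space \<Omega>" and uhL2: "uh \<in> L2_space \<Omega>" and wL2: "w \<in> L2_space \<Omega>"
    using Gw(3) L2_space_agrees[OF Fh(2)] L2_space_agrees[OF w(2)] L2 by blast+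
  have uu: "L2_inner \<Omega> u u = 1" and uhuh: "L2_inner \<Omega> uh uh = 1"
    using eigen uh(2) L2_norm_square[of \<Omega> u] L2_norm_square[of \<Omega> uh] by (simp_all add: eigenpair_def)
  have GG: "form ?G ?G = \<mu>"
  proof -
    have "A_inner A \<Omega> G G = \<mu> * L2_inner \<Omega> u u"
      using eigen u unfolding eigenpair_def G_def by blast
    then show ?thesis
      using A_inner_form[OF agrees_self agrees_self, of G G] L2(1) uu by simp
  qed
  have HhHh: "form Hh Hh = \<nu>"
    using uh_eq[OF uh(1)] A_inner_form[OF nHh nHh L2(6,6)] uhuh by simp
  have HhH: "form Hh H = \<nu> * L2_inner \<Omega> uh w"
    using uh_eq[OF w(1)] A_inner_form[OF nHh nH L2(6,4)] by simp
  have eN: "e\<^sup>2 = form ?N ?N"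
    unfolding e_def A_norm_def A_inner_form[OF nN nN N2 N2] using form_nonneg[OF N2] by simp
  show e0: "0 \<le> e"
    unfolding e_def A_norm_def A_inner_form[OF nN nN N2 N2] using form_nonneg[OF N2] by simp
  show \<nu>0: "0 \<le> \<nu>"
    using form_nonneg[OF L2(6)] HhHh by simp
  have orth: "form ?X H' = 0" if "shape_family F' H'" for F' H'
    by (rule form_orthogonal[where v = "\<lambda>K x. u x - F K x", OF v2 X2 flux mean that])
  have GHh: "form ?G Hh = \<nu> * L2_inner \<Omega> w uh"
    using orth[OF Fh(1)] form_diff_left[OF L2(1,4,6)] HhH form_commute[of H Hh] by (simp add: L2_inner_commute)
  have NN: "form ?N ?N = \<mu> - 2 * form ?G Hh + \<nu>"
    using form_diff_left[OF L2(1,6) N2] form_diff_right[OF L2(1,6,1)] form_diff_right[OF L2(1,6,6)]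
      form_commute[of Hh ?G] GG HhHh by simp
  \<comment> \<open>\<open>?P\<close> is the family 2 G - Hh. Nonnegativity of its energy is the
    parallelogram estimate, which bounds the discrete eigenvalue before anything is known about its
    distance to \<mu>.\<close>
  show "\<nu> \<le> 2 * \<mu> + 2 * e\<^sup>2"
  proof -
    let ?Y = "\<lambda>K x. Hh K x - G x"
    let ?P = "\<lambda>K x. G x - ?Y K x"
    have Y2: "L2_family ?Y"
      using L2 by (auto intro: L2_space_diff)
    have P2: "L2_family ?P"
      by (rule ballI, rule L2_space_diff) (use L2(1) Y2 in blast)+
    have "form ?P ?P = form ?G ?G - 2 * form ?G ?Y + form ?Y ?Y"
      using form_diff_left[OF L2(1) Y2 P2] form_diff_right[OF L2(1) Y2 L2(1)] form_diff_right[OF L2(1) Y2 Y2]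
        form_commute[of ?Y ?G] by simp
    moreover have "form ?G ?Y = form ?G Hh - \<mu>"
      using form_diff_right[OF L2(6,1,1)] GG by simp
    moreover have "form ?Y ?Y = \<nu> - 2 * form ?G Hh + \<mu>"
      using form_diff_left[OF L2(6,1) Y2] form_diff_right[OF L2(6,1,6)] form_diff_right[OF L2(6,1,1)]
        form_commute[of Hh ?G] GG HhHh by simp
    ultimately show ?thesis
      using form_nonneg[OF P2] NN eN GG by linarith
  qed
  \<comment> \<open>Pythagoras: \<open>?X\<close> is orthogonal to all shape gradients, so the
    interpolant is a best approximation in energy and its error is at most that of the discrete
    eigenfunction.\<close>
  have XX: "form ?X ?X \<le> e\<^sup>2"
  proof -
    let ?Y = "\<lambda>K x. Hh K x - H K x"
    have Y2: "L2_family ?Y"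
      using L2 by (auto intro: L2_space_diff)
    have XY: "form ?X ?Y = 0"
      using form_diff_right[OF L2(6,4) X2] orth[OF Fh(1)] orth[OF w(3)] by simp
    have N: "?N = (\<lambda>K x. ?X K x - ?Y K x)"
      by simp
    have "form ?N ?N = form ?X ?X - 2 * form ?X ?Y + form ?Y ?Y"
      using form_diff_left[OF X2 Y2 N2] form_diff_right[OF X2 Y2 X2] form_diff_right[OF X2 Y2 Y2]
        form_commute[of ?Y ?X] unfolding N[symmetric] by simp
    then show ?thesis
      using XY form_nonneg[OF Y2] eN by simp
  qed
  define \<delta> where "\<delta> = L2_inner \<Omega> (\<lambda>x. u x - w x) uh"
  have \<delta>: "\<bar>\<delta>\<bar> \<le> 2 ^ CARD('n) * h\<^sup>2 * (C\<^sub>0 * e * sqrt \<nu>)"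
  proof -
    let ?p = "2 ^ CARD('n) * h\<^sup>2"
    have local_bound: "\<bar>L2_inner K (\<lambda>x. u x - F K x) (Fh K)\<bar> \<le> ?p * (\<bar>L2_norm K (?X K)\<bar> * \<bar>L2_norm K (Hh K)\<bar>)" if K: "K \<in> \<T>" for K
    proof -
      have k: "measure lborel K > 0"
        using nondegenerate_simplex.measure_K_pos[OF mesh_vertices(1)[OF K]] mesh_vertices(2)[OF K] by simp
      have one: "(\<lambda>x. 1::real) \<in> L2_space K"
        by (intro continuous_L2_space compact_mesh K continuous_intros)
      have oneK: "L2_inner K (\<lambda>x. 1::real) (\<lambda>x. 1) = measure lborel K"
        using compact_mesh[OF K] by (simp add: L2_inner_lborel borel_compact)
      \<comment> \<open>As u minus its interpolant has zero mean on K, the mean of the discrete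
        eigenfunction may be subtracted from the other factor. Each factor then admits a Poincare
        inequality, giving h twice.\<close>
      define m where "m = L2_inner K (Fh K) (\<lambda>x. 1) / measure lborel K"
      let ?v = "\<lambda>x. u x - F K x" and ?z = "\<lambda>x. Fh K x - m"
      have FhK: "Fh K \<in> L2_space K" and HhK: "Hh K \<in> L2_space K"
        using L2 K by auto
      have mL2: "(\<lambda>x. m) \<in> L2_space K"
        by (intro continuous_L2_space compact_mesh K continuous_intros)
      have z2: "?z \<in> L2_space K"
        by (intro L2_space_diff FhK mL2)
      have mconst: "L2_inner K (\<lambda>x. m) f = m * L2_inner K (\<lambda>x. 1) f" if "f \<in> L2_space K" for f
        using L2_inner_lincomb_left[OF one one that, of m 0] by simp
      have zmean: "L2_inner K ?z (\<lambda>x. 1) = 0"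
        using L2_inner_diff_left[OF FhK mL2 one] mconst[OF one] oneK k by (simp add: m_def)
      have "L2_inner K ?v (Fh K) = L2_inner K ?v ?z"
        using L2_inner_diff_right[OF FhK mL2 v2[OF K]] mconst[OF v2[OF K]] mean[OF K]
        by (simp add: L2_inner_commute[of K ?v])
      then have "\<bar>L2_inner K ?v (Fh K)\<bar> \<le> L2_norm K ?v * L2_norm K ?z"
        using L2_Cauchy_Schwarz[OF v2[OF K] z2] by simp
      also have "\<dots> \<le> (sqrt ?p * L2_norm K (?X K)) * (sqrt ?p * L2_norm K (Hh K))"
      proof (rule mult_mono)
        show "L2_norm K ?v \<le> sqrt ?p * L2_norm K (?X K)"
          unfolding h_def
        proof (rule poincare_mesh[OF K _ _ _ mean[OF K]])
          show "L2_tendsto K (\<lambda>j x. \<phi> j x - F K x) ?v"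
            by (intro L2_tendsto_diff_const L2_tendsto_mesh[OF \<phi>(2) K]) (use L2 K in auto)
          show "L2_tendsto K (\<lambda>j x. (\<chi> i. partial i (\<phi> j) x) - H K x) (?X K)"
            by (intro L2_tendsto_diff_const L2_tendsto_mesh[OF \<phi>(3) K]) (use L2 K in auto)
          show "C1_with (\<lambda>x. \<phi> j x - F K x) (\<lambda>x. (\<chi> i. partial i (\<phi> j) x) - H K x)" for j
            by (intro C1_with_diff C1_with_test_function[OF \<phi>(1)] shape_family_C1[OF w(3) K])
        qed
        show "L2_norm K ?z \<le> sqrt ?p * L2_norm K (Hh K)"
          unfolding h_def
        proof (rule poincare_mesh[OF K _ _ _ zmean])
          show "L2_tendsto K (\<lambda>j. ?z) ?z" "L2_tendsto K (\<lambda>j. Hh K) (Hh K)"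
            using z2 HhK by (simp_all add: L2_tendsto_def L2_norm_def L2_inner_def)
          show "C1_with ?z (Hh K)"
            using C1_with_diff[OF shape_family_C1[OF Fh(1) K] C1_with_affine[of 0 m]] by simp
        qed
      qed (auto intro!: mult_nonneg_nonneg L2_norm_nonneg)
      also have "\<dots> = (sqrt ?p * sqrt ?p) * (L2_norm K (?X K) * L2_norm K (Hh K))"
        by (simp only: mult_ac)
      also have "\<dots> = ?p * (\<bar>L2_norm K (?X K)\<bar> * \<bar>L2_norm K (Hh K)\<bar>)"
        by (simp add: L2_norm_nonneg)
      finally show ?thesis .
    qed
    have "\<delta> = (\<Sum>K\<in>\<T>. L2_inner K (\<lambda>x. u x - F K x) (Fh K))"
      unfolding \<delta>_def
      by (rule L2_inner_agrees[OF agrees_diff[OF agrees_self w(2)] Fh(2) v2]) (use L2 in auto)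
    then have "\<bar>\<delta>\<bar> \<le> (\<Sum>K\<in>\<T>. \<bar>L2_inner K (\<lambda>x. u x - F K x) (Fh K)\<bar>)"
      by simp
    also have "\<dots> \<le> (\<Sum>K\<in>\<T>. ?p * (\<bar>L2_norm K (?X K)\<bar> * \<bar>L2_norm K (Hh K)\<bar>))"
      by (intro sum_mono local_bound)
    also have "\<dots> = ?p * (\<Sum>K\<in>\<T>. \<bar>L2_norm K (?X K)\<bar> * \<bar>L2_norm K (Hh K)\<bar>)"
      by (simp add: sum_distrib_left)
    \<comment> \<open>Discrete Cauchy-Schwarz over the elements; the absolute values were introduced
      to match its form.\<close>
    also have "\<dots> \<le> ?p * (L2_set (\<lambda>K. L2_norm K (?X K)) \<T> * L2_set (\<lambda>K. L2_norm K (Hh K)) \<T>)"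
      by (intro mult_left_mono L2_set_mult_ineq) simp
    also have "\<dots> \<le> ?p * (sqrt (C\<^sub>0 * e\<^sup>2) * sqrt (C\<^sub>0 * \<nu>))"
    proof (intro mult_left_mono mult_mono)
      have "(\<Sum>K\<in>\<T>. L2_inner K (?X K) (?X K)) \<le> C\<^sub>0 * e\<^sup>2"
        using form_coercive[OF X2] mult_left_mono[OF XX, of C\<^sub>0] C\<^sub>0 by linarith
      then show "L2_set (\<lambda>K. L2_norm K (?X K)) \<T> \<le> sqrt (C\<^sub>0 * e\<^sup>2)"
        by (simp add: L2_set_def L2_norm_square)
      have "(\<Sum>K\<in>\<T>. L2_inner K (Hh K) (Hh K)) \<le> C\<^sub>0 * \<nu>"
        using form_coercive[OF L2(6)] HhHh by simp
      then show "L2_set (\<lambda>K. L2_norm K (Hh K)) \<T> \<le> sqrt (C\<^sub>0 * \<nu>)"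
        by (simp add: L2_set_def L2_norm_square)
    qed (use C\<^sub>0 in \<open>auto intro: L2_set_nonneg\<close>)
    also have "sqrt (C\<^sub>0 * e\<^sup>2) * sqrt (C\<^sub>0 * \<nu>) = C\<^sub>0 * e * sqrt \<nu>"
      using C\<^sub>0 e0 by (simp add: real_sqrt_mult)
    finally show ?thesis .
  qed
  have d: "d\<^sup>2 = 2 - 2 * L2_inner \<Omega> u uh"
    unfolding d_def L2_norm_square
    using uu uhuh L2_space_diff[OF uL2 uhL2] uL2 uhL2
    by (simp add: L2_inner_diff_left L2_inner_diff_right L2_inner_commute[of \<Omega> uh u])
  have dd: "\<delta> = L2_inner \<Omega> u uh - L2_inner \<Omega> w uh"
    unfolding \<delta>_def by (rule L2_inner_diff_left[OF uL2 wL2 uhL2])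
  have "\<mu> - \<nu> = e\<^sup>2 - \<nu> * d\<^sup>2 - 2 * \<nu> * \<delta>"
    unfolding eN NN GHh d dd by (simp add: algebra_simps)
  moreover have "2 * \<nu> * \<delta> \<le> 2 * \<nu> * (2 ^ CARD('n) * h\<^sup>2 * (C\<^sub>0 * e * sqrt \<nu>))"
    using \<delta> \<nu>0 by (intro mult_left_mono) auto
  ultimately show "e\<^sup>2 - \<nu> * d\<^sup>2 - 2 * \<nu> * (2 ^ CARD('n) * h\<^sup>2 * (C\<^sub>0 * e * sqrt \<nu>)) \<le> \<mu> - \<nu>"
    by linarith
qed

lemma mesh_size_pos: "mesh_size \<T> > 0"
proof -
  have "\<Union>\<T> \<noteq> {}"
    using mesh(2) \<Omega>(3) by simp
  then obtain K where K: "K \<in> \<T>" by blast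
  interpret S: nondegenerate_simplex "vertices K"
    by (rule mesh_vertices(1)[OF K])
  obtain a where a: "a \<in> vertices K"
    using S.V_nonempty by blast
  obtain b where b: "b \<in> vertices K" "b \<noteq> a"
    by (rule S.other_vertex)
  have "a \<in> K" "b \<in> K"
    using hull_inc[of _ "vertices K" convex] a b mesh_vertices(2)[OF K] by auto
  then have "norm (b - a) \<le> mesh_size \<T>"
    using norm_le_mesh_size[OF K] by blast
  then show ?thesis
    using b(2) by (smt (verit) zero_less_norm_iff right_minus_eq)
qed

end

text \<open>Both error terms are of higher order than \<open>e\<^sup>2\<close>: \<open>d\<^sup>2\<close> by the a priori estimate and \<open>h\<^sup>2 e\<close> since
  \<open>h \<le> h\<^sup>s\<close>; saturation bounds \<open>h\<^sup>s\<close> by \<open>e\<close>.\<close>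

lemma error_terms_absorbed:
  fixes h s e d \<nu> \<Lambda> c C D :: real
  assumes h: "0 < h" "h \<le> 1" and s: "0 < s" "s \<le> 1" and nn: "0 \<le> e" "0 \<le> d" "0 \<le> \<nu>" "0 \<le> C" "0 \<le> D"
    and \<Lambda>: "\<nu> \<le> \<Lambda>" and d: "d \<le> c * h powr (2 * s)" and sat: "h powr (2 * s) \<le> C * e\<^sup>2"
    and small: "\<Lambda> * c\<^sup>2 * C * h powr (2 * s) \<le> 1/2" "2 * \<Lambda> * D * sqrt \<Lambda> * sqrt C * h \<le> 1/2"
  shows "\<nu> * d\<^sup>2 + 2 * \<nu> * (h\<^sup>2 * (D * e * sqrt \<nu>)) \<le> e\<^sup>2"
proof -
  let ?p = "h powr (2 * s)"
  have p: "?p = (h powr s)\<^sup>2"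
    using h by (simp add: power2_eq_square flip: powr_add)
  have \<Lambda>0: "0 \<le> \<Lambda>"
    using nn(3) \<Lambda> by linarith
  have "\<nu> * d\<^sup>2 \<le> \<Lambda> * (c * ?p)\<^sup>2"
    using nn \<Lambda> \<Lambda>0 d by (intro mult_mono power_mono) auto
  also have "\<dots> = (\<Lambda> * c\<^sup>2 * ?p) * ?p"
    by (simp add: power2_eq_square mult_ac)
  also have "\<dots> \<le> (\<Lambda> * c\<^sup>2 * ?p) * (C * e\<^sup>2)"
    using \<Lambda>0 by (intro mult_left_mono sat) auto
  also have "\<dots> = (\<Lambda> * c\<^sup>2 * C * ?p) * e\<^sup>2"
    by (simp add: mult_ac)
  also have "\<dots> \<le> 1/2 * e\<^sup>2"
    by (intro mult_right_mono small) simp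
  finally have 1: "\<nu> * d\<^sup>2 \<le> 1/2 * e\<^sup>2" .
  have "h powr s \<le> sqrt C * e"
  proof (rule power2_le_imp_le)
    show "(h powr s)\<^sup>2 \<le> (sqrt C * e)\<^sup>2"
      using sat nn unfolding p by (simp add: power_mult_distrib)
  qed (use nn in simp)
  moreover have "h \<le> h powr s"
    using powr_mono'[of s 1 h] h s by simp
  ultimately have he: "h \<le> sqrt C * e"
    by linarith
  have "2 * \<nu> * (h\<^sup>2 * (D * e * sqrt \<nu>)) = (2 * \<nu> * D * sqrt \<nu> * h * e) * h"
    by (simp add: power2_eq_square mult_ac)
  also have "\<dots> \<le> (2 * \<nu> * D * sqrt \<nu> * h * e) * (sqrt C * e)"
    using nn h by (intro mult_left_mono he) auto
  also have "\<dots> \<le> (2 * \<Lambda> * D * sqrt \<Lambda> * h * e) * (sqrt C * e)"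
    using nn h \<Lambda> \<Lambda>0 by (intro mult_right_mono mult_mono) auto
  also have "\<dots> = (2 * \<Lambda> * D * sqrt \<Lambda> * sqrt C * h) * e\<^sup>2"
    by (simp add: power2_eq_square mult_ac)
  also have "\<dots> \<le> 1/2 * e\<^sup>2"
    by (intro mult_right_mono small) simp
  finally show ?thesis
    using 1 by linarith
qed

theorem theorem3p1:
  fixes \<Omega> :: "(real^'n) set"
    and \<F> :: "(real^'n) set set set"
    and A :: "real^'n \<Rightarrow> real^'n^'n"
    and s lam :: real
    and u :: "real^'n \<Rightarrow> real"
    and k :: nat
    and lam_GCR :: "(real^'n) set set \<Rightarrow> real"
    and u_GCR :: "(real^'n) set set \<Rightarrow> real^'n \<Rightarrow> real"
  assumes domain: "polytopal_domain \<Omega>"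
    and partitions: "\<And>\<T>. \<T> \<in> \<F> \<Longrightarrow> simplicial_partition \<Omega> \<T>"
    and regular: "shape_regular \<F>"
    and A_sym: "\<And>x. x \<in> \<Omega> \<Longrightarrow> transpose (A x) = A x"
    and A_coercive: "\<exists>C>0. \<forall>q\<in>L2_space \<Omega>. L2_inner \<Omega> q q \<le> C * A_inner A \<Omega> q q"
    and A_piecewise_constant: "\<And>\<T>. \<T> \<in> \<F> \<Longrightarrow> piecewise_constant \<T> A"
    and s: "0 < s" "s \<le> 1"
    and eigen: "eigenpair A \<Omega> lam u" "kth_eigenvalue \<Omega> (eigenpair A \<Omega>) k lam"
    and eigen_GCR: "\<And>\<T>. \<T> \<in> \<F> \<Longrightarrow> gcr_eigenpair A \<Omega> \<T> (lam_GCR \<T>) (u_GCR \<T>)"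
      "\<And>\<T>. \<T> \<in> \<F> \<Longrightarrow> kth_eigenvalue \<Omega> (gcr_eigenpair A \<Omega> \<T>) k (lam_GCR \<T>)"
    and u_regular: "u \<in> H1_0 \<Omega> \<inter> H1s \<Omega> s"
    and a_priori: "\<exists>C>0. \<forall>\<T>\<in>\<F>.
      L2_norm \<Omega> (\<lambda>x. u x - u_GCR \<T> x)
        + mesh_size \<T> powr s * A_norm A \<Omega> (nc_grad \<T> (\<lambda>x. u x - u_GCR \<T> x))
      \<le> C * (mesh_size \<T> powr (2 * s) * H1s_seminorm \<Omega> s u)"
    and saturation: "\<exists>C>0. \<forall>\<T>\<in>\<F>.
      mesh_size \<T> powr (2 * s)
      \<le> C * (A_norm A \<Omega> (nc_grad \<T> (\<lambda>x. u x - u_GCR \<T> x)))\<^sup>2"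
  shows "\<exists>h\<^sub>0>0. \<forall>\<T>\<in>\<F>. mesh_size \<T> < h\<^sub>0 \<longrightarrow> lam_GCR \<T> \<le> lam"
proof -
  obtain C\<^sub>0 where C\<^sub>0: "C\<^sub>0 > 0" "\<forall>q\<in>L2_space \<Omega>. L2_inner \<Omega> q q \<le> C\<^sub>0 * A_inner A \<Omega> q q"
    using A_coercive by blast
  have mesh: "gcr_mesh \<Omega> A \<T> C\<^sub>0" if "\<T> \<in> \<F>" for \<T>
    using domain partitions[OF that] A_sym C\<^sub>0 A_piecewise_constant[OF that] by unfold_locales auto
  obtain C\<^sub>1 where C\<^sub>1: "C\<^sub>1 > 0" "\<And>\<T>. \<T> \<in> \<F> \<Longrightarrow> L2_norm \<Omega> (\<lambda>x. u x - u_GCR \<T> x)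
        + mesh_size \<T> powr s * A_norm A \<Omega> (nc_grad \<T> (\<lambda>x. u x - u_GCR \<T> x))
      \<le> C\<^sub>1 * (mesh_size \<T> powr (2 * s) * H1s_seminorm \<Omega> s u)"
    using a_priori by blast
  obtain C\<^sub>2 where C\<^sub>2: "C\<^sub>2 > 0" "\<And>\<T>. \<T> \<in> \<F> \<Longrightarrow> mesh_size \<T> powr (2 * s)
      \<le> C\<^sub>2 * (A_norm A \<Omega> (nc_grad \<T> (\<lambda>x. u x - u_GCR \<T> x)))\<^sup>2"
    using saturation by blast
  define c where "c = C\<^sub>1 * H1s_seminorm \<Omega> s u"
  \<comment> \<open>A bound for the discrete eigenvalue on all meshes with h at most 1: the a priori
    estimate gives e at most c there, and the discrete eigenvalue is at most twice lam +
    e^2.\<close>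
  define \<Lambda> where "\<Lambda> = 2 * \<bar>lam\<bar> + 2 * c\<^sup>2"
  define D where "D = 2 ^ CARD('n) * C\<^sub>0"
  define \<alpha> where "\<alpha> = \<Lambda> * c\<^sup>2 * C\<^sub>2"
  define \<beta> where "\<beta> = 2 * \<Lambda> * D * sqrt \<Lambda> * sqrt C\<^sub>2"
  \<comment> \<open>Three requirements: h at most 1, and each of the two error terms at most half of
    e^2, that is, \<alpha> h^(2s) and \<beta> h at most 1/2. Adding 1 in the denominators covers the
    cases \<alpha> = 0 and \<beta> = 0.\<close>
  define h\<^sub>0 where "h\<^sub>0 = min 1 (min ((1 / (2 * (\<alpha> + 1))) powr (1 / (2 * s))) (1 / (2 * (\<beta> + 1))))"
  have nn: "0 \<le> \<Lambda>" "0 \<le> D" "0 \<le> \<alpha>" "0 \<le> \<beta>"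
    using C\<^sub>0 C\<^sub>2 by (auto simp: \<Lambda>_def D_def \<alpha>_def \<beta>_def)
  have frac: "a * (1 / (2 * (a + 1))) \<le> 1/2" if "0 \<le> a" for a :: real
    using that by (simp add: field_simps)
  have "h\<^sub>0 > 0"
    using nn by (simp add: h\<^sub>0_def add_nonneg_pos)
  moreover have "lam_GCR \<T> \<le> lam" if \<T>: "\<T> \<in> \<F>" and small: "mesh_size \<T> < h\<^sub>0" for \<T>
  proof -
    interpret gcr_mesh \<Omega> A \<T> C\<^sub>0
      by (rule mesh[OF \<T>])
    let ?h = "mesh_size \<T>"
    define e where "e = A_norm A \<Omega> (nc_grad \<T> (\<lambda>x. u x - u_GCR \<T> x))"
    define d where "d = L2_norm \<Omega> (\<lambda>x. u x - u_GCR \<T> x)"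
    have u: "u \<in> H1_0 \<Omega>"
      using u_regular by blast
    note est = estimate[OF u eigen(1) eigen_GCR(1)[OF \<T>], folded e_def d_def]
    have h: "0 < ?h" "?h \<le> 1"
      using mesh_size_pos small by (auto simp: h\<^sub>0_def)
    have d0: "0 \<le> d"
      by (simp add: d_def L2_norm_nonneg)
    have ap: "d + ?h powr s * e \<le> c * ?h powr (2 * s)"
      using C\<^sub>1(2)[OF \<T>] by (simp add: c_def d_def e_def mult_ac)
    have pw: "?h powr (2 * s) = ?h powr s * ?h powr s"
      by (simp flip: powr_add)
    have d: "d \<le> c * ?h powr (2 * s)"
      using ap mult_nonneg_nonneg[OF powr_ge_zero[of ?h s] est(1)] by linarith
    have "?h powr s * e \<le> ?h powr s * (c * ?h powr s)"
      using ap d0 unfolding pw by (simp add: mult_ac)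
    then have ec: "e \<le> c * ?h powr s"
      using h by simp
    \<comment> \<open>The sign of c is read off from the a priori estimate, since c h^s bounds the
      nonnegative quantity e.\<close>
    have c0: "0 \<le> c"
    proof -
      have "0 \<le> c * ?h powr s"
        using est(1) ec by linarith
      then show ?thesis
        using h by (simp add: zero_le_mult_iff)
    qed
    have "?h powr s \<le> 1"
      using h s by (simp add: powr_le1)
    then have "c * ?h powr s \<le> c"
      using c0 by (simp add: mult_left_le)
    then have "e\<^sup>2 \<le> c\<^sup>2"
      using ec est(1) by (intro power_mono) auto
    then have lam: "lam_GCR \<T> \<le> \<Lambda>"
      using est(3) by (simp add: \<Lambda>_def)
    have "?h powr (2 * s) \<le> ((1 / (2 * (\<alpha> + 1))) powr (1 / (2 * s))) powr (2 * s)"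
      using small h s by (intro powr_mono2) (auto simp: h\<^sub>0_def)
    also have "\<dots> = 1 / (2 * (\<alpha> + 1))"
      using s nn by (simp add: powr_powr)
    finally have "\<alpha> * ?h powr (2 * s) \<le> \<alpha> * (1 / (2 * (\<alpha> + 1)))"
      using nn by (intro mult_left_mono)
    then have s1: "\<Lambda> * c\<^sup>2 * C\<^sub>2 * ?h powr (2 * s) \<le> 1/2"
      using order_trans[OF _ frac[OF nn(3)]] unfolding \<alpha>_def by blast
    have "\<beta> * ?h \<le> \<beta> * (1 / (2 * (\<beta> + 1)))"
      using small nn by (intro mult_left_mono) (auto simp: h\<^sub>0_def)
    then have s2: "2 * \<Lambda> * D * sqrt \<Lambda> * sqrt C\<^sub>2 * ?h \<le> 1/2"
      using order_trans[OF _ frac[OF nn(4)]] unfolding \<beta>_def by blast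
    have sat: "?h powr (2 * s) \<le> C\<^sub>2 * e\<^sup>2"
      using C\<^sub>2(2)[OF \<T>] by (simp add: e_def)
    have "lam_GCR \<T> * d\<^sup>2 + 2 * lam_GCR \<T> * (?h\<^sup>2 * (D * e * sqrt (lam_GCR \<T>))) \<le> e\<^sup>2"
      by (rule error_terms_absorbed[OF h s est(1) d0 est(2) _ nn(2) lam d sat s1 s2]) (use C\<^sub>2 in simp)
    moreover have "?h\<^sup>2 * (D * e * sqrt (lam_GCR \<T>)) = 2 ^ CARD('n) * ?h\<^sup>2 * (C\<^sub>0 * e * sqrt (lam_GCR \<T>))"
      by (simp add: D_def mult_ac)
    ultimately show ?thesis
      using est(4) by simp
  qed
  ultimately show ?thesis by blast
qed

end
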